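(* The linearized Benjamin-Bona-Mahony system $$ \left\{\begin{array}{l} (\partial_t u_j-\partial_x^2\partial_t u_j+\partial_x u_j)(t,x)=0,\quad x\in(0,\ell_j),\ t>0,\ j=1,\dots,N,\\ u_j(t,0)=u_k(t,0),\quad t>0,\ j,k=1,\dots,N,\\ \sum_{j=1}^N\partial_x\partial_t u_j(t,0)=\alpha\,u_1(t,0),\quad t>0,\\ u_j(t,\ell_j)=0,\quad t>0,\ j=1,\dots,N,\\ u_j(0,x)=u_j^0(x),\quad x\in(0,\ell_j),\ j=1,\dots,N, \end{array}\right. $$ is strongly stable, i.e. for all $\underline u^0\in\mathbb H^1_e(\mathcal T)$ $$\lim_{t\to+\infty}\left\|e^{t\mathcal A}\underline u^0\right\|_{\mathbb H^1_e(\mathcal T)}=0,$$ if and only if $$\frac{\ell_i}{\ell_j}\notin\mathbb Q\quad\text{for all }1\le i\ne j\le N.$$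
   Context: $N\ge 1$ is an integer (number of edges), $\ell_1,\dots,\ell_N>0$ are the edge lengths, the edges are identified with the intervals $(0,\ell_j)$, all glued at the central node $x=0$, and $\mathcal T$ denotes the resulting star-shaped network. The constant $\alpha$ satisfies $\alpha>N/2$. $\mathbb L^2(\mathcal T)=\bigoplus_{j=1}^N L^2(0,\ell_j)$ and $\mathbb H^1_e(\mathcal T)=\{\underline u=(u_1,\dots,u_N)\in\bigoplus_{j=1}^N H^1(0,\ell_j):\ u_j(\ell_j)=0,\ u_j(0)=u_k(0)\ \forall j,k=1,\dots,N\}$ (complex-valued functions), with inner product $\langle\underline u,\underline v\rangle=\sum_{j=1}^N\int_0^{\ell_j}(u_j\overline{v_j}+u_j'\overline{v_j'})\,dx$ and the associated norm. For $\underline q\in\mathbb L^2(\mathcal T)$, $(I-\Delta)^{-1}_{\mathcal T}\underline q=\underline w$ denotes the unique solution in $\bigoplus_jH^2(0,\ell_j)$ of $w_j-w_j''=q_j$ on $(0,\ell_j)$, $w_j(\ell_j)=0$, $w_j(0)=w_k(0)$ for all $j,k$, $\sum_{j=1}^N w_j'(0)=0$. Let $\varphi_j(x)=\frac{x-\ell_j}{\ell_j}\left(\sum_{i=1}^N\ell_i^{-1}\right)^{-1}$ and $\underline\varphi=(\varphi_1,\dots,\varphi_N)$. The operator $\mathcal A$ is $$\mathcal A\underline u=-(I-\Delta)^{-1}_{\mathcal T}\partial_x\underline u+\alpha\,u_1(0)\left(\underline\varphi-(I-\Delta)^{-1}_{\mathcal T}\big((1-\partial_x^2)\underline\varphi\big)\right),$$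 where $\partial_x$ and $1-\partial_x^2$ act componentwise, with domain $\mathcal D(\mathcal A)=\{\underline u\in\mathbb H^1_e(\mathcal T):\ \sum_{i=1}^N\partial_x(\mathcal A\underline u)_i(0)=\alpha u_1(0)\}$. Equivalently, $\mathcal A\underline u=\underline v$ is the solution of $v_j-v_j''=-u_j'$ on $(0,\ell_j)$, $v_j(\ell_j)=0$, $v_j(0)=v_k(0)$ for all $j,k$, $\sum_j v_j'(0)=\alpha u_1(0)$. The system above is $\underline u'(t)=\mathcal A\underline u(t)$, $\underline u(0)=\underline u^0$, and $e^{t\mathcal A}\underline u^0=\underline u(t)$ is its solution. *)

theory Defs
  imports "HOL-Analysis.Analysis"
begin

abbreviation interval_measure :: "real \<Rightarrow> real measure"
  where "interval_measure l \<equiv> lebesgue_on {0<..<l}"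

definition L2 :: "real \<Rightarrow> (real \<Rightarrow> complex) set"
  where "L2 l = {f. f \<in> borel_measurable (interval_measure l) \<and>
                    integrable (interval_measure l) (\<lambda>x. (cmod (f x))\<^sup>2)}"

definition test_function :: "real \<Rightarrow> (real \<Rightarrow> real) \<Rightarrow> (real \<Rightarrow> real) \<Rightarrow> bool"
  where "test_function l \<phi> \<phi>' \<longleftrightarrow>
    (\<forall>x. (\<phi> has_real_derivative \<phi>' x) (at x)) \<and> continuous_on UNIV \<phi>' \<and>
    (\<exists>a b. 0 < a \<and> a \<le> b \<and> b < l \<and> (\<forall>x. x \<notin> {a..b} \<longrightarrow> \<phi> x = 0))"

text \<open>Weak derivatives are tested against compactly supported functions of class C1; smooth test
  functions give the same notion.\<close>

definition has_weak_deriv :: "real \<Rightarrow> (real \<Rightarrow> complex) \<Rightarrow> (real \<Rightarrow> complex) \<Rightarrow> bool"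
  where "has_weak_deriv l u g \<longleftrightarrow> u \<in> L2 l \<and> g \<in> L2 l \<and>
    (\<forall>\<phi> \<phi>'. test_function l \<phi> \<phi>' \<longrightarrow>
      (LINT x|interval_measure l. u x * of_real (\<phi>' x)) =
      - (LINT x|interval_measure l. g x * of_real (\<phi> x)))"

text \<open>A weak derivative is determined almost everywhere only; the choice operator picks a
  representative.\<close>

definition weak_deriv :: "real \<Rightarrow> (real \<Rightarrow> complex) \<Rightarrow> (real \<Rightarrow> complex)"
  where "weak_deriv l u = (SOME g. has_weak_deriv l u g)"

text \<open>An element of the Sobolev space of order one is represented by its unique representative that
  is continuous on the closed interval, set to zero outside. Hence equality of elements is
  equality of functions, and the values at 0 and l are the traces.\<close>

definition H1 :: "real \<Rightarrow> (real \<Rightarrow> complex) set"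
  where "H1 l = {u. continuous_on {0..l} u \<and> (\<forall>x. x \<notin> {0..l} \<longrightarrow> u x = 0) \<and>
                    (\<exists>g. has_weak_deriv l u g)}"

definition H2 :: "real \<Rightarrow> (real \<Rightarrow> complex) set"
  where "H2 l = {u \<in> H1 l. \<exists>g \<in> H1 l. has_weak_deriv l u g}"

text \<open>Functions in H2 are continuously differentiable up to the boundary, so the trace of
  the derivative at 0 is a classical one-sided derivative.\<close>

definition deriv_at_node :: "real \<Rightarrow> (real \<Rightarrow> complex) \<Rightarrow> complex"
  where "deriv_at_node l u = vector_derivative u (at 0 within {0..l})"

text \<open>The edges are indexed by {1..N}, and edge j is the interval from 0 (the central node) to l j.
  Components with an index outside {1..N} carry no information and are set to zero.\<close>

type_synonym network_fun = "nat \<Rightarrow> real \<Rightarrow> complex"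

definition H1e :: "nat \<Rightarrow> (nat \<Rightarrow> real) \<Rightarrow> network_fun set"
  where "H1e N l = {u.
    (\<forall>j\<in>{1..N}. u j \<in> H1 (l j) \<and> u j (l j) = 0) \<and>
    (\<forall>j\<in>{1..N}. \<forall>k\<in>{1..N}. u j 0 = u k 0) \<and>
    (\<forall>j. j \<notin> {1..N} \<longrightarrow> u j = (\<lambda>x. 0))}"

definition H1_inner :: "nat \<Rightarrow> (nat \<Rightarrow> real) \<Rightarrow> network_fun \<Rightarrow> network_fun \<Rightarrow> complex"
  where "H1_inner N l u v = (\<Sum>j=1..N. LINT x|interval_measure (l j).
    u j x * cnj (v j x) + weak_deriv (l j) (u j) x * cnj (weak_deriv (l j) (v j) x))"

definition H1_norm :: "nat \<Rightarrow> (nat \<Rightarrow> real) \<Rightarrow> network_fun \<Rightarrow> real"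
  where "H1_norm N l u = sqrt (Re (H1_inner N l u u))"

definition dx :: "(nat \<Rightarrow> real) \<Rightarrow> network_fun \<Rightarrow> network_fun"
  where "dx l u = (\<lambda>j. weak_deriv (l j) (u j))"

definition resolvent_problem :: "nat \<Rightarrow> (nat \<Rightarrow> real) \<Rightarrow> network_fun \<Rightarrow> network_fun \<Rightarrow> bool"
  where "resolvent_problem N l q w \<longleftrightarrow>
    (\<forall>j\<in>{1..N}. w j \<in> H2 (l j) \<and>
      (AE x in interval_measure (l j). w j x - dx l (dx l w) j x = q j x) \<and>
      w j (l j) = 0) \<and>
    (\<forall>j\<in>{1..N}. \<forall>k\<in>{1..N}. w j 0 = w k 0) \<and>
    (\<Sum>j=1..N. deriv_at_node (l j) (w j)) = 0 \<and>
    (\<forall>j. j \<notin> {1..N} \<longrightarrow> w j = (\<lambda>x. 0))"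

definition inv_I_minus_Laplacian :: "nat \<Rightarrow> (nat \<Rightarrow> real) \<Rightarrow> network_fun \<Rightarrow> network_fun"
  where "inv_I_minus_Laplacian N l q = (THE w. resolvent_problem N l q w)"

definition varphi :: "nat \<Rightarrow> (nat \<Rightarrow> real) \<Rightarrow> network_fun"
  where "varphi N l = (\<lambda>j x. if j \<in> {1..N} \<and> x \<in> {0..l j}
    then of_real ((x - l j) / l j * inverse (\<Sum>i=1..N. inverse (l i))) else 0)"

definition BBM_op :: "nat \<Rightarrow> (nat \<Rightarrow> real) \<Rightarrow> real \<Rightarrow> network_fun \<Rightarrow> network_fun"
  where "BBM_op N l \<alpha> u = (\<lambda>j x.
    - inv_I_minus_Laplacian N l (dx l u) j x +
    of_real \<alpha> * u 1 0 *
      (varphi N l j x -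
       inv_I_minus_Laplacian N l
         (\<lambda>k y. varphi N l k y - dx l (dx l (varphi N l)) k y) j x))"

definition BBM_domain :: "nat \<Rightarrow> (nat \<Rightarrow> real) \<Rightarrow> real \<Rightarrow> network_fun set"
  where "BBM_domain N l \<alpha> = {u \<in> H1e N l.
    (\<Sum>i=1..N. deriv_at_node (l i) (BBM_op N l \<alpha> u i)) = of_real \<alpha> * u 1 0}"

text \<open>For v = BBM_op u one has v_j - v_j'' = - u_j' on edge j, v_j (l j) = 0, equal values v_j 0 and
  the sum of the v_j' 0 equal to alpha u_1 0. Hence u'(t) = BBM_op (u t) is the linearized
  Benjamin-Bona-Mahony system with its node and boundary conditions. The time
  derivative is the limit of difference quotients in the norm of H1e (one-sided at time 0). Values of the curve at negative times are irrelevant.\<close>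

definition BBM_solution ::
    "nat \<Rightarrow> (nat \<Rightarrow> real) \<Rightarrow> real \<Rightarrow> network_fun \<Rightarrow> (real \<Rightarrow> network_fun) \<Rightarrow> bool"
  where "BBM_solution N l \<alpha> u0 u \<longleftrightarrow>
    u 0 = u0 \<and>
    (\<forall>t\<ge>0. u t \<in> BBM_domain N l \<alpha> \<and>
      ((\<lambda>s. H1_norm N l
          (\<lambda>j x. (u s j x - u t j x) / of_real (s - t) - BBM_op N l \<alpha> (u t) j x))
        \<longlongrightarrow> 0) (at t within {0..}))"

definition BBM_semigroup ::
    "nat \<Rightarrow> (nat \<Rightarrow> real) \<Rightarrow> real \<Rightarrow> real \<Rightarrow> network_fun \<Rightarrow> network_fun"
  where "BBM_semigroup N l \<alpha> t u0 = (THE v. \<exists>u. BBM_solution N l \<alpha> u0 u \<and> v = u t)"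

definition strongly_stable :: "nat \<Rightarrow> (nat \<Rightarrow> real) \<Rightarrow> real \<Rightarrow> bool"
  where "strongly_stable N l \<alpha> \<longleftrightarrow> (\<forall>u0 \<in> H1e N l.
    ((\<lambda>t. H1_norm N l (BBM_semigroup N l \<alpha> t u0)) \<longlongrightarrow> 0) at_top)"

end

theory Submission
  imports Defs "HOL-Complex_Analysis.Great_Picard" "HOL-Library.Function_Algebras"
begin

text \<open>Write \<open>A\<close> for the operator of the system. Integration by parts on every edge gives the energy identity
\<open>Re \<langle>A u, u\<rangle> = - (\<alpha> - N/2) |u\<^sub>1(0)|\<^sup>2\<close> (\<open>A_energy\<close>), so \<open>A\<close> is dissipative and energy is lost only through
the value at the node. Moreover \<open>A\<close> is compact (\<open>A_compact\<close>): bounded sets of the energy space are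
relatively compact for uniform convergence, and variation of constants expresses \<open>A u\<close> and its
derivative through values and integrals of \<open>u\<close> alone.

The abstract part treats a compact dissipative operator on an inner product space. Along a
trajectory that starts in the range of \<open>A\<close>, limit points exist, and on the trajectory of a limit
point the energy is constant. Such states form a closed invariant subspace on which \<open>A\<close> is
skew-symmetric. A nonzero compact skew-symmetric operator has an eigenvector, so if no eigenvector
without energy loss exists, then every trajectory that starts in the range tends to zero. Thus
\<open>A u(t)\<close> tends to zero for every trajectory, hence \<open>u(t)\<close> tends to zero weakly; averaging a
trajectory with its own far future shows that the limit \<open>c\<close> of \<open>\<parallel>u(t)\<parallel>\<close> satisfies
\<open>c\<^sup>2 \<le> c\<^sup>2 / 2\<close> (\<open>strong_stability\<close>).

It remains to find the eigenfunctions \<open>z\<close> with eigenvalue \<open>\<i>\<omega>\<close>, \<open>\<omega> \<noteq> 0\<close>. They vanish at the node by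
the energy identity, so on each edge \<open>z'' = z + z' / (\<i>\<omega>)\<close> with zero values at both ends, and the
derivatives at the node have sum zero. The factor \<open>exp (- x / (2\<i>\<omega>))\<close> turns the equation into
that of a harmonic oscillator, and a nonzero solution on an edge of length \<open>L\<close> exists exactly if
\<open>1 / (4\<omega>\<^sup>2) - 1 = (k\<pi> / L)\<^sup>2\<close> for some \<open>k \<ge> 1\<close>. The condition on the sum of the derivatives requires
at least two edges on which \<open>z\<close> is nonzero, and their lengths have the ratio of two such integers
(\<open>no_imaginary_eigenvalue\<close>). Conversely, if \<open>l\<^sub>i / l\<^sub>j\<close> is rational, then the two edge solutions with
opposite signs form an eigenfunction, whose trajectory is periodic (\<open>unstable_if_rational\<close>).

Functions of Sobolev order one are handled as primitives of square-integrable functions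
(\<open>is_primitive\<close>). Fubini's theorem on the triangle gives integration by parts for them, and the
lemma of du Bois-Reymond identifies them with the functions that have a weak derivative.\<close>

section \<open>Functions as a real vector space\<close>

instantiation "fun" :: (type, scaleR) scaleR
begin
definition "scaleR c f = (\<lambda>x. c *\<^sub>R f x)"
instance ..
end

lemma scaleR_fun_apply [simp]: "(c *\<^sub>R f) x = c *\<^sub>R f x"
  by (simp add: scaleR_fun_def)

instance "fun" :: (type, real_vector) real_vector
  by standard (auto simp: fun_eq_iff algebra_simps)

section \<open>Inner products on a subspace\<close>

text \<open>Besides the usual Cauchy-Schwarz inequality, this criterion gives the inequality for the pairing of
square-integrable functions and for the form of energy loss, which is only semidefinite.\<close>

lemma discriminant_nonpos:
  assumes "\<And>t::real. 0 \<le> a + 2 * t * b + t\<^sup>2 * c"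
  shows "b\<^sup>2 \<le> a * c"
proof (cases "c = 0")
  case True
  have "b = 0"
  proof (rule ccontr)
    assume "b \<noteq> 0"
    then show False
      \<comment> \<open>At this \<open>t\<close> the affine function takes the value \<open>-1\<close>.\<close>
      using assms[of "- (a + 1) / (2 * b)"] True by (simp add: field_simps)
  qed
  then show ?thesis using True by simp
next
  case False
  have "c > 0"
  proof (rule ccontr)
    assume "\<not> c > 0"
    then have "c < 0" using False by simp
    \<comment> \<open>Large enough for the negative quadratic term to dominate.\<close>
    define t where "t = (\<bar>a\<bar> + 2 * \<bar>b\<bar> + 1) / (- c) + 1"
    have t1: "t \<ge> 1" unfolding t_def using \<open>c < 0\<close> by (simp add: field_simps)
    have "t * (- c) = (\<bar>a\<bar> + 2 * \<bar>b\<bar> + 1) - c"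
      unfolding t_def using \<open>c < 0\<close> by (simp add: field_simps)
    then have *: "t * c < - (\<bar>a\<bar> + 2 * \<bar>b\<bar> + 1) + 0" using \<open>c < 0\<close> by linarith
    have "t * (t * c) \<le> t * (- (\<bar>a\<bar> + 2 * \<bar>b\<bar> + 1))"
      using * t1 by (intro mult_left_mono) auto
    moreover have "a \<le> t * \<bar>a\<bar>" using t1 mult_right_mono[of 1 t "\<bar>a\<bar>"] by auto
    moreover have "t * b \<le> t * \<bar>b\<bar>" using t1 by (intro mult_left_mono) auto
    ultimately have "a + 2 * t * b + t\<^sup>2 * c \<le> - t"
      by (simp add: algebra_simps power2_eq_square)
    then show False using assms[of t] t1 by linarith
  qed
  then show ?thesis
    using assms[of "- b / c"] by (simp add: field_simps power2_eq_square)
qed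

text \<open>The energy space depends on the parameters \<open>N\<close> and \<open>l\<close>, so it is a subset of a vector space rather
than a type, and the inner product is meaningful on this subset only.\<close>

locale inner_on =
  fixes H :: "'a::real_vector set" and ip :: "'a \<Rightarrow> 'a \<Rightarrow> real"
  assumes H_sub: "subspace H"
    and ip_add: "\<And>x y z. x \<in> H \<Longrightarrow> y \<in> H \<Longrightarrow> z \<in> H \<Longrightarrow> ip (x + y) z = ip x z + ip y z"
    and ip_scale: "\<And>c x y. x \<in> H \<Longrightarrow> y \<in> H \<Longrightarrow> ip (c *\<^sub>R x) y = c * ip x y"
    and ip_sym: "\<And>x y. x \<in> H \<Longrightarrow> y \<in> H \<Longrightarrow> ip x y = ip y x"
    and ip_pos: "\<And>x. x \<in> H \<Longrightarrow> x \<noteq> 0 \<Longrightarrow> ip x x > 0"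
begin

definition nrm :: "'a \<Rightarrow> real" where "nrm x = sqrt (ip x x)"

lemma H_zero [simp, intro]: "0 \<in> H"
  and H_add [simp, intro]: "x \<in> H \<Longrightarrow> y \<in> H \<Longrightarrow> x + y \<in> H"
  and H_diff [simp, intro]: "x \<in> H \<Longrightarrow> y \<in> H \<Longrightarrow> x - y \<in> H"
  and H_scale [simp, intro]: "x \<in> H \<Longrightarrow> c *\<^sub>R x \<in> H"
  and H_minus [simp, intro]: "x \<in> H \<Longrightarrow> - x \<in> H"
  and H_sum: "(\<And>i. i \<in> I \<Longrightarrow> f i \<in> H) \<Longrightarrow> sum f I \<in> H"
  using H_sub by (auto simp: subspace_0 subspace_add subspace_diff subspace_mul subspace_neg subspace_sum)

lemma ip_add_right: "x \<in> H \<Longrightarrow> y \<in> H \<Longrightarrow> z \<in> H \<Longrightarrow> ip z (x + y) = ip z x + ip z y"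
  using ip_add ip_sym by (metis H_add)

lemma ip_scale_right: "x \<in> H \<Longrightarrow> y \<in> H \<Longrightarrow> ip y (c *\<^sub>R x) = c * ip y x"
  using ip_scale ip_sym by (metis H_scale)

lemma ip_minus: "x \<in> H \<Longrightarrow> y \<in> H \<Longrightarrow> ip (- x) y = - ip x y"
  using ip_scale[of x y "-1"] by simp

lemma ip_minus_right: "x \<in> H \<Longrightarrow> y \<in> H \<Longrightarrow> ip y (- x) = - ip y x"
  using ip_scale_right[of x y "-1"] by simp

lemma ip_diff: "x \<in> H \<Longrightarrow> y \<in> H \<Longrightarrow> z \<in> H \<Longrightarrow> ip (x - y) z = ip x z - ip y z"
  using ip_add[of x "-y" z] by (simp add: ip_minus)

lemma ip_diff_right: "x \<in> H \<Longrightarrow> y \<in> H \<Longrightarrow> z \<in> H \<Longrightarrow> ip z (x - y) = ip z x - ip z y"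
  using ip_add_right[of x "-y" z] by (simp add: ip_minus_right)

lemma ip_zero [simp]: "y \<in> H \<Longrightarrow> ip 0 y = 0" "y \<in> H \<Longrightarrow> ip y 0 = 0"
  using ip_scale[of y y 0] ip_scale_right[of y y 0] by auto

lemmas ip_linear = ip_add ip_add_right ip_scale ip_scale_right ip_diff ip_diff_right ip_minus
  ip_minus_right

lemma ip_nonneg: "x \<in> H \<Longrightarrow> 0 \<le> ip x x"
  using ip_pos[of x] by (cases "x = 0") auto

lemma nrm_nonneg [simp]: "x \<in> H \<Longrightarrow> 0 \<le> nrm x"
  by (simp add: nrm_def ip_nonneg)

lemma nrm_sq: "x \<in> H \<Longrightarrow> (nrm x)\<^sup>2 = ip x x"
  by (simp add: nrm_def ip_nonneg)

lemma nrm_zero [simp]: "nrm 0 = 0"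
  by (simp add: nrm_def)

lemma nrm_eq_0: "x \<in> H \<Longrightarrow> nrm x = 0 \<longleftrightarrow> x = 0"
  using ip_pos[of x] by (force simp: nrm_def)

lemma nrm_pos: "x \<in> H \<Longrightarrow> x \<noteq> 0 \<Longrightarrow> 0 < nrm x"
  using nrm_eq_0[of x] nrm_nonneg[of x] by linarith

lemma nrm_scale: "x \<in> H \<Longrightarrow> nrm (c *\<^sub>R x) = \<bar>c\<bar> * nrm x"
  by (simp add: nrm_def ip_scale ip_scale_right real_sqrt_mult mult.assoc[symmetric])

lemma nrm_minus: "x \<in> H \<Longrightarrow> nrm (- x) = nrm x"
  by (simp add: nrm_def ip_minus ip_minus_right)

lemma nrm_diff_commute: "x \<in> H \<Longrightarrow> y \<in> H \<Longrightarrow> nrm (x - y) = nrm (y - x)"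
  using nrm_minus[of "x - y"] by simp

lemma Cauchy_Schwarz: assumes "x \<in> H" "y \<in> H" shows "\<bar>ip x y\<bar> \<le> nrm x * nrm y"
proof -
  have "(ip x y)\<^sup>2 \<le> ip x x * ip y y"
  proof (rule discriminant_nonpos)
    fix t :: real
    have "ip (x + t *\<^sub>R y) (x + t *\<^sub>R y) = ip x x + 2 * t * ip x y + t\<^sup>2 * ip y y"
      using assms by (simp add: ip_linear ip_sym[of y x] algebra_simps power2_eq_square)
    then show "0 \<le> ip x x + 2 * t * ip x y + t\<^sup>2 * ip y y"
      using ip_nonneg[of "x + t *\<^sub>R y"] assms by simp
  qed
  then have "(ip x y)\<^sup>2 \<le> (nrm x * nrm y)\<^sup>2"
    using assms by (simp add: power_mult_distrib nrm_sq)
  then show ?thesis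
    using assms by (simp add: abs_le_square_iff[symmetric] abs_mult)
qed

lemma nrm_triangle: assumes "x \<in> H" "y \<in> H" shows "nrm (x + y) \<le> nrm x + nrm y"
proof (rule power2_le_imp_le)
  have "(nrm (x + y))\<^sup>2 = (nrm x)\<^sup>2 + 2 * ip x y + (nrm y)\<^sup>2"
    using assms by (simp add: nrm_sq ip_linear ip_sym[of y x])
  also have "\<dots> \<le> (nrm x)\<^sup>2 + 2 * (nrm x * nrm y) + (nrm y)\<^sup>2"
    using Cauchy_Schwarz[OF assms] by linarith
  finally show "(nrm (x + y))\<^sup>2 \<le> (nrm x + nrm y)\<^sup>2"
    by (simp add: power2_sum)
qed (use assms in auto)

lemma nrm_triangle_diff: "x \<in> H \<Longrightarrow> y \<in> H \<Longrightarrow> nrm (x - y) \<le> nrm x + nrm y"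
  using nrm_triangle[of x "-y"] by (simp add: nrm_minus)

lemma nrm_triangle3: "x \<in> H \<Longrightarrow> y \<in> H \<Longrightarrow> z \<in> H \<Longrightarrow> nrm (x - z) \<le> nrm (x - y) + nrm (y - z)"
  using nrm_triangle[of "x - y" "y - z"] by simp

lemma nrm_diff_le: "x \<in> H \<Longrightarrow> y \<in> H \<Longrightarrow> \<bar>nrm x - nrm y\<bar> \<le> nrm (x - y)"
  using nrm_triangle[of "x - y" y] nrm_triangle[of "y - x" x] nrm_diff_commute[of x y] by auto

lemma nrm_sum: "(\<And>i. i \<in> I \<Longrightarrow> f i \<in> H) \<Longrightarrow> nrm (sum f I) \<le> (\<Sum>i\<in>I. nrm (f i))"
proof (induction I rule: infinite_finite_induct)
  case (insert i I)
  then have "nrm (f i + sum f I) \<le> nrm (f i) + nrm (sum f I)"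
    by (intro nrm_triangle H_sum) auto
  then show ?case using insert by fastforce
qed auto

text \<open>Convergence in norm, relative to the inner product; the type carries no matching topology.\<close>

definition tends :: "('b \<Rightarrow> 'a) \<Rightarrow> 'a \<Rightarrow> 'b filter \<Rightarrow> bool"
  where "tends X y F \<longleftrightarrow> ((\<lambda>n. nrm (X n - y)) \<longlongrightarrow> 0) F"

lemma tendsI_le:
  assumes "(g \<longlongrightarrow> 0) F" "\<forall>\<^sub>F n in F. nrm (X n - y) \<le> g n" "\<forall>\<^sub>F n in F. X n \<in> H" "y \<in> H"
  shows "tends X y F"
  unfolding tends_def
  by (rule tendsto_sandwich[OF _ assms(2) tendsto_const assms(1)])
     (use assms(3,4) in \<open>auto elim!: eventually_mono\<close>)

lemma tends_nrm:
  assumes "tends X y F" "\<forall>\<^sub>F n in F. X n \<in> H" "y \<in> H"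
  shows "((\<lambda>n. nrm (X n)) \<longlongrightarrow> nrm y) F"
proof -
  have "((\<lambda>n. nrm (X n) - nrm y) \<longlongrightarrow> 0) F"
    by (rule Lim_null_comparison[OF _ assms(1)[unfolded tends_def]])
       (use assms(2,3) in \<open>auto elim!: eventually_mono simp: nrm_diff_le\<close>)
  then show ?thesis by (simp add: LIM_zero_iff)
qed

lemma tends_ip:
  assumes "tends X y F" "\<forall>\<^sub>F n in F. X n \<in> H" "y \<in> H" "z \<in> H"
  shows "((\<lambda>n. ip (X n) z) \<longlongrightarrow> ip y z) F"
proof -
  have "((\<lambda>n. ip (X n) z - ip y z) \<longlongrightarrow> 0) F"
  proof (rule Lim_null_comparison)
    show "((\<lambda>n. nrm (X n - y) * nrm z) \<longlongrightarrow> 0) F"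
      using tendsto_mult_right[OF assms(1)[unfolded tends_def], of "nrm z"] by (simp add: mult.commute)
    show "\<forall>\<^sub>F n in F. norm (ip (X n) z - ip y z) \<le> nrm (X n - y) * nrm z"
      using assms(2) by (rule eventually_mono)
        (use assms Cauchy_Schwarz in \<open>auto simp: ip_diff[symmetric]\<close>)
  qed
  then show ?thesis by (simp add: LIM_zero_iff)
qed

lemma tends_ip2:
  assumes "tends X x F" "tends Y y F" "\<forall>\<^sub>F n in F. X n \<in> H" "\<forall>\<^sub>F n in F. Y n \<in> H" "x \<in> H" "y \<in> H"
  shows "((\<lambda>n. ip (X n) (Y n)) \<longlongrightarrow> ip x y) F"
proof -
  have "((\<lambda>n. ip (X n) (Y n) - ip (X n) y) \<longlongrightarrow> 0) F"
  proof (rule Lim_null_comparison)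
    show "((\<lambda>n. nrm (X n) * nrm (Y n - y)) \<longlongrightarrow> 0) F"
      using tendsto_mult[OF tends_nrm[OF assms(1,3,5)] assms(2)[unfolded tends_def]] by simp
    show "\<forall>\<^sub>F n in F. norm (ip (X n) (Y n) - ip (X n) y) \<le> nrm (X n) * nrm (Y n - y)"
      using assms(3,4) by eventually_elim (use assms Cauchy_Schwarz in \<open>auto simp: ip_diff_right[symmetric]\<close>)
  qed
  from tendsto_add[OF this tends_ip[OF assms(1,3,5,6)]] show ?thesis by simp
qed

lemma tends_unique:
  assumes "tends X y F" "tends X z F" "\<forall>\<^sub>F n in F. X n \<in> H" "y \<in> H" "z \<in> H" "F \<noteq> bot"
  shows "y = z"
proof -
  have "((\<lambda>n. nrm (y - z)) \<longlongrightarrow> 0) F"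
  proof (rule tendsto_sandwich[OF _ _ tendsto_const])
    show "\<forall>\<^sub>F n in F. nrm (y - z) \<le> nrm (X n - y) + nrm (X n - z)"
      using assms(3) by (rule eventually_mono)
        (metis assms(4,5) nrm_triangle3 nrm_diff_commute)
    show "((\<lambda>n. nrm (X n - y) + nrm (X n - z)) \<longlongrightarrow> 0) F"
      using tendsto_add[OF assms(1,2)[unfolded tends_def]] by simp
  qed (use assms in auto)
  then have "nrm (y - z) = 0"
    using assms(6) tendsto_unique tendsto_const by blast
  then show ?thesis using nrm_eq_0[of "y - z"] assms by auto
qed

lemma tends_add:
  assumes "tends X x F" "tends Y y F" "\<forall>\<^sub>F n in F. X n \<in> H" "\<forall>\<^sub>F n in F. Y n \<in> H" "x \<in> H" "y \<in> H"
  shows "tends (\<lambda>n. X n + Y n) (x + y) F"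
proof (rule tendsI_le)
  show "((\<lambda>n. nrm (X n - x) + nrm (Y n - y)) \<longlongrightarrow> 0) F"
    using tendsto_add[OF assms(1,2)[unfolded tends_def]] by simp
  show "\<forall>\<^sub>F n in F. nrm (X n + Y n - (x + y)) \<le> nrm (X n - x) + nrm (Y n - y)"
    using assms(3,4)
  proof eventually_elim
    case (elim n)
    have "X n + Y n - (x + y) = (X n - x) + (Y n - y)" by simp
    then show ?case using elim assms nrm_triangle[of "X n - x" "Y n - y"] by (metis H_diff)
  qed
  show "\<forall>\<^sub>F n in F. X n + Y n \<in> H" using assms(3,4) by eventually_elim auto
qed (use assms in auto)

lemma tends_const: "tends (\<lambda>_. x) x F"
  by (simp add: tends_def)

lemma tends_scale:
  assumes "tends X x F" "\<forall>\<^sub>F n in F. X n \<in> H" "x \<in> H"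
  shows "tends (\<lambda>n. c *\<^sub>R X n) (c *\<^sub>R x) F"
proof (rule tendsI_le)
  show "((\<lambda>n. \<bar>c\<bar> * nrm (X n - x)) \<longlongrightarrow> 0) F"
    using tendsto_mult_left[OF assms(1)[unfolded tends_def], of "\<bar>c\<bar>"] by simp
  show "\<forall>\<^sub>F n in F. nrm (c *\<^sub>R X n - c *\<^sub>R x) \<le> \<bar>c\<bar> * nrm (X n - x)"
    using assms(2) by eventually_elim (simp add: assms(3) nrm_scale scaleR_diff_right[symmetric] del: scaleR_diff_right)
  show "\<forall>\<^sub>F n in F. c *\<^sub>R X n \<in> H" using assms(2) by eventually_elim auto
qed (use assms in auto)

end

lemma eventually_nonneg_within: "\<forall>\<^sub>F s in at t within {0..}. (0::real) \<le> s"
  by (auto simp: eventually_at intro: exI[of _ 1])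

lemma mvt_within:
  fixes f :: "real \<Rightarrow> real"
  assumes "0 \<le> a" "a < b"
    and "\<And>t. t \<ge> 0 \<Longrightarrow> (f has_real_derivative f' t) (at t within {0..})"
  shows "\<exists>t. a < t \<and> t < b \<and> f b - f a = (b - a) * f' t"
proof -
  have "\<exists>t\<in>{a<..<b}. f b - f a = (*) (f' t) (b - a)"
    by (rule mvt_simple[OF assms(2)])
       (use assms in \<open>auto simp: has_field_derivative_def[symmetric] intro!: has_field_derivative_subset[OF assms(3)]\<close>)
  then show ?thesis by (auto simp: mult.commute)
qed

lemma nonneg_derivative_unique:
  fixes f :: "real \<Rightarrow> real"
  assumes "s \<ge> 0" "(f has_real_derivative a) (at s within {0..})" "(f has_real_derivative b) (at s within {0..})"
  shows "a = b"
proof -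
  have "at s within {s<..} \<le> at s within {0..}" using assms(1) by (intro at_le) auto
  then have "at s within {0..} \<noteq> bot" using trivial_limit_at_right_real[of s] bot.extremum_uniqueI by metis
  then show ?thesis using assms(2,3) unfolding has_field_derivative_iff using tendsto_unique by blast
qed

section \<open>Compact dissipative operators\<close>

text \<open>Compactness is stated with sequences, and the limit has to lie in \<open>H\<close>. This also yields
boundedness of \<open>A\<close> and those limits that are usually obtained from completeness.\<close>

locale compact_dissipative = inner_on +
  fixes A :: "'a \<Rightarrow> 'a"
  assumes A_in [simp, intro]: "\<And>x. x \<in> H \<Longrightarrow> A x \<in> H"
    and A_add: "\<And>x y. x \<in> H \<Longrightarrow> y \<in> H \<Longrightarrow> A (x + y) = A x + A y"
    and A_scale: "\<And>c x. x \<in> H \<Longrightarrow> A (c *\<^sub>R x) = c *\<^sub>R A x"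
    and dissipative: "\<And>x. x \<in> H \<Longrightarrow> ip (A x) x \<le> 0"
    and compact: "\<And>X M. (\<And>n::nat. X n \<in> H) \<Longrightarrow> (\<And>n. nrm (X n) \<le> M) \<Longrightarrow>
      \<exists>r y. strict_mono r \<and> y \<in> H \<and> tends (\<lambda>n. A (X (r n))) y sequentially"
begin

lemma A_zero [simp]: "A 0 = 0"
  using A_scale[of 0 0] by simp

lemma A_minus: "x \<in> H \<Longrightarrow> A (- x) = - A x"
  using A_scale[of x "-1"] by simp

lemma A_diff: "x \<in> H \<Longrightarrow> y \<in> H \<Longrightarrow> A (x - y) = A x - A y"
  using A_add[of x "-y"] by (simp add: A_minus)

lemma A_sum: "(\<And>i. i \<in> I \<Longrightarrow> f i \<in> H) \<Longrightarrow> A (sum f I) = (\<Sum>i\<in>I. A (f i))"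
  by (induction I rule: infinite_finite_induct) (auto simp: A_add H_sum)

text \<open>If \<open>A\<close> were unbounded on unit vectors, then their images would have no bounded subsequence, which
contradicts compactness.\<close>

lemma op_bound_exists: "\<exists>B\<ge>0. \<forall>x\<in>H. nrm (A x) \<le> B * nrm x"
proof (rule ccontr)
  assume "\<not> ?thesis"
  then have "\<exists>x\<in>H. nrm (A x) > real n * nrm x" for n :: nat
    unfolding not_le[symmetric] using of_nat_0_le_iff by blast
  then obtain X where X: "\<And>n. X n \<in> H" "\<And>n. nrm (A (X n)) > real n * nrm (X n)"
    by metis
  have pos: "nrm (X n) > 0" for n
  proof -
    have "X n \<noteq> 0" using X(2)[of n] by auto
    then show ?thesis using nrm_eq_0[OF X(1)[of n]] nrm_nonneg[OF X(1)[of n]] by linarith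
  qed
  \<comment> \<open>Normalized vectors whose images have norm greater than \<open>n\<close>.\<close>
  define Y where "Y n = (1 / nrm (X n)) *\<^sub>R X n" for n
  have Y: "Y n \<in> H" "nrm (Y n) \<le> 1" "nrm (A (Y n)) > n" for n
    using X pos[of n] by (auto simp: Y_def nrm_scale A_scale field_simps)
  obtain r y where r: "strict_mono r" "y \<in> H" "tends (\<lambda>n. A (Y (r n))) y sequentially"
    using compact[of Y 1] Y by blast
  have "(\<lambda>n. nrm (A (Y (r n)))) \<longlonglongrightarrow> nrm y"
    using tends_nrm[OF r(3)] r Y by auto
  then obtain M where M: "\<And>n. norm (nrm (A (Y (r n)))) \<le> M"
    by (meson Bseq_def convergentI convergent_imp_Bseq)
  obtain n where "real n > M" using reals_Archimedean2 by blast
  moreover have "real n \<le> real (r n)" using r(1) seq_suble by (simp add: seq_suble)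
  ultimately show False using M[of n] Y(3)[of "r n"] by auto
qed

definition op_bound :: real where "op_bound = (SOME B. B \<ge> 0 \<and> (\<forall>x\<in>H. nrm (A x) \<le> B * nrm x))"

lemma op_bound: "op_bound \<ge> 0" "\<And>x. x \<in> H \<Longrightarrow> nrm (A x) \<le> op_bound * nrm x"
  using someI_ex[of "\<lambda>B. B \<ge> 0 \<and> (\<forall>x\<in>H. nrm (A x) \<le> B * nrm x)"] op_bound_exists
  unfolding op_bound_def by auto

lemma tends_A:
  assumes "tends X y F" "\<forall>\<^sub>F n in F. X n \<in> H" "y \<in> H"
  shows "tends (\<lambda>n. A (X n)) (A y) F"
proof (rule tendsI_le)
  show "((\<lambda>n. op_bound * nrm (X n - y)) \<longlongrightarrow> 0) F"
    using tendsto_mult_left[OF assms(1)[unfolded tends_def], of op_bound] by simp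
  show "\<forall>\<^sub>F n in F. nrm (A (X n) - A y) \<le> op_bound * nrm (X n - y)"
    using assms(2) by eventually_elim (use assms op_bound in \<open>auto simp: A_diff[symmetric]\<close>)
  show "\<forall>\<^sub>F n in F. A (X n) \<in> H" using assms(2) by eventually_elim auto
qed (use assms in auto)

text \<open>A Cauchy sequence is bounded, so by compactness a subsequence of the images converges; since \<open>A\<close> is
bounded, the images form a Cauchy sequence and converge as a whole.\<close>

lemma A_Cauchy_convergent:
  assumes X: "\<And>n::nat. X n \<in> H"
    and C: "\<And>e. e > 0 \<Longrightarrow> \<exists>K. \<forall>m\<ge>K. \<forall>n\<ge>K. nrm (X m - X n) < e"
  shows "\<exists>y\<in>H. tends (\<lambda>n. A (X n)) y sequentially"
proof -
  obtain K where K: "\<forall>m\<ge>K. \<forall>n\<ge>K. nrm (X m - X n) < 1" using C[of 1] by auto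
  have bd: "nrm (X (n + K)) \<le> nrm (X K) + 1" for n
  proof -
    have "nrm (X (n+K) - X K) < 1" using K by simp
    then show ?thesis using nrm_triangle[of "X (n+K) - X K" "X K"] X by simp
  qed
  obtain r y where r: "strict_mono r" "y \<in> H" "tends (\<lambda>n. A (X (r n + K))) y sequentially"
    using compact[of "\<lambda>n. X (n + K)" "nrm (X K) + 1"] bd X by blast
  have "tends (\<lambda>n. A (X n)) y sequentially"
    unfolding tends_def
  proof (rule LIMSEQ_I)
    fix e :: real assume e: "e > 0"
    define d where "d = e / 2 / (op_bound + 1)"
    have d: "d > 0" "op_bound * d < e / 2" using e op_bound(1) by (auto simp: d_def field_simps)
    obtain L where L: "\<forall>m\<ge>L. \<forall>n\<ge>L. nrm (X m - X n) < d" using C[OF d(1)] by auto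
    obtain L' where L': "\<forall>n\<ge>L'. norm (nrm (A (X (r n + K)) - y) - 0) < e / 2"
      using LIMSEQ_D[OF r(3)[unfolded tends_def], of "e/2"] e by auto
    define p where "p = max L L'"
    have p: "r p + K \<ge> L" "p \<ge> L'" using seq_suble[OF r(1), of p] unfolding p_def by auto
    show "\<exists>no. \<forall>n\<ge>no. norm (nrm (A (X n) - y) - 0) < e"
    proof (intro exI[of _ L] allI impI)
      fix n assume "n \<ge> L"
      then have "nrm (X n - X (r p + K)) < d" using L p by auto
      then have "op_bound * nrm (X n - X (r p + K)) \<le> op_bound * d" using op_bound(1) by (intro mult_left_mono) auto
      moreover have "nrm (A (X n) - A (X (r p + K))) \<le> op_bound * nrm (X n - X (r p + K))"
        using op_bound(2)[of "X n - X (r p + K)"] X by (simp add: A_diff)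
      moreover have "nrm (A (X (r p + K)) - y) < e / 2" using L' p(2) by auto
      moreover have "nrm (A (X n) - y) \<le> nrm (A (X n) - A (X (r p + K))) + nrm (A (X (r p + K)) - y)"
        using nrm_triangle3 X r by auto
      ultimately show "norm (nrm (A (X n) - y) - 0) < e"
        using d(2) nrm_nonneg[of "A (X n) - y"] X r(2) by auto
    qed
  qed
  then show ?thesis using r by auto
qed

definition solution :: "'a \<Rightarrow> (real \<Rightarrow> 'a) \<Rightarrow> bool"
  where "solution x u \<longleftrightarrow> u 0 = x \<and> (\<forall>t\<ge>0. u t \<in> H \<and>
    tends (\<lambda>s. (1 / (s - t)) *\<^sub>R (u s - u t)) (A (u t)) (at t within {0..}))"

lemma solution_in: "solution x u \<Longrightarrow> t \<ge> 0 \<Longrightarrow> u t \<in> H"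
  by (simp add: solution_def)

lemma solution_start: "solution x u \<Longrightarrow> u 0 = x"
  by (simp add: solution_def)

lemma solution_tends:
  "solution x u \<Longrightarrow> t \<ge> 0 \<Longrightarrow>
    tends (\<lambda>s. (1 / (s - t)) *\<^sub>R (u s - u t)) (A (u t)) (at t within {0..})"
  by (simp add: solution_def)

lemma solution_eventually_in:
  assumes "solution x u"
  shows "\<forall>\<^sub>F s in at t within {0..}. u s \<in> H"
  using eventually_nonneg_within by eventually_elim (use assms solution_in in auto)

lemma solution_quot_in:
  assumes "solution x u" "t \<ge> 0"
  shows "\<forall>\<^sub>F s in at t within {0..}. (1 / (s - t)) *\<^sub>R (u s - u t) \<in> H"
  using solution_eventually_in[OF assms(1)] by eventually_elim (use assms solution_in in auto)

lemma solution_continuous: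
  assumes u: "solution x u" and t: "t \<ge> 0"
  shows "tends u (u t) (at t within {0..})"
proof -
  let ?Q = "\<lambda>s. (1 / (s - t)) *\<^sub>R (u s - u t)"
  note inH = solution_in[OF u t]
  show ?thesis
  proof (rule tendsI_le[OF _ _ solution_eventually_in[OF u] inH])
    have "((\<lambda>s. \<bar>s - t\<bar> * nrm (?Q s)) \<longlongrightarrow> \<bar>t - t\<bar> * nrm (A (u t))) (at t within {0..})"
      by (intro tendsto_intros tends_nrm[OF solution_tends[OF u t] solution_quot_in[OF u t]] A_in inH)
    then show "((\<lambda>s. \<bar>s - t\<bar> * nrm (?Q s)) \<longlongrightarrow> 0) (at t within {0..})" by simp
    show "\<forall>\<^sub>F s in at t within {0..}. nrm (u s - u t) \<le> \<bar>s - t\<bar> * nrm (?Q s)"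
      using solution_eventually_in[OF u]
    proof eventually_elim
      case (elim s)
      then have "nrm (?Q s) = \<bar>1 / (s - t)\<bar> * nrm (u s - u t)"
        using inH by (intro nrm_scale) auto
      then show ?case by (cases "s = t") auto
    qed
  qed
qed

lemma solution_ip_deriv:
  assumes u: "solution x u" and t: "t \<ge> 0" and z: "z \<in> H"
  shows "((\<lambda>s. ip (u s) z) has_real_derivative ip (A (u t)) z) (at t within {0..})"
  unfolding has_field_derivative_iff
proof (rule Lim_transform_eventually)
  show "((\<lambda>s. ip ((1 / (s - t)) *\<^sub>R (u s - u t)) z) \<longlongrightarrow> ip (A (u t)) z) (at t within {0..})"
    by (intro tends_ip solution_tends[OF u t] solution_quot_in[OF u t] A_in solution_in[OF u t] z)
  show "\<forall>\<^sub>F s in at t within {0..}. ip ((1 / (s - t)) *\<^sub>R (u s - u t)) z = (ip (u s) z - ip (u t) z) / (s - t)"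
    using solution_eventually_in[OF u] by eventually_elim
      (use z solution_in[OF u t] in \<open>simp add: ip_linear\<close>)
qed

lemma solution_energy_deriv:
  assumes u: "solution x u" and t: "t \<ge> 0"
  shows "((\<lambda>s. ip (u s) (u s)) has_real_derivative 2 * ip (A (u t)) (u t)) (at t within {0..})"
  unfolding has_field_derivative_iff
proof (rule Lim_transform_eventually)
  let ?Q = "\<lambda>s. (1 / (s - t)) *\<^sub>R (u s - u t)"
  note inH = solution_in[OF u t]
  have "((\<lambda>s. ip (?Q s) (u s + u t)) \<longlongrightarrow> ip (A (u t)) (u t + u t)) (at t within {0..})"
  proof (rule tends_ip2[OF solution_tends[OF u t] _ solution_quot_in[OF u t]])
    show "tends (\<lambda>s. u s + u t) (u t + u t) (at t within {0..})"
      by (intro tends_add solution_continuous[OF u t] tends_const solution_eventually_in[OF u])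
         (use inH in auto)
    show "\<forall>\<^sub>F s in at t within {0..}. u s + u t \<in> H"
      using solution_eventually_in[OF u] by eventually_elim (use inH in auto)
  qed (use inH in auto)
  then show "((\<lambda>s. ip (?Q s) (u s + u t)) \<longlongrightarrow> 2 * ip (A (u t)) (u t)) (at t within {0..})"
    using inH by (simp add: ip_linear)
  show "\<forall>\<^sub>F s in at t within {0..}. ip (?Q s) (u s + u t) = (ip (u s) (u s) - ip (u t) (u t)) / (s - t)"
    using solution_eventually_in[OF u] by eventually_elim
      (use inH ip_sym in \<open>simp add: ip_linear\<close>)
qed

lemma solution_decreasing:
  assumes u: "solution x u" and "0 \<le> s" "s \<le> t"
  shows "nrm (u t) \<le> nrm (u s)"
proof (cases "s = t")
  case False
  then obtain r where r: "s < r" "ip (u t) (u t) - ip (u s) (u s) = (t - s) * (2 * ip (A (u r)) (u r))"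
    using mvt_within[OF _ _ solution_energy_deriv[OF u], of s t] assms by force
  have "ip (A (u r)) (u r) \<le> 0"
    using r(1) assms by (intro dissipative solution_in[OF u]) auto
  then have "(t - s) * (2 * ip (A (u r)) (u r)) \<le> 0" using assms by (intro mult_nonneg_nonpos) auto
  then show ?thesis using r(2) by (simp add: nrm_def)
qed auto

lemma solution_comb:
  assumes u: "solution x u" and v: "solution y v"
  shows "solution (a *\<^sub>R x + b *\<^sub>R y) (\<lambda>t. a *\<^sub>R u t + b *\<^sub>R v t)"
  unfolding solution_def
proof (intro conjI allI impI)
  fix t :: real assume t: "t \<ge> 0"
  note inH = solution_in[OF u t] solution_in[OF v t]
  show "a *\<^sub>R u t + b *\<^sub>R v t \<in> H" using inH by auto
  have "tends (\<lambda>s. a *\<^sub>R ((1 / (s - t)) *\<^sub>R (u s - u t)) + b *\<^sub>R ((1 / (s - t)) *\<^sub>R (v s - v t)))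
     (a *\<^sub>R A (u t) + b *\<^sub>R A (v t)) (at t within {0..})" (is "tends ?f _ _")
  proof (intro tends_add tends_scale solution_tends[OF u t] solution_tends[OF v t]
        solution_quot_in[OF u t] solution_quot_in[OF v t])
    show "\<forall>\<^sub>F s in at t within {0..}. a *\<^sub>R ((1 / (s - t)) *\<^sub>R (u s - u t)) \<in> H"
      using solution_quot_in[OF u t] by eventually_elim (rule H_scale)
    show "\<forall>\<^sub>F s in at t within {0..}. b *\<^sub>R ((1 / (s - t)) *\<^sub>R (v s - v t)) \<in> H"
      using solution_quot_in[OF v t] by eventually_elim (rule H_scale)
  qed (use inH in auto)
  moreover have "?f = (\<lambda>s. (1 / (s - t)) *\<^sub>R (a *\<^sub>R u s + b *\<^sub>R v s - (a *\<^sub>R u t + b *\<^sub>R v t)))"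
    by (auto simp: fun_eq_iff algebra_simps)
  moreover have "a *\<^sub>R A (u t) + b *\<^sub>R A (v t) = A (a *\<^sub>R u t + b *\<^sub>R v t)"
    using inH by (simp add: A_add A_scale)
  ultimately show "tends (\<lambda>s. (1 / (s - t)) *\<^sub>R (a *\<^sub>R u s + b *\<^sub>R v s - (a *\<^sub>R u t + b *\<^sub>R v t)))
     (A (a *\<^sub>R u t + b *\<^sub>R v t)) (at t within {0..})" by simp
qed (use solution_start[OF u] solution_start[OF v] in auto)

text \<open>The difference of two solutions is a solution that starts at zero, and norms of solutions decrease.\<close>

lemma solution_unique:
  assumes u: "solution x u" and v: "solution x v" and t: "t \<ge> 0"
  shows "u t = v t"
proof -
  have "solution (1 *\<^sub>R x + (-1) *\<^sub>R x) (\<lambda>t. 1 *\<^sub>R u t + (-1) *\<^sub>R v t)"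
    by (rule solution_comb[OF u v])
  from solution_decreasing[OF this order_refl t] have "nrm (u t - v t) \<le> nrm (u 0 - v 0)" by simp
  then have "nrm (u t - v t) = 0"
    using nrm_nonneg[OF H_diff[OF solution_in[OF u t] solution_in[OF v t]]]
      solution_start[OF u] solution_start[OF v] by auto
  then show ?thesis using nrm_eq_0[of "u t - v t"] solution_in[OF u t] solution_in[OF v t] by auto
qed

lemma Apow_in: "x \<in> H \<Longrightarrow> (A ^^ k) x \<in> H"
  by (induction k) auto

lemma Apow_bound: "x \<in> H \<Longrightarrow> nrm ((A ^^ k) x) \<le> op_bound ^ k * nrm x"
proof (induction k)
  case (Suc k)
  have "nrm ((A ^^ Suc k) x) \<le> op_bound * nrm ((A ^^ k) x)"
    using op_bound(2) Apow_in[OF Suc.prems] by simp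
  also have "\<dots> \<le> op_bound * (op_bound ^ k * nrm x)" using Suc op_bound(1) by (intro mult_left_mono) auto
  finally show ?case by (simp add: mult.assoc)
qed auto

definition expsum :: "'a \<Rightarrow> nat \<Rightarrow> real \<Rightarrow> 'a"
  where "expsum x n t = (\<Sum>k<n. (t ^ k / fact k) *\<^sub>R (A ^^ k) x)"

lemma expsum_in: "x \<in> H \<Longrightarrow> expsum x n t \<in> H"
  unfolding expsum_def by (intro H_sum H_scale Apow_in)

text \<open>All terms of the exponential series except the first lie in the range of \<open>A\<close>: the tail is the image
under \<open>A\<close> of a Cauchy sequence.\<close>

lemma expsum_convergent:
  assumes x: "x \<in> H"
  shows "\<exists>y\<in>H. tends (\<lambda>n. expsum x (Suc n) t) y sequentially"
proof -
  define T where "T n = (\<Sum>k<n. (t ^ Suc k / fact (Suc k)) *\<^sub>R (A ^^ k) x)" for n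
  have TH: "T n \<in> H" for n unfolding T_def by (intro H_sum H_scale Apow_in x)
  have S: "expsum x (Suc n) t = x + A (T n)" for n
  proof -
    have "A (T n) = (\<Sum>k<n. (t ^ Suc k / fact (Suc k)) *\<^sub>R (A ^^ Suc k) x)"
      unfolding T_def by (subst A_sum) (auto intro!: H_scale Apow_in x simp: A_scale Apow_in x)
    then show ?thesis
      unfolding expsum_def by (simp add: sum.lessThan_Suc_shift del: sum.lessThan_Suc)
  qed
  define c where "c k = \<bar>t\<bar> * nrm x * ((\<bar>t\<bar> * op_bound) ^ k / fact k)" for k
  have c: "summable c"
    unfolding c_def using summable_exp_generic[of "\<bar>t\<bar> * op_bound"]
    by (intro summable_mult) (simp add: divide_inverse mult.commute)
  have cb: "nrm ((t ^ Suc k / fact (Suc k)) *\<^sub>R (A ^^ k) x) \<le> c k" for k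
  proof -
    have "nrm ((t ^ Suc k / fact (Suc k)) *\<^sub>R (A ^^ k) x)
        = \<bar>t\<bar> ^ Suc k / fact (Suc k) * nrm ((A ^^ k) x)"
      by (simp add: nrm_scale Apow_in x power_abs abs_mult del: fact_Suc)
    also have "\<dots> \<le> \<bar>t\<bar> ^ Suc k / fact k * (op_bound ^ k * nrm x)"
      using Apow_bound[OF x] op_bound(1) x Apow_in
      by (intro mult_mono divide_left_mono fact_mono) auto
    finally show ?thesis by (simp add: c_def power_mult_distrib field_simps)
  qed
  have "\<exists>y\<in>H. tends (\<lambda>n. A (T n)) y sequentially"
  proof (rule A_Cauchy_convergent[OF TH])
    fix e :: real assume e: "e > 0"
    obtain K where K: "\<forall>m\<ge>K. \<forall>n. norm (sum c {m..<n}) < e"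
      using c e unfolding summable_Cauchy by blast
    have *: "nrm (T n - T m) < e" if "m \<ge> K" "m \<le> n" for m n
    proof -
      have "T n - T m = (\<Sum>k=m..<n. (t ^ Suc k / fact (Suc k)) *\<^sub>R (A ^^ k) x)"
        unfolding T_def lessThan_atLeast0 using sum_diff_nat_ivl[of 0 m n] that by blast
      then have "nrm (T n - T m) \<le> (\<Sum>k=m..<n. nrm ((t ^ Suc k / fact (Suc k)) *\<^sub>R (A ^^ k) x))"
        using nrm_sum[of "{m..<n}" "\<lambda>k. (t ^ Suc k / fact (Suc k)) *\<^sub>R (A ^^ k) x"] Apow_in x by auto
      also have "\<dots> \<le> sum c {m..<n}" by (intro sum_mono cb)
      also have "\<dots> < e" using K that by (metis abs_ge_self le_less_trans real_norm_def)
      finally show ?thesis .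
    qed
    show "\<exists>K. \<forall>m\<ge>K. \<forall>n\<ge>K. nrm (T m - T n) < e"
    proof (intro exI[of _ K] allI impI)
      fix m n assume "m \<ge> K" "n \<ge> K"
      then show "nrm (T m - T n) < e"
        using *[of n m] *[of m n] nrm_diff_commute[OF TH[of m] TH[of n]] by (cases "m \<le> n") auto
    qed
  qed
  then obtain y where y: "y \<in> H" "tends (\<lambda>n. A (T n)) y sequentially" by blast
  have "tends (\<lambda>n. x + A (T n)) (x + y) sequentially"
    using y TH x by (intro tends_add tends_const) auto
  then show ?thesis unfolding S using x y by blast
qed

text \<open>A bound for the error of the difference quotient that is uniform in the number \<open>n\<close> of terms, so
that it survives the passage to the limit and shows that the series solves the equation.\<close>

lemma expsum_quotient:
  assumes x: "x \<in> H" and st: "\<bar>s\<bar> \<le> R" "\<bar>t\<bar> \<le> R" "s \<noteq> t"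
  shows "nrm ((1 / (s - t)) *\<^sub>R (expsum x (Suc n) s - expsum x (Suc n) t) - A (expsum x n t))
     \<le> \<bar>s - t\<bar> * (\<Sum>k. real k * real (k - 1) * R ^ (k - 2) / fact k * (op_bound ^ k * nrm x))"
proof -
  let ?a = "\<lambda>k. (A ^^ k) x"
  let ?d = "\<lambda>k. ((s ^ k - t ^ k) / (s - t) - real k * t ^ (k - 1)) / fact k"
  define c where "c k = real k * real (k - 1) * R ^ (k - 2) / fact k * (op_bound ^ k * nrm x)" for k
  have R: "R \<ge> 0" using st by linarith
  have c_nonneg: "c k \<ge> 0" for k unfolding c_def using R op_bound(1) x by simp
  have c: "summable c"
  proof (subst summable_iff_shift[of c 2, symmetric])
    have "c (k + 2) = op_bound\<^sup>2 * nrm x * ((R * op_bound) ^ k / fact k)" for k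
    proof -
      have "fact (k + 2) = real (k + 2) * real (k + 1) * fact k" by (simp add: algebra_simps)
      then have "real (k + 2) * real (k + 1) / fact (k + 2) = 1 / fact k"
        by (simp add: divide_simps del: of_nat_add fact_Suc)
      then have "c (k + 2) = 1 / fact k * R ^ k * (op_bound ^ (k + 2) * nrm x)"
        unfolding c_def by (simp add: mult.commute mult.left_commute)
      then show ?thesis
        by (simp add: power_add power_mult_distrib power2_eq_square mult.commute mult.left_commute)
    qed
    then have "c (k + 2) = op_bound\<^sup>2 * nrm x * (inverse (fact k) * (R * op_bound) ^ k)" for k
      by (simp add: divide_inverse mult.commute)
    then show "summable (\<lambda>k. c (k + 2))"
      using summable_mult[OF summable_exp[of "R * op_bound"], of "op_bound\<^sup>2 * nrm x"] by (simp only:)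
  qed
  have A1: "A (expsum x n t) = (\<Sum>k<Suc n. (real k * t ^ (k - 1) / fact k) *\<^sub>R ?a k)"
  proof -
    have "A (expsum x n t) = (\<Sum>k<n. (t ^ k / fact k) *\<^sub>R ?a (Suc k))"
      unfolding expsum_def by (subst A_sum) (auto intro!: H_scale Apow_in x simp: A_scale Apow_in x)
    also have "\<dots> = (\<Sum>k<n. (real (Suc k) * t ^ (Suc k - 1) / fact (Suc k)) *\<^sub>R ?a (Suc k))"
      by (intro sum.cong refl arg_cong2[of _ _ _ _ "(*\<^sub>R)"]) (simp del: of_nat_Suc)
    finally show ?thesis by (simp add: sum.lessThan_Suc_shift del: sum.lessThan_Suc)
  qed
  have "(1 / (s - t)) *\<^sub>R (expsum x (Suc n) s - expsum x (Suc n) t) - A (expsum x n t)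
      = (\<Sum>k<Suc n. ?d k *\<^sub>R ?a k)"
    unfolding A1 unfolding expsum_def scaleR_sum_right sum_subtractf[symmetric]
  proof (intro sum.cong refl)
    fix k
    have "1 / (s - t) * (s ^ k / fact k - t ^ k / fact k) - real k * t ^ (k - 1) / fact k = ?d k"
      by (simp add: diff_divide_distrib right_diff_distrib mult.commute)
    then show "(1 / (s - t)) *\<^sub>R ((s ^ k / fact k) *\<^sub>R ?a k - (t ^ k / fact k) *\<^sub>R ?a k)
        - (real k * t ^ (k - 1) / fact k) *\<^sub>R ?a k = ?d k *\<^sub>R ?a k"
      by (simp only: scaleR_diff_left[symmetric] scaleR_scaleR)
  qed
  then have "nrm ((1 / (s - t)) *\<^sub>R (expsum x (Suc n) s - expsum x (Suc n) t) - A (expsum x n t))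
      \<le> (\<Sum>k<Suc n. nrm (?d k *\<^sub>R ?a k))"
    using nrm_sum[of "{..<Suc n}" "\<lambda>k. ?d k *\<^sub>R ?a k"] Apow_in x by (metis H_scale)
  also have "\<dots> \<le> (\<Sum>k<Suc n. \<bar>s - t\<bar> * c k)"
  proof (rule sum_mono)
    fix k
    have "norm (((t + (s - t)) ^ k - t ^ k) / (s - t) - of_nat k * t ^ (k - Suc 0))
       \<le> of_nat k * of_nat (k - Suc 0) * R ^ (k - 2) * norm (s - t)"
      using st by (intro lemma_termdiff3) auto
    then have *: "\<bar>?d k\<bar> \<le> real k * real (k - 1) * R ^ (k - 2) * \<bar>s - t\<bar> / fact k"
      by (simp add: divide_right_mono)
    have "nrm (?d k *\<^sub>R ?a k) = \<bar>?d k\<bar> * nrm (?a k)"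
      by (rule nrm_scale[OF Apow_in[OF x]])
    also have "\<dots> \<le> (real k * real (k - 1) * R ^ (k - 2) * \<bar>s - t\<bar> / fact k) * (op_bound ^ k * nrm x)"
      by (intro mult_mono * Apow_bound x) (use R x Apow_in in auto)
    also have "\<dots> = \<bar>s - t\<bar> * c k" by (simp add: c_def)
    finally show "nrm (?d k *\<^sub>R ?a k) \<le> \<bar>s - t\<bar> * c k" .
  qed
  also have "\<dots> \<le> \<bar>s - t\<bar> * suminf c"
    unfolding sum_distrib_left[symmetric]
    by (intro mult_left_mono sum_le_suminf c) (auto simp: c_nonneg)
  finally show ?thesis unfolding c_def .
qed

lemma solution_exists:
  assumes x: "x \<in> H"
  shows "\<exists>u. solution x u"
proof -
  obtain u where u: "\<And>t. u t \<in> H" "\<And>t. tends (\<lambda>n. expsum x (Suc n) t) (u t) sequentially"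
    using expsum_convergent[OF x] by metis
  have "tends (\<lambda>n. x) (u 0) sequentially"
    using u(2)[of 0] by (simp add: expsum_def sum.lessThan_Suc_shift del: sum.lessThan_Suc)
  then have "u 0 = x"
    using tends_unique[OF _ tends_const] u x by (metis always_eventually sequentially_bot)
  moreover have "tends (\<lambda>s. (1 / (s - t)) *\<^sub>R (u s - u t)) (A (u t)) (at t within {0..})" for t
  proof (rule tendsI_le)
    define C where "C = (\<Sum>k. real k * real (k - 1) * (\<bar>t\<bar> + 1) ^ (k - 2) / fact k * (op_bound ^ k * nrm x))"
    have "((\<lambda>s. \<bar>s - t\<bar> * C) \<longlongrightarrow> \<bar>t - t\<bar> * C) (at t within {0..})" by (intro tendsto_intros)
    then show "((\<lambda>s. \<bar>s - t\<bar> * C) \<longlongrightarrow> 0) (at t within {0..})" by simp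
    have "nrm ((1 / (s - t)) *\<^sub>R (u s - u t) - A (u t)) \<le> \<bar>s - t\<bar> * C"
      if "s \<noteq> t" "dist s t < 1" for s
    proof -
      have L1: "tends (\<lambda>n. (1 / (s - t)) *\<^sub>R (expsum x (Suc n) s - expsum x (Suc n) t))
        ((1 / (s - t)) *\<^sub>R (u s - u t)) sequentially"
      proof (rule tends_scale)
        show "tends (\<lambda>n. expsum x (Suc n) s - expsum x (Suc n) t) (u s - u t) sequentially"
          using tends_add[OF u(2)[of s] tends_scale[OF u(2)[of t], of "-1"]] u(1) expsum_in[OF x] by simp
      qed (use u expsum_in[OF x] in auto)
      have L0: "tends (\<lambda>n. expsum x n t) (u t) sequentially"
        using u(2)[of t] unfolding tends_def by (subst (asm) filterlim_sequentially_Suc)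
      have "tends (\<lambda>n. (1 / (s - t)) *\<^sub>R (expsum x (Suc n) s - expsum x (Suc n) t) + (-1) *\<^sub>R A (expsum x n t))
        ((1 / (s - t)) *\<^sub>R (u s - u t) + (-1) *\<^sub>R A (u t)) sequentially"
        using u expsum_in[OF x] by (intro tends_add L1 tends_scale tends_A L0) auto
      then have "tends (\<lambda>n. (1 / (s - t)) *\<^sub>R (expsum x (Suc n) s - expsum x (Suc n) t) - A (expsum x n t))
        ((1 / (s - t)) *\<^sub>R (u s - u t) - A (u t)) sequentially" by simp
      then have "(\<lambda>n. nrm ((1 / (s - t)) *\<^sub>R (expsum x (Suc n) s - expsum x (Suc n) t) - A (expsum x n t)))
        \<longlonglongrightarrow> nrm ((1 / (s - t)) *\<^sub>R (u s - u t) - A (u t))"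
        by (rule tends_nrm) (use u expsum_in[OF x] in auto)
      then show ?thesis
        by (rule LIMSEQ_le_const2)
           (use expsum_quotient[OF x, of s "\<bar>t\<bar> + 1" t] that C_def in \<open>auto simp: dist_real_def\<close>)
    qed
    then show "\<forall>\<^sub>F s in at t within {0..}. nrm ((1 / (s - t)) *\<^sub>R (u s - u t) - A (u t)) \<le> \<bar>s - t\<bar> * C"
      unfolding eventually_at by (intro exI[of _ 1]) auto
  qed (use u in auto)
  ultimately have "solution x u" unfolding solution_def using u by auto
  then show ?thesis by blast
qed

section \<open>The contraction semigroup\<close>

definition flow :: "real \<Rightarrow> 'a \<Rightarrow> 'a"
  where "flow t x = (SOME u. solution x u) t"

lemma flow_solution: "x \<in> H \<Longrightarrow> solution x (\<lambda>t. flow t x)"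
  unfolding flow_def using someI_ex[OF solution_exists] by blast

lemma flow_eq: "solution x u \<Longrightarrow> t \<ge> 0 \<Longrightarrow> flow t x = u t"
proof -
  assume u: "solution x u" and t: "t \<ge> 0"
  then have "x \<in> H" using solution_in[OF u, of 0] solution_start[OF u] by simp
  then show ?thesis using solution_unique[OF flow_solution u t] by simp
qed

lemma flow_in [simp, intro]: "x \<in> H \<Longrightarrow> t \<ge> 0 \<Longrightarrow> flow t x \<in> H"
  using solution_in[OF flow_solution] .

lemma flow_0 [simp]: "x \<in> H \<Longrightarrow> flow 0 x = x"
  using solution_start[OF flow_solution] .

lemma flow_decreasing: "x \<in> H \<Longrightarrow> 0 \<le> s \<Longrightarrow> s \<le> t \<Longrightarrow> nrm (flow t x) \<le> nrm (flow s x)"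
  using solution_decreasing[OF flow_solution] .

lemma flow_contraction: "x \<in> H \<Longrightarrow> t \<ge> 0 \<Longrightarrow> nrm (flow t x) \<le> nrm x"
  using flow_decreasing[of x 0 t] by simp

lemma flow_comb:
  "x \<in> H \<Longrightarrow> y \<in> H \<Longrightarrow> t \<ge> 0 \<Longrightarrow> flow t (a *\<^sub>R x + b *\<^sub>R y) = a *\<^sub>R flow t x + b *\<^sub>R flow t y"
  by (intro flow_eq solution_comb flow_solution)

lemma flow_add: "x \<in> H \<Longrightarrow> y \<in> H \<Longrightarrow> t \<ge> 0 \<Longrightarrow> flow t (x + y) = flow t x + flow t y"
  using flow_comb[of x y t 1 1] by simp

lemma flow_diff: "x \<in> H \<Longrightarrow> y \<in> H \<Longrightarrow> t \<ge> 0 \<Longrightarrow> flow t (x - y) = flow t x - flow t y"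
  using flow_comb[of x y t 1 "-1"] by simp

lemma flow_scale: "x \<in> H \<Longrightarrow> t \<ge> 0 \<Longrightarrow> flow t (c *\<^sub>R x) = c *\<^sub>R flow t x"
  using flow_comb[of x x t c 0] by simp

lemma flow_flow:
  assumes x: "x \<in> H" and s: "s \<ge> 0" and r: "r \<ge> 0"
  shows "flow s (flow r x) = flow (s + r) x"
proof (rule flow_eq[OF _ s])
  show "solution (flow r x) (\<lambda>s. flow (s + r) x)"
    unfolding solution_def
  proof (intro conjI allI impI)
    fix t :: real assume t: "t \<ge> 0"
    have "filterlim (\<lambda>s. s + r) (at (t + r) within {0..}) (at t within {0..})"
      unfolding filterlim_at using r
      by (auto intro!: tendsto_intros simp: eventually_at intro: exI[of _ 1])
    moreover have "((\<lambda>s. nrm ((1 / (s - (t + r))) *\<^sub>R (flow s x - flow (t + r) x) - A (flow (t + r) x))) \<longlongrightarrow> 0)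
        (at (t + r) within {0..})"
      using solution_tends[OF flow_solution[OF x], of "t + r"] t r by (simp add: tends_def)
    ultimately have "((\<lambda>s. nrm ((1 / (s + r - (t + r))) *\<^sub>R (flow (s + r) x - flow (t + r) x)
        - A (flow (t + r) x))) \<longlongrightarrow> 0) (at t within {0..})"
      by (rule filterlim_compose[rotated])
    then show "tends (\<lambda>s. (1 / (s - t)) *\<^sub>R (flow (s + r) x - flow (t + r) x)) (A (flow (t + r) x)) (at t within {0..})"
      unfolding tends_def by simp
  qed (use x r in auto)
qed

lemma flow_A:
  assumes x: "x \<in> H" and t: "t \<ge> 0"
  shows "flow t (A x) = A (flow t x)"
proof (rule flow_eq[OF _ t])
  note u = flow_solution[OF x]
  show "solution (A x) (\<lambda>t. A (flow t x))"
    unfolding solution_def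
  proof (intro conjI allI impI)
    fix t :: real assume t: "t \<ge> 0"
    have "tends (\<lambda>s. A ((1 / (s - t)) *\<^sub>R (flow s x - flow t x))) (A (A (flow t x))) (at t within {0..})"
      by (intro tends_A solution_tends[OF u t] solution_quot_in[OF u t]) (use x t in auto)
    then show "tends (\<lambda>s. (1 / (s - t)) *\<^sub>R (A (flow s x) - A (flow t x))) (A (A (flow t x))) (at t within {0..})"
      unfolding tends_def
    proof (rule Lim_transform_eventually)
      show "\<forall>\<^sub>F s in at t within {0..}. nrm (A ((1 / (s - t)) *\<^sub>R (flow s x - flow t x)) - A (A (flow t x)))
        = nrm ((1 / (s - t)) *\<^sub>R (A (flow s x) - A (flow t x)) - A (A (flow t x)))"
        using solution_eventually_in[OF u]
        by eventually_elim (use x t in \<open>simp add: A_scale A_diff\<close>)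
    qed
  qed (use x in auto)
qed

text \<open>The derivative of \<open>flow t x\<close> is \<open>flow t (A x)\<close>, whose norm is at most that of \<open>A x\<close>. The mean value
theorem is applied to the inner product with the difference itself.\<close>

lemma flow_diff_bound:
  assumes x: "x \<in> H" and t: "t \<ge> 0"
  shows "nrm (flow t x - x) \<le> t * nrm (A x)"
proof (cases "t = 0")
  case False
  define z where "z = flow t x - x"
  have z: "z \<in> H" using x t by (auto simp: z_def)
  obtain r where r: "0 < r" "r < t" "ip (flow t x) z - ip (flow 0 x) z = (t - 0) * ip (A (flow r x)) z"
    using mvt_within[OF _ _ solution_ip_deriv[OF flow_solution[OF x] _ z], of 0 t] False t by force
  have "(nrm z)\<^sup>2 = t * ip (A (flow r x)) z"
    using r x t z by (simp add: nrm_sq) (simp add: z_def ip_diff)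
  also have "ip (A (flow r x)) z \<le> nrm (A (flow r x)) * nrm z"
    using Cauchy_Schwarz[of "A (flow r x)" z] z x r by auto
  also have "nrm (A (flow r x)) \<le> nrm (A x)"
    using flow_contraction[of "A x" r] flow_A[of x r] x r by simp
  finally have "nrm z * nrm z \<le> (t * nrm (A x)) * nrm z"
    using t z by (simp add: power2_eq_square mult_left_mono mult_right_mono mult.assoc)
  moreover have "nrm z \<ge> 0" "t * nrm (A x) \<ge> 0" using z t x by auto
  ultimately show ?thesis unfolding z_def[symmetric]
    by (cases "nrm z = 0") auto
qed (use x in simp)

lemma flow_continuous:
  assumes "tends X y F" "\<forall>\<^sub>F n in F. X n \<in> H" "y \<in> H" "t \<ge> 0"
  shows "tends (\<lambda>n. flow t (X n)) (flow t y) F"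
proof (rule tendsI_le[OF assms(1)[unfolded tends_def]])
  show "\<forall>\<^sub>F n in F. nrm (flow t (X n) - flow t y) \<le> nrm (X n - y)"
    using assms(2) by eventually_elim (use assms flow_contraction in \<open>auto simp: flow_diff[symmetric]\<close>)
  show "\<forall>\<^sub>F n in F. flow t (X n) \<in> H" using assms(2) by eventually_elim (use assms in auto)
qed (use assms in auto)

section \<open>Trajectories without loss of energy\<close>

text \<open>The symmetric part of \<open>2A\<close> as a bilinear form; it is the rate of change of the squared norm.\<close>

definition sym_part :: "'a \<Rightarrow> 'a \<Rightarrow> real"
  where "sym_part x y = ip (A x) y + ip x (A y)"

text \<open>Dissipativity makes the negative of this form positive semidefinite, so a null vector is orthogonal
to everything by the Cauchy-Schwarz inequality. Hence null vectors form a subspace.\<close>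

lemma sym_part_null:
  assumes x: "x \<in> H" "ip (A x) x = 0" and z: "z \<in> H"
  shows "sym_part x z = 0"
proof -
  have "(sym_part x z)\<^sup>2 \<le> 0 * (- 4 * ip (A z) z)"
  proof (rule discriminant_nonpos)
    fix t :: real
    \<comment> \<open>The scaling by \<open>-2\<close> matches the form of the quadratic in \<open>discriminant_nonpos\<close>.\<close>
    let ?p = "x + (- 2 * t) *\<^sub>R z"
    have "ip (A (x + \<tau> *\<^sub>R z)) (x + \<tau> *\<^sub>R z) = \<tau> * sym_part x z + \<tau>\<^sup>2 * ip (A z) z" for \<tau>
      using x z ip_sym[of x "A z"]
      by (simp add: ip_linear A_add A_scale sym_part_def algebra_simps power2_eq_square)
    from this[of "- 2 * t"]
    have "ip (A ?p) ?p = (- 2 * t) * sym_part x z + (- 2 * t)\<^sup>2 * ip (A z) z" .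
    moreover have "ip (A ?p) ?p \<le> 0" using x z by (intro dissipative) auto
    ultimately show "0 \<le> 0 + 2 * t * sym_part x z + t\<^sup>2 * (- 4 * ip (A z) z)"
      by (simp add: power2_eq_square)
  qed
  then show ?thesis by simp
qed

text \<open>The states along whose trajectory no energy is lost. The condition is stated with all test vectors
\<open>z\<close>, which makes it linear in \<open>y\<close>.\<close>

definition conservative :: "'a set"
  where "conservative = {y \<in> H. \<forall>s\<ge>0. \<forall>z\<in>H. sym_part (flow s y) z = 0}"

lemma conservative_H: "y \<in> conservative \<Longrightarrow> y \<in> H"
  by (simp add: conservative_def)

lemma sym_part_scale: "x \<in> H \<Longrightarrow> z \<in> H \<Longrightarrow> sym_part (c *\<^sub>R x) z = c * sym_part x z"
  by (simp add: sym_part_def A_scale ip_linear algebra_simps)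

lemma conservative_scale: "x \<in> conservative \<Longrightarrow> c *\<^sub>R x \<in> conservative"
  by (auto simp: conservative_def flow_scale sym_part_scale)

text \<open>Differentiate the identity \<open>sym_part (flow s y) z = 0\<close> with respect to \<open>s\<close>.\<close>

lemma conservative_A:
  assumes y: "y \<in> conservative" shows "A y \<in> conservative"
  unfolding conservative_def
proof (intro CollectI conjI allI impI ballI)
  have yH: "y \<in> H" using y conservative_H by blast
  then show "A y \<in> H" by auto
  fix s z assume s: "s \<ge> (0::real)" and z: "z \<in> H"
  let ?D = "ip (A (flow s y)) (A z) + ip (A (flow s (A y))) z"
  have "((\<lambda>s. ip (flow s y) (A z) + ip (flow s (A y)) z) has_real_derivative ?D) (at s within {0..})"
    by (intro DERIV_add solution_ip_deriv[OF flow_solution[OF yH] s]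
        solution_ip_deriv[OF flow_solution[OF A_in[OF yH]] s] s z A_in yH)
  moreover have "((\<lambda>s. ip (flow s y) (A z) + ip (flow s (A y)) z) has_real_derivative 0) (at s within {0..})"
  proof (rule has_field_derivative_transform_within[OF DERIV_const zero_less_one])
    fix r assume "r \<in> {0::real..}" "dist r s < 1"
    then have "sym_part (flow r y) z = 0" using y z by (auto simp: conservative_def)
    then show "0 = ip (flow r y) (A z) + ip (flow r (A y)) z"
      using flow_A[OF yH, of r] \<open>r \<in> _\<close> by (simp add: sym_part_def)
  qed (use s in auto)
  ultimately have "?D = 0" by (rule nonneg_derivative_unique[OF s])
  then show "sym_part (flow s (A y)) z = 0"
    using flow_A[OF yH s] by (simp add: sym_part_def)
qed

lemma conservative_closed:
  assumes "tends X y sequentially" "\<And>n::nat. X n \<in> conservative" "y \<in> H"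
  shows "y \<in> conservative"
  unfolding conservative_def
proof (intro CollectI conjI allI impI ballI assms(3))
  fix s z assume s: "s \<ge> (0::real)" and z: "z \<in> H"
  have X: "X n \<in> H" for n using assms(2) conservative_H by blast
  have 1: "tends (\<lambda>n. flow s (X n)) (flow s y) sequentially"
    using assms X s by (intro flow_continuous) auto
  have "(\<lambda>n. ip (A (flow s (X n))) z + ip (flow s (X n)) (A z))
     \<longlonglongrightarrow> ip (A (flow s y)) z + ip (flow s y) (A z)"
    using X s assms(3) z by (intro tendsto_add tends_ip tends_A 1) auto
  moreover have "ip (A (flow s (X n))) z + ip (flow s (X n)) (A z) = 0" for n
    using assms(2)[of n] s z by (simp add: conservative_def sym_part_def)
  ultimately show "sym_part (flow s y) z = 0"
    unfolding sym_part_def using LIMSEQ_unique[OF _ tendsto_const] by simp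
qed

lemma conservative_skew:
  assumes y: "y \<in> conservative" and z: "z \<in> H"
  shows "ip (A y) z = - ip y (A z)"
proof -
  have "sym_part (flow 0 y) z = 0" using assms unfolding conservative_def by blast
  then show ?thesis using conservative_H[OF y] by (simp add: sym_part_def)
qed

text \<open>Let \<open>L\<close> be the supremum of \<open>\<parallel>A x\<parallel>\<close> over conservative \<open>x\<close> in the unit ball and \<open>X n\<close> a maximizing
sequence. By skew-symmetry \<open>\<parallel>A\<^sup>2 x + L\<^sup>2 x\<parallel>\<^sup>2 \<le> L\<^sup>2 (L\<^sup>2 - \<parallel>A x\<parallel>\<^sup>2)\<close>, so \<open>A\<^sup>2 (X n) + L\<^sup>2 X n\<close> tends to
zero. Compactness provides a convergent subsequence of \<open>A\<^sup>2 (X n)\<close>, and then the same subsequence of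
\<open>X n\<close> converges to an eigenvector of \<open>A\<^sup>2\<close>.\<close>

lemma conservative_eigenvector:
  assumes y: "y \<in> conservative" "A y \<noteq> 0"
  shows "\<exists>x\<in>conservative. \<exists>\<mu>>0. x \<noteq> 0 \<and> A (A x) = - (\<mu>\<^sup>2) *\<^sub>R x"
proof -
  define U where "U = (\<lambda>x. nrm (A x)) ` {x \<in> conservative. nrm x \<le> 1}"
  define L where "L = Sup U"
  have bddU: "bdd_above U"
  proof (rule bdd_aboveI)
    fix r assume "r \<in> U"
    then obtain x where x: "x \<in> conservative" "nrm x \<le> 1" "r = nrm (A x)" by (auto simp: U_def)
    then have "r \<le> op_bound * nrm x" using op_bound(2) conservative_H by blast
    also have "\<dots> \<le> op_bound" using x op_bound(1) mult_left_mono[of "nrm x" 1 op_bound] by auto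
    finally show "r \<le> op_bound" .
  qed
  have yH: "y \<in> H" using y conservative_H by blast
  have y0: "nrm y > 0" using y(2) A_zero by (intro nrm_pos yH) auto
  have Ay0: "nrm (A y) > 0" using y(2) yH by (intro nrm_pos) auto
  have inU: "nrm (A ((1 / nrm y) *\<^sub>R y)) \<in> U"
    unfolding U_def using y0 yH y by (intro imageI) (auto simp: nrm_scale intro: conservative_scale)
  then have "nrm (A ((1 / nrm y) *\<^sub>R y)) \<le> L" unfolding L_def by (rule cSup_upper[OF _ bddU])
  moreover have "nrm (A ((1 / nrm y) *\<^sub>R y)) > 0"
    using y0 Ay0 yH by (simp add: A_scale nrm_scale)
  ultimately have L: "L > 0" by linarith
  have opL: "nrm (A x) \<le> L * nrm x" if x: "x \<in> conservative" for x
  proof (cases "x = 0")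
    case False
    have xH: "x \<in> H" using x conservative_H by blast
    then have x0: "nrm x > 0" using False by (intro nrm_pos)
    have "nrm (A ((1 / nrm x) *\<^sub>R x)) \<in> U"
      unfolding U_def using x0 xH x by (intro imageI) (auto simp: nrm_scale intro: conservative_scale)
    then have "nrm (A ((1 / nrm x) *\<^sub>R x)) \<le> L" unfolding L_def by (rule cSup_upper[OF _ bddU])
    then show ?thesis using x0 xH by (simp add: A_scale nrm_scale field_simps)
  qed simp
  have "\<exists>x\<in>conservative. nrm x \<le> 1 \<and> nrm (A x) > L - inverse (real (Suc n))" for n
  proof -
    have "\<exists>r\<in>U. L - inverse (real (Suc n)) < r"
      unfolding L_def using inU by (intro less_cSupD) auto
    then show ?thesis by (auto simp: U_def)
  qed
  then obtain X where X: "\<And>n. X n \<in> conservative" "\<And>n. nrm (X n) \<le> 1"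
      "\<And>n. nrm (A (X n)) > L - inverse (real (Suc n))" by metis
  have XH: "X n \<in> H" for n using X(1) conservative_H by blast
  have lim1: "(\<lambda>n. nrm (A (X n))) \<longlonglongrightarrow> L"
  proof (rule tendsto_sandwich)
    show "(\<lambda>n. L - inverse (real (Suc n))) \<longlonglongrightarrow> L"
      using tendsto_diff[OF tendsto_const LIMSEQ_inverse_real_of_nat, of L] by simp
    show "\<forall>\<^sub>F n in sequentially. nrm (A (X n)) \<le> L"
      using opL[OF X(1)] X(2) L by (intro always_eventually allI) (metis mult_left_le less_imp_le order_trans)
  qed (use X(3) in \<open>auto intro!: always_eventually less_imp_le\<close>)
  obtain r z where r: "strict_mono r" "z \<in> H" "tends (\<lambda>n. A (A (X (r n)))) z sequentially"
    using compact[of "\<lambda>n. A (X n)" "op_bound * 1"] XH op_bound X(2) by (meson A_in order_trans mult_left_mono)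
  have bound: "nrm (A (A (X n)) + L\<^sup>2 *\<^sub>R X n) \<le> sqrt (L\<^sup>2 * (L\<^sup>2 - (nrm (A (X n)))\<^sup>2))" for n
  proof (rule real_le_rsqrt)
    have AX: "A (X n) \<in> conservative" by (intro conservative_A X)
    have "ip (A (A (X n))) (X n) = - ip (A (X n)) (A (X n))"
      by (intro conservative_skew AX XH)
    then have "(nrm (A (A (X n)) + L\<^sup>2 *\<^sub>R X n))\<^sup>2
      = (nrm (A (A (X n))))\<^sup>2 - 2 * L\<^sup>2 * (nrm (A (X n)))\<^sup>2 + L\<^sup>2 * L\<^sup>2 * (nrm (X n))\<^sup>2"
      using XH ip_sym[of "X n" "A (A (X n))"] by (simp add: nrm_sq ip_linear algebra_simps)
    also have "(nrm (A (A (X n))))\<^sup>2 \<le> (L * nrm (A (X n)))\<^sup>2"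
      using opL[OF AX] XH by (intro power_mono) auto
    also have "L\<^sup>2 * L\<^sup>2 * (nrm (X n))\<^sup>2 \<le> L\<^sup>2 * L\<^sup>2 * 1"
      using X(2)[of n] XH by (intro mult_left_mono power_le_one) auto
    finally show "(nrm (A (A (X n)) + L\<^sup>2 *\<^sub>R X n))\<^sup>2 \<le> L\<^sup>2 * (L\<^sup>2 - (nrm (A (X n)))\<^sup>2)"
      by (simp add: power_mult_distrib algebra_simps)
  qed
  have "tends (\<lambda>n. A (A (X n)) + L\<^sup>2 *\<^sub>R X n) 0 sequentially"
  proof (rule tendsI_le)
    have "(\<lambda>n. sqrt (L\<^sup>2 * (L\<^sup>2 - (nrm (A (X n)))\<^sup>2))) \<longlonglongrightarrow> sqrt (L\<^sup>2 * (L\<^sup>2 - L\<^sup>2))"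
      by (intro tendsto_intros lim1)
    then show "(\<lambda>n. sqrt (L\<^sup>2 * (L\<^sup>2 - (nrm (A (X n)))\<^sup>2))) \<longlonglongrightarrow> 0" by simp
  qed (use bound XH in auto)
  then have sub: "tends (\<lambda>n. A (A (X (r n))) + L\<^sup>2 *\<^sub>R X (r n)) 0 sequentially"
    unfolding tends_def using LIMSEQ_subseq_LIMSEQ[OF _ r(1)] by (auto simp: o_def)
  have "tends (\<lambda>n. (1 / L\<^sup>2) *\<^sub>R ((A (A (X (r n))) + L\<^sup>2 *\<^sub>R X (r n)) + (-1) *\<^sub>R A (A (X (r n)))))
      ((1 / L\<^sup>2) *\<^sub>R (0 + (-1) *\<^sub>R z)) sequentially"
    using XH r by (intro tends_scale tends_add sub) auto
  then have conv: "tends (\<lambda>n. X (r n)) ((- 1 / L\<^sup>2) *\<^sub>R z) sequentially"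
    using L by simp
  define x where "x = (- 1 / L\<^sup>2) *\<^sub>R z"
  have xH: "x \<in> H" using r by (auto simp: x_def)
  have conv: "tends (\<lambda>n. X (r n)) x sequentially" using conv by (simp add: x_def)
  have xc: "x \<in> conservative" by (rule conservative_closed[OF conv X(1) xH])
  have "tends (\<lambda>n. A (A (X (r n)))) (A (A x)) sequentially"
    using conv XH xH by (intro tends_A) auto
  then have "A (A x) = z" using tends_unique[OF _ r(3)] XH xH r(2) by auto
  then have e: "A (A x) = - (L\<^sup>2) *\<^sub>R x" using L by (simp add: x_def)
  have "(\<lambda>n. nrm (A (X (r n)))) \<longlonglongrightarrow> nrm (A x)"
    using conv XH xH by (intro tends_nrm tends_A) auto
  moreover have "(\<lambda>n. nrm (A (X (r n)))) \<longlonglongrightarrow> L"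
    using LIMSEQ_subseq_LIMSEQ[OF lim1 r(1)] by (simp add: o_def)
  ultimately have "nrm (A x) = L" by (rule LIMSEQ_unique)
  then have "x \<noteq> 0" using L by auto
  then show ?thesis using xc e L by blast
qed

lemma flow_nrm_convergent:
  assumes x: "x \<in> H"
  obtains c where "((\<lambda>t. nrm (flow t x)) \<longlongrightarrow> c) at_top" "c \<ge> 0" "\<And>t. t \<ge> 0 \<Longrightarrow> c \<le> nrm (flow t x)"
proof -
  define c where "c = Inf ((\<lambda>t. nrm (flow t x)) ` {0..})"
  have bdd: "bdd_below ((\<lambda>t. nrm (flow t x)) ` {0..})"
    by (rule bdd_belowI[of _ 0]) (use x in auto)
  have le: "c \<le> nrm (flow t x)" if "t \<ge> 0" for t
    unfolding c_def by (rule cInf_lower[OF _ bdd]) (use that in auto)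
  have "c \<ge> 0" unfolding c_def by (rule cInf_greatest) (use x in auto)
  moreover have "((\<lambda>t. nrm (flow t x)) \<longlongrightarrow> c) at_top"
  proof (rule tendstoI)
    fix e :: real assume "e > 0"
    then have "\<exists>r\<in>(\<lambda>t. nrm (flow t x)) ` {0..}. r < c + e"
      unfolding c_def by (intro cInf_lessD) auto
    then obtain T where T: "T \<ge> 0" "nrm (flow T x) < c + e" by auto
    show "\<forall>\<^sub>F t in at_top. dist (nrm (flow t x)) c < e"
      using eventually_ge_at_top[of T]
    proof eventually_elim
      case (elim t)
      then show ?case using flow_decreasing[OF x T(1) elim] T le[of t] by (auto simp: dist_real_def)
    qed
  qed
  ultimately show ?thesis using that le by blast
qed

text \<open>LaSalle's principle. Along a sequence of times, \<open>A (flow t w)\<close> converges to some \<open>y\<close> because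
\<open>flow t w\<close> is bounded. All points of the trajectory of \<open>y\<close> have the norm \<open>c\<close>, the limit of the
decreasing norms, so \<open>y\<close> is conservative. Without a conservative eigenvector, \<open>A y = 0\<close>.\<close>

lemma flow_range_tendsto_0:
  assumes inj: "\<And>x. x \<in> H \<Longrightarrow> A x = 0 \<Longrightarrow> x = 0"
    and noeig: "\<And>x \<mu>. x \<in> H \<Longrightarrow> \<mu> > 0 \<Longrightarrow> A (A x) = - (\<mu>\<^sup>2) *\<^sub>R x \<Longrightarrow> ip (A x) x = 0 \<Longrightarrow>
        ip (A (A x)) (A x) = 0 \<Longrightarrow> x = 0"
    and w: "w \<in> H"
  shows "((\<lambda>t. nrm (flow t (A w))) \<longlongrightarrow> 0) at_top"
proof -
  obtain c where c: "((\<lambda>t. nrm (flow t (A w))) \<longlongrightarrow> c) at_top" "c \<ge> 0"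
      "\<And>t. t \<ge> 0 \<Longrightarrow> c \<le> nrm (flow t (A w))"
    using flow_nrm_convergent[OF A_in[OF w]] by blast
  obtain r y where r: "strict_mono r" "y \<in> H" "tends (\<lambda>n. A (flow (real (r n)) w)) y sequentially"
    using compact[of "\<lambda>n. flow (real n) w" "nrm w"] w flow_contraction by force
  have lim: "filterlim (\<lambda>n. s + real (r n)) at_top sequentially" for s
    by (intro filterlim_tendsto_add_at_top[OF tendsto_const]
        filterlim_compose[OF filterlim_real_sequentially filterlim_subseq[OF r(1)]])
  have nc: "nrm (flow s y) = c" if s: "s \<ge> 0" for s
  proof -
    have "(\<lambda>n. nrm (flow s (A (flow (real (r n)) w)))) \<longlonglongrightarrow> nrm (flow s y)"
      using r w s by (intro tends_nrm flow_continuous) auto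
    moreover have "flow s (A (flow (real (r n)) w)) = flow (s + real (r n)) (A w)" for n
      using w s by (simp add: flow_A[symmetric] flow_flow)
    moreover have "(\<lambda>n. nrm (flow (s + real (r n)) (A w))) \<longlonglongrightarrow> c"
      by (rule filterlim_compose[OF c(1) lim])
    ultimately show ?thesis using LIMSEQ_unique by simp
  qed
  have loss: "ip (A (flow s y)) (flow s y) = 0" if s: "s \<ge> 0" for s
  proof -
    have "((\<lambda>s. ip (flow s y) (flow s y)) has_real_derivative 2 * ip (A (flow s y)) (flow s y)) (at s within {0..})"
      by (rule solution_energy_deriv[OF flow_solution[OF r(2)] s])
    moreover have "((\<lambda>s. ip (flow s y) (flow s y)) has_real_derivative 0) (at s within {0..})"
    proof (rule has_field_derivative_transform_within[OF DERIV_const zero_less_one])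
      fix q assume "q \<in> {0::real..}" "dist q s < 1"
      then show "c\<^sup>2 = ip (flow q y) (flow q y)" using nc[of q] nrm_sq[of "flow q y"] r(2) by auto
    qed (use s in auto)
    ultimately have "2 * ip (A (flow s y)) (flow s y) = 0"
      by (rule nonneg_derivative_unique[OF s])
    then show ?thesis by simp
  qed
  have yc: "y \<in> conservative"
    unfolding conservative_def using r(2) loss by (auto intro: sym_part_null)
  have "A y = 0"
  proof (rule ccontr)
    assume "A y \<noteq> 0"
    then obtain x \<mu> where x: "x \<in> conservative" "\<mu> > 0" "x \<noteq> 0" "A (A x) = - (\<mu>\<^sup>2) *\<^sub>R x"
      using conservative_eigenvector[OF yc] by blast
    have *: "ip (A z) z = 0" if "z \<in> conservative" for z
      using conservative_skew[OF that, of z] ip_sym[of z "A z"] conservative_H[OF that] by simp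
    show False
      using noeig[of x \<mu>] x * conservative_H conservative_A by blast
  qed
  then have "y = 0" using inj r(2) by blast
  then have "c = 0" using nc[of 0] by simp
  then show ?thesis using c(1) by simp
qed

text \<open>The hypothesis \<open>weak\<close> extends the conclusion from the range of \<open>A\<close> to all states. Let \<open>c\<close> be the limit
of the norms and \<open>p\<close> a point of the trajectory. The midpoint \<open>m\<close> of \<open>p\<close> and \<open>flow n p\<close> has the same
asymptotic norm \<open>c\<close>, because the difference of their trajectories is controlled by \<open>A (flow s p)\<close>.
On the other hand \<open>flow n p\<close> tends weakly to zero, so \<open>\<parallel>m\<parallel>\<^sup>2\<close> is at most \<open>\<parallel>p\<parallel>\<^sup>2 / 2\<close> up to an error
that vanishes as \<open>n\<close> grows.\<close>

theorem strong_stability: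
  assumes weak: "\<And>X M y. (\<And>n::nat. X n \<in> H) \<Longrightarrow> (\<And>n. nrm (X n) \<le> M) \<Longrightarrow>
        tends (\<lambda>n. A (X n)) 0 sequentially \<Longrightarrow> y \<in> H \<Longrightarrow> (\<lambda>n. ip (X n) y) \<longlonglongrightarrow> 0"
    and noeig: "\<And>x \<mu>. x \<in> H \<Longrightarrow> \<mu> > 0 \<Longrightarrow> A (A x) = - (\<mu>\<^sup>2) *\<^sub>R x \<Longrightarrow> ip (A x) x = 0 \<Longrightarrow>
        ip (A (A x)) (A x) = 0 \<Longrightarrow> x = 0"
    and x: "x \<in> H"
  shows "((\<lambda>t. nrm (flow t x)) \<longlongrightarrow> 0) at_top"
proof -
  have inj: "z = 0" if "z \<in> H" "A z = 0" for z
  proof -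
    have "(\<lambda>n::nat. ip z z) \<longlonglongrightarrow> 0"
      using that by (intro weak[of "\<lambda>_. z" "nrm z"]) (auto simp: tends_const)
    then have "ip z z = 0" using LIMSEQ_unique tendsto_const by blast
    then show ?thesis using ip_pos[OF that(1)] by force
  qed
  have lasalle: "((\<lambda>t. nrm (flow t (A w))) \<longlongrightarrow> 0) at_top" if "w \<in> H" for w
    using flow_range_tendsto_0[of w] inj noeig that by blast
  obtain c where c: "((\<lambda>t. nrm (flow t x)) \<longlongrightarrow> c) at_top" "c \<ge> 0" "\<And>t. t \<ge> 0 \<Longrightarrow> c \<le> nrm (flow t x)"
    using flow_nrm_convergent[OF x] by blast
  have key: "c\<^sup>2 \<le> (nrm p)\<^sup>2 / 2" if T: "T \<ge> 0" and p: "p = flow T x" for p T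
  proof -
    have pH: "p \<in> H" using x T p by auto
    have Fp: "flow s p = flow (s + T) x" if "s \<ge> 0" for s using flow_flow[OF x that T] p by simp
    have Alim: "(\<lambda>n. nrm (A (flow (real n) p))) \<longlonglongrightarrow> 0"
      using filterlim_compose[OF lasalle[OF pH] filterlim_real_sequentially]
      by (simp add: flow_A pH)
    have ipl: "(\<lambda>n. ip (flow (real n) p) p) \<longlonglongrightarrow> 0"
      using pH flow_contraction Alim by (intro weak[of _ "nrm p"]) (auto simp: tends_def)
    have main: "c\<^sup>2 \<le> (nrm p)\<^sup>2 / 2 + ip (flow (real n) p) p / 2" for n
    proof -
      let ?m = "(1/2) *\<^sub>R (p + flow (real n) p)"
      have mH: "?m \<in> H" using pH by auto
      have fm: "flow s ?m = flow s p + (1/2) *\<^sub>R (flow (real n) (flow s p) - flow s p)" if "s \<ge> 0" for s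
      proof -
        have "flow s ?m = (1/2) *\<^sub>R (flow s p + flow (real n) (flow s p))"
          using pH that by (simp add: flow_scale flow_add flow_flow add.commute)
        then show ?thesis by (simp add: algebra_simps) (simp add: scaleR_add_left[symmetric])
      qed
      \<comment> \<open>The trajectory of the midpoint stays close to that of \<open>p\<close> and its norm is at most \<open>\<parallel>m\<parallel>\<close>.\<close>
      have low: "nrm (flow s p) - (1/2) * (real n * nrm (flow s (A p))) \<le> nrm ?m" if s: "s \<ge> 0" for s
      proof -
        let ?d = "(1/2) *\<^sub>R (flow (real n) (flow s p) - flow s p)"
        have dH: "?d \<in> H" "flow s p \<in> H" using pH s by auto
        have "nrm ?d = (1/2) * nrm (flow (real n) (flow s p) - flow s p)"
          using pH s by (subst nrm_scale) auto
        also have "\<dots> \<le> (1/2) * (real n * nrm (A (flow s p)))"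
          using flow_diff_bound[of "flow s p" "real n"] pH s by auto
        finally have 1: "nrm ?d \<le> (1/2) * (real n * nrm (flow s (A p)))" using flow_A[OF pH s] by simp
        have "nrm (flow s p) \<le> nrm (flow s ?m) + nrm ?d"
          using nrm_triangle_diff[of "flow s ?m" ?d] dH mH s fm[OF s] by simp
        also have "nrm (flow s ?m) \<le> nrm ?m" using flow_contraction[OF mH s] .
        finally show ?thesis using 1 by linarith
      qed
      have "((\<lambda>s. nrm (flow s p) - (1/2) * (real n * nrm (flow s (A p)))) \<longlongrightarrow> c - (1/2) * (real n * 0)) at_top"
      proof (intro tendsto_intros lasalle pH)
        have "filterlim (\<lambda>s. s + T) at_top at_top"
          using filterlim_tendsto_add_at_top[OF tendsto_const[of T] filterlim_ident] by (simp add: add.commute)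
        from filterlim_compose[OF c(1) this] show "((\<lambda>s. nrm (flow s p)) \<longlongrightarrow> c) at_top"
          by (rule Lim_transform_eventually) (use eventually_ge_at_top[of "0::real"] in eventually_elim, simp add: Fp)
      qed
      then have "c - (1/2) * (real n * 0) \<le> nrm ?m"
        by (rule tendsto_upperbound) (use eventually_ge_at_top[of "0::real"] in eventually_elim, rule low, auto)
      then have "c\<^sup>2 \<le> (nrm ?m)\<^sup>2" using c(2) by (intro power_mono) auto
      also have "\<dots> = ((nrm p)\<^sup>2 + (nrm (flow (real n) p))\<^sup>2 + 2 * ip (flow (real n) p) p) / 4"
        using pH mH ip_sym[of p "flow (real n) p"] by (simp add: nrm_sq ip_linear algebra_simps)
      also have "(nrm (flow (real n) p))\<^sup>2 \<le> (nrm p)\<^sup>2"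
        using flow_contraction[OF pH, of "real n"] pH by (intro power_mono) auto
      finally show ?thesis by simp
    qed
    have "(\<lambda>n. (nrm p)\<^sup>2 / 2 + ip (flow (real n) p) p / 2) \<longlonglongrightarrow> (nrm p)\<^sup>2 / 2 + 0 / 2"
      by (intro tendsto_intros ipl) auto
    then have "c\<^sup>2 \<le> (nrm p)\<^sup>2 / 2 + 0 / 2"
      by (rule LIMSEQ_le_const) (use main in auto)
    then show ?thesis by simp
  qed
  have "((\<lambda>t. (nrm (flow t x))\<^sup>2 / 2) \<longlongrightarrow> c\<^sup>2 / 2) at_top" by (intro tendsto_intros c) auto
  then have "c\<^sup>2 \<le> c\<^sup>2 / 2"
    by (rule tendsto_lowerbound) (use eventually_ge_at_top[of "0::real"] in eventually_elim, rule key, auto)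
  then have "c = 0" by (simp add: power2_eq_square) (metis mult_eq_0_iff c(2) less_eq_real_def mult_pos_pos not_less)
  then show ?thesis using c(1) by simp
qed

text \<open>An eigenvector for \<open>\<i>\<omega>\<close> in real terms: \<open>x\<close> and \<open>y\<close> span a plane on which the flow is a rotation.\<close>

lemma oscillation:
  assumes x: "x \<in> H" and y: "y \<in> H" and A: "A x = \<omega> *\<^sub>R y" "A y = - \<omega> *\<^sub>R x"
  shows "t \<ge> 0 \<Longrightarrow> flow t x = cos (\<omega> * t) *\<^sub>R x + sin (\<omega> * t) *\<^sub>R y"
proof (rule flow_eq)
  show "solution x (\<lambda>t. cos (\<omega> * t) *\<^sub>R x + sin (\<omega> * t) *\<^sub>R y)"
    unfolding solution_def
  proof (intro conjI allI impI)
    fix t :: real assume t: "t \<ge> 0"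
    let ?u = "\<lambda>t. cos (\<omega> * t) *\<^sub>R x + sin (\<omega> * t) *\<^sub>R y"
    define C where "C s = (cos (\<omega> * s) - cos (\<omega> * t)) / (s - t)" for s
    define S where "S s = (sin (\<omega> * s) - sin (\<omega> * t)) / (s - t)" for s
    have "((\<lambda>t. cos (\<omega> * t)) has_real_derivative - \<omega> * sin (\<omega> * t)) (at t within {0..})"
      by (auto intro!: derivative_eq_intros)
    then have C: "(C \<longlongrightarrow> - \<omega> * sin (\<omega> * t)) (at t within {0..})"
      by (simp add: has_field_derivative_iff C_def[abs_def])
    have "((\<lambda>t. sin (\<omega> * t)) has_real_derivative \<omega> * cos (\<omega> * t)) (at t within {0..})"
      by (auto intro!: derivative_eq_intros)
    then have S: "(S \<longlongrightarrow> \<omega> * cos (\<omega> * t)) (at t within {0..})"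
      by (simp add: has_field_derivative_iff S_def[abs_def])
    have Q: "(1 / (s - t)) *\<^sub>R (?u s - ?u t) = C s *\<^sub>R x + S s *\<^sub>R y" for s
      by (simp add: C_def S_def algebra_simps diff_divide_distrib)
    have AU: "A (?u t) = (- \<omega> * sin (\<omega> * t)) *\<^sub>R x + (\<omega> * cos (\<omega> * t)) *\<^sub>R y"
      using x y A by (simp add: A_add A_scale mult.commute)
    show "tends (\<lambda>s. (1 / (s - t)) *\<^sub>R (?u s - ?u t)) (A (?u t)) (at t within {0..})"
      unfolding Q AU
    proof (rule tendsI_le)
      have "((\<lambda>s. \<bar>C s - - \<omega> * sin (\<omega> * t)\<bar> * nrm x + \<bar>S s - \<omega> * cos (\<omega> * t)\<bar> * nrm y)
        \<longlongrightarrow> \<bar>- \<omega> * sin (\<omega> * t) - - \<omega> * sin (\<omega> * t)\<bar> * nrm x + \<bar>\<omega> * cos (\<omega> * t) - \<omega> * cos (\<omega> * t)\<bar> * nrm y)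
        (at t within {0..})"
        by (intro tendsto_intros C S)
      then show "((\<lambda>s. \<bar>C s - - \<omega> * sin (\<omega> * t)\<bar> * nrm x + \<bar>S s - \<omega> * cos (\<omega> * t)\<bar> * nrm y) \<longlongrightarrow> 0)
        (at t within {0..})" by simp
      have "nrm (C s *\<^sub>R x + S s *\<^sub>R y - ((- \<omega> * sin (\<omega> * t)) *\<^sub>R x + (\<omega> * cos (\<omega> * t)) *\<^sub>R y))
        \<le> \<bar>C s - - \<omega> * sin (\<omega> * t)\<bar> * nrm x + \<bar>S s - \<omega> * cos (\<omega> * t)\<bar> * nrm y" for s
      proof -
        have "C s *\<^sub>R x + S s *\<^sub>R y - ((- \<omega> * sin (\<omega> * t)) *\<^sub>R x + (\<omega> * cos (\<omega> * t)) *\<^sub>R y)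
           = (C s - - \<omega> * sin (\<omega> * t)) *\<^sub>R x + (S s - \<omega> * cos (\<omega> * t)) *\<^sub>R y"
          by (simp add: algebra_simps)
        then show ?thesis
          using nrm_triangle[of "(C s - - \<omega> * sin (\<omega> * t)) *\<^sub>R x" "(S s - \<omega> * cos (\<omega> * t)) *\<^sub>R y"] x y
          by (simp only: H_scale nrm_scale)
      qed
      then show "\<forall>\<^sub>F s in at t within {0..}. nrm (C s *\<^sub>R x + S s *\<^sub>R y - ((- \<omega> * sin (\<omega> * t)) *\<^sub>R x + (\<omega> * cos (\<omega> * t)) *\<^sub>R y))
        \<le> \<bar>C s - - \<omega> * sin (\<omega> * t)\<bar> * nrm x + \<bar>S s - \<omega> * cos (\<omega> * t)\<bar> * nrm y" by simp
    qed (use x y in auto)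
  qed (use x y in auto)
qed

theorem oscillation_unstable:
  assumes x: "x \<in> H" "x \<noteq> 0" and y: "y \<in> H" and A: "A x = \<omega> *\<^sub>R y" "A y = - \<omega> *\<^sub>R x"
  shows "\<not> ((\<lambda>t. nrm (flow t x)) \<longlongrightarrow> 0) at_top"
proof
  assume lim: "((\<lambda>t. nrm (flow t x)) \<longlongrightarrow> 0) at_top"
  \<comment> \<open>A positive period of the rotation.\<close>
  define p where "p = (if \<omega> = 0 then 1 else 2 * pi / \<bar>\<omega>\<bar>)"
  have p: "p > 0" by (simp add: p_def)
  have "flow (real n * p) x = x" for n
  proof -
    have "\<exists>k::int. \<omega> * (real n * p) = 2 * pi * of_int k"
    proof (cases "\<omega> = 0")
      case False
      then have "\<omega> * (real n * p) = 2 * pi * of_int (if \<omega> > 0 then int n else - int n)"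
        by (simp add: p_def field_simps abs_if)
      then show ?thesis by blast
    qed (auto intro: exI[of _ 0])
    then obtain k :: int where k: "\<omega> * (real n * p) = 2 * pi * of_int k" by blast
    then show ?thesis
      using oscillation[OF x(1) y A, of "real n * p"] p by simp
  qed
  moreover have "filterlim (\<lambda>n. real n * p) at_top sequentially"
    using filterlim_at_top_mult_tendsto_pos[OF tendsto_const p filterlim_real_sequentially] by (simp add: mult.commute)
  from filterlim_compose[OF lim this] have "(\<lambda>n. nrm (flow (real n * p) x)) \<longlonglongrightarrow> 0" .
  ultimately have "nrm x = 0" using LIMSEQ_unique tendsto_const by fastforce
  then show False using x nrm_eq_0 by blast
qed

end

section \<open>Square-integrable functions on an interval\<close>

lemma finite_measure_interval: "finite_measure (interval_measure l)"
  by (intro finite_measure_lebesgue_on) simp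

lemma continuous_interval_measurable:
  "continuous_on {0..l} f \<Longrightarrow> f \<in> borel_measurable (interval_measure l)"
  by (rule continuous_imp_measurable_on_sets_lebesgue) (auto elim: continuous_on_subset)

lemma interval_subset_measurable:
  assumes "f \<in> borel_measurable (interval_measure l)" "x \<le> l"
  shows "f \<in> borel_measurable (interval_measure x)"
proof -
  have "f \<in> borel_measurable (restrict_space (interval_measure l) {0<..<x})"
    using assms(1) by (rule measurable_restrict_space1)
  moreover have "restrict_space (interval_measure l) {0<..<x} = interval_measure x"
    using assms(2) by (simp add: restrict_restrict_space Int_absorb1 subset_iff)
  ultimately show ?thesis by simp
qed

lemma L2_measurable: "f \<in> L2 l \<Longrightarrow> f \<in> borel_measurable (interval_measure l)"
  by (simp add: L2_def)

lemma L2_sq_integrable: "f \<in> L2 l \<Longrightarrow> integrable (interval_measure l) (\<lambda>x. (cmod (f x))\<^sup>2)"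
  by (simp add: L2_def)

lemma L2_mult_integrable:
  assumes "f \<in> L2 l" "g \<in> L2 l"
  shows "integrable (interval_measure l) (\<lambda>x. f x * g x)"
proof (rule Bochner_Integration.integrable_bound)
  show "integrable (interval_measure l) (\<lambda>x. (cmod (f x))\<^sup>2 + (cmod (g x))\<^sup>2)"
    using assms by (intro Bochner_Integration.integrable_add L2_sq_integrable)
  show "(\<lambda>x. f x * g x) \<in> borel_measurable (interval_measure l)"
    using assms by (intro borel_measurable_times L2_measurable)
  have "a * b \<le> a\<^sup>2 + b\<^sup>2" for a b :: real
    using sum_squares_bound[of a b] sum_power2_ge_zero[of a b] by linarith
  then show "AE x in interval_measure l. norm (f x * g x) \<le> norm ((cmod (f x))\<^sup>2 + (cmod (g x))\<^sup>2)"
    by (simp add: norm_mult)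
qed

lemma L2_add: assumes "f \<in> L2 l" "g \<in> L2 l" shows "(\<lambda>x. f x + g x) \<in> L2 l"
  unfolding L2_def
proof (intro CollectI conjI)
  show m: "(\<lambda>x. f x + g x) \<in> borel_measurable (interval_measure l)"
    using assms by (intro borel_measurable_add L2_measurable)
  show "integrable (interval_measure l) (\<lambda>x. (cmod (f x + g x))\<^sup>2)"
  proof (rule Bochner_Integration.integrable_bound)
    show "integrable (interval_measure l) (\<lambda>x. 2 * (cmod (f x))\<^sup>2 + 2 * (cmod (g x))\<^sup>2)"
      using assms by (intro Bochner_Integration.integrable_add integrable_mult_right L2_sq_integrable)
    show "(\<lambda>x. (cmod (f x + g x))\<^sup>2) \<in> borel_measurable (interval_measure l)"
      using m by measurable
    have "(cmod (a + b))\<^sup>2 \<le> 2 * (cmod a)\<^sup>2 + 2 * (cmod b)\<^sup>2" for a b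
    proof -
      have "(cmod (a + b))\<^sup>2 \<le> (cmod a + cmod b)\<^sup>2" by (intro power_mono norm_triangle_ineq) auto
      also have "\<dots> \<le> 2 * (cmod a)\<^sup>2 + 2 * (cmod b)\<^sup>2"
        using sum_squares_bound[of "cmod a" "cmod b"] by (simp add: power2_sum)
      finally show ?thesis .
    qed
    then show "AE x in interval_measure l. norm ((cmod (f x + g x))\<^sup>2) \<le> norm (2 * (cmod (f x))\<^sup>2 + 2 * (cmod (g x))\<^sup>2)"
      by (intro AE_I2) (smt (verit) real_norm_def zero_le_power2)
  qed
qed

lemma L2_cmult: "f \<in> L2 l \<Longrightarrow> (\<lambda>x. c * f x) \<in> L2 l"
  unfolding L2_def by (auto simp: norm_mult power_mult_distrib)

lemma L2_diff: "f \<in> L2 l \<Longrightarrow> g \<in> L2 l \<Longrightarrow> (\<lambda>x. f x - g x) \<in> L2 l"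
  using L2_add[OF _ L2_cmult[of g l "-1"], of f] by simp

lemma borel_measurable_cnj: "f \<in> borel_measurable M \<Longrightarrow> (\<lambda>x. cnj (f x)) \<in> borel_measurable M"
  by (rule borel_measurable_continuous_on[where f = cnj]) (auto intro: continuous_intros)

lemma L2_cnj: "f \<in> L2 l \<Longrightarrow> (\<lambda>x. cnj (f x)) \<in> L2 l"
  unfolding L2_def by (auto intro: borel_measurable_cnj)

lemma L2_bounded:
  assumes "f \<in> borel_measurable (interval_measure l)" "\<And>x. x \<in> {0<..<l} \<Longrightarrow> cmod (f x) \<le> B"
  shows "f \<in> L2 l"
  unfolding L2_def
proof (intro CollectI conjI assms(1))
  interpret finite_measure "interval_measure l" by (rule finite_measure_interval)
  show "integrable (interval_measure l) (\<lambda>x. (cmod (f x))\<^sup>2)"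
  proof (rule integrable_const_bound[where B = "B\<^sup>2"])
    show "AE x in interval_measure l. norm ((cmod (f x))\<^sup>2) \<le> B\<^sup>2"
      using assms(2) by (intro AE_I2) (auto intro!: power_mono)
    show "(\<lambda>x. (cmod (f x))\<^sup>2) \<in> borel_measurable (interval_measure l)"
      using assms(1) by measurable
  qed
qed

lemma L2_continuous:
  assumes "continuous_on {0..l} f" shows "f \<in> L2 l"
proof -
  have "compact (f ` {0..l})" using assms by (intro compact_continuous_image) auto
  then obtain B where "\<And>x. x \<in> {0..l} \<Longrightarrow> cmod (f x) \<le> B"
    using compact_imp_bounded bounded_iff by (metis imageI)
  then show ?thesis
    using assms by (intro L2_bounded[where B = B] continuous_interval_measurable) auto
qed

lemma L2_const: "(\<lambda>x. c) \<in> L2 l"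
  by (rule L2_continuous) (rule continuous_on_const)

lemma L2_integrable: "f \<in> L2 l \<Longrightarrow> integrable (interval_measure l) f"
  using L2_mult_integrable[OF _ L2_const, of f l 1] by simp

lemma L2_cong_AE:
  assumes "f \<in> L2 l" "g \<in> borel_measurable (interval_measure l)" "AE x in interval_measure l. f x = g x"
  shows "g \<in> L2 l"
  unfolding L2_def
proof (intro CollectI conjI assms)
  show "integrable (interval_measure l) (\<lambda>x. (cmod (g x))\<^sup>2)"
  proof (rule integrable_cong_AE_imp[OF L2_sq_integrable[OF assms(1)]])
    show "(\<lambda>x. (cmod (g x))\<^sup>2) \<in> borel_measurable (interval_measure l)"
      using assms(2) by measurable
    show "AE x in interval_measure l. (cmod (f x))\<^sup>2 = (cmod (g x))\<^sup>2"
      using assms(3) by eventually_elim simp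
  qed
qed

definition sqnorm :: "real \<Rightarrow> (real \<Rightarrow> complex) \<Rightarrow> real"
  where "sqnorm l f = (LINT x|interval_measure l. (cmod (f x))\<^sup>2)"

lemma sqnorm_nonneg: "0 \<le> sqnorm l f"
  unfolding sqnorm_def by (rule integral_nonneg_AE) simp

lemma sqnorm_add:
  assumes "f \<in> L2 l" "g \<in> L2 l"
  shows "sqnorm l (\<lambda>x. f x + g x) \<le> 2 * sqnorm l f + 2 * sqnorm l g"
proof -
  have "sqnorm l (\<lambda>x. f x + g x) \<le> (LINT x|interval_measure l. 2 * (cmod (f x))\<^sup>2 + 2 * (cmod (g x))\<^sup>2)"
    unfolding sqnorm_def
  proof (rule integral_mono)
    show "integrable (interval_measure l) (\<lambda>x. (cmod (f x + g x))\<^sup>2)"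
      using L2_sq_integrable[OF L2_add[OF assms]] .
    show "integrable (interval_measure l) (\<lambda>x. 2 * (cmod (f x))\<^sup>2 + 2 * (cmod (g x))\<^sup>2)"
      using assms by (intro Bochner_Integration.integrable_add integrable_mult_right L2_sq_integrable)
    fix x
    have "(cmod (f x + g x))\<^sup>2 \<le> (cmod (f x) + cmod (g x))\<^sup>2" by (intro power_mono norm_triangle_ineq) auto
    also have "\<dots> \<le> 2 * (cmod (f x))\<^sup>2 + 2 * (cmod (g x))\<^sup>2"
      using sum_squares_bound[of "cmod (f x)" "cmod (g x)"] by (simp add: power2_sum)
    finally show "(cmod (f x + g x))\<^sup>2 \<le> 2 * (cmod (f x))\<^sup>2 + 2 * (cmod (g x))\<^sup>2" .
  qed
  also have "\<dots> = 2 * sqnorm l f + 2 * sqnorm l g"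
    using assms by (simp add: sqnorm_def L2_sq_integrable)
  finally show ?thesis .
qed

lemma L2_Cauchy_Schwarz:
  assumes f: "f \<in> L2 l" and g: "g \<in> L2 l"
  shows "cmod (LINT x|interval_measure l. f x * g x) \<le> sqrt (sqnorm l f) * sqrt (sqnorm l g)"
proof -
  let ?M = "interval_measure l"
  define b where "b = (LINT x|?M. cmod (f x) * cmod (g x))"
  have i: "integrable ?M (\<lambda>x. cmod (f x) * cmod (g x))"
    using integrable_norm[OF L2_mult_integrable[OF f g]] by (simp add: norm_mult)
  have "b\<^sup>2 \<le> sqnorm l f * sqnorm l g"
  proof (rule discriminant_nonpos)
    fix t :: real
    have "0 \<le> (LINT x|?M. (cmod (f x) + t * cmod (g x))\<^sup>2)" by (rule integral_nonneg_AE) simp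
    also have "\<dots> = (LINT x|?M. (cmod (f x))\<^sup>2 + 2 * t * (cmod (f x) * cmod (g x)) + t\<^sup>2 * (cmod (g x))\<^sup>2)"
      by (intro Bochner_Integration.integral_cong refl) (simp add: power2_eq_square algebra_simps)
    also have "\<dots> = sqnorm l f + 2 * t * b + t\<^sup>2 * sqnorm l g"
      unfolding sqnorm_def b_def using i f g by (simp add: L2_sq_integrable)
    finally show "0 \<le> sqnorm l f + 2 * t * b + t\<^sup>2 * sqnorm l g" .
  qed
  then have "b \<le> sqrt (sqnorm l f * sqnorm l g)" by (rule real_le_rsqrt)
  moreover have "cmod (LINT x|?M. f x * g x) \<le> b"
    unfolding b_def norm_mult[symmetric] by (rule integral_norm_bound)
  ultimately show ?thesis by (simp add: real_sqrt_mult)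
qed

lemma L2_dominated_convergence:
  assumes f: "f \<in> borel_measurable (interval_measure l)"
    and g: "\<And>n. g n \<in> borel_measurable (interval_measure l)"
    and w: "w \<in> L2 l" "\<And>n x. x \<in> {0<..<l} \<Longrightarrow> cmod (f x - g n x) \<le> cmod (w x)"
    and lim: "AE x in interval_measure l. (\<lambda>n. g n x) \<longlonglongrightarrow> f x"
  shows "(\<lambda>n. sqnorm l (\<lambda>x. f x - g n x)) \<longlonglongrightarrow> 0"
proof -
  have "(\<lambda>n. LINT x|interval_measure l. (cmod (f x - g n x))\<^sup>2) \<longlonglongrightarrow> (LINT x|interval_measure l. 0)"
  proof (rule integral_dominated_convergence[OF _ _ L2_sq_integrable[OF w(1)]])
    show "AE x in interval_measure l. (\<lambda>n. (cmod (f x - g n x))\<^sup>2) \<longlonglongrightarrow> 0"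
      using lim
    proof eventually_elim
      case (elim x)
      have "(\<lambda>n. (cmod (f x - g n x))\<^sup>2) \<longlonglongrightarrow> (cmod (f x - f x))\<^sup>2"
        by (intro tendsto_intros elim)
      then show ?case by simp
    qed
    show "AE x in interval_measure l. norm ((cmod (f x - g n x))\<^sup>2) \<le> (cmod (w x))\<^sup>2" for n
      by (intro AE_I2) (use w(2) in \<open>auto intro!: power_mono\<close>)
    show "(\<lambda>x. (cmod (f x - g n x))\<^sup>2) \<in> borel_measurable (interval_measure l)" for n
      using f g[of n] by measurable
  qed auto
  then show ?thesis by (simp add: sqnorm_def)
qed

section \<open>Density of continuously differentiable functions\<close>

text \<open>Approximation in the mean by functions that vanish at both ends: these are, up to extension by
zero, test functions supported on one edge, and integration by parts against them has no
boundary terms.\<close>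

definition C1_approximable :: "real \<Rightarrow> (real \<Rightarrow> complex) \<Rightarrow> bool"
  where "C1_approximable l h \<longleftrightarrow> (\<forall>e>0. \<exists>f f'. (\<forall>x. (f has_vector_derivative f' x) (at x)) \<and>
    continuous_on UNIV f' \<and> f 0 = 0 \<and> f l = 0 \<and> sqnorm l (\<lambda>x. h x - f x) < e)"

lemma C1_approximable_limit:
  assumes h: "h \<in> L2 l" and g: "\<And>n. g n \<in> L2 l" "\<And>n. C1_approximable l (g n)"
    and lim: "(\<lambda>n. sqnorm l (\<lambda>x. h x - g n x)) \<longlonglongrightarrow> 0"
  shows "C1_approximable l h"
  unfolding C1_approximable_def
proof (intro allI impI)
  fix e :: real assume e: "e > 0"
  then obtain n where n: "sqnorm l (\<lambda>x. h x - g n x) < e / 4"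
    using LIMSEQ_D[OF lim, of "e / 4"] sqnorm_nonneg by (auto dest: spec)
  have "e / 4 > 0" using e by simp
  with g(2)[of n, unfolded C1_approximable_def, rule_format, of "e / 4"]
  obtain f f' where f: "\<forall>x. (f has_vector_derivative f' x) (at x)" "continuous_on UNIV f'" "f 0 = 0" "f l = 0"
      "sqnorm l (\<lambda>x. g n x - f x) < e / 4"
    by blast
  have "continuous_on {0..l} f"
    using f(1) by (meson continuous_at_imp_continuous_on has_vector_derivative_continuous)
  then have "f \<in> L2 l" by (rule L2_continuous)
  then have "sqnorm l (\<lambda>x. (h x - g n x) + (g n x - f x)) \<le> 2 * sqnorm l (\<lambda>x. h x - g n x) + 2 * sqnorm l (\<lambda>x. g n x - f x)"
    by (intro sqnorm_add L2_diff h g)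
  also have "\<dots> < e" using n f(5) by linarith
  finally show "\<exists>f f'. (\<forall>x. (f has_vector_derivative f' x) (at x)) \<and>
    continuous_on UNIV f' \<and> f 0 = 0 \<and> f l = 0 \<and> sqnorm l (\<lambda>x. h x - f x) < e"
    using f by (intro exI[of _ f] exI[of _ f']) simp
qed

text \<open>Multiplication by \<open>1 - (1 - 2 x / l) ^ (2 n)\<close> produces zeros at both ends; inside the interval this
polynomial factor tends to one.\<close>

lemma C1_approximable_polynomial:
  fixes p :: "real \<Rightarrow> complex"
  assumes l: "l > 0" and p: "polynomial_function p"
  shows "C1_approximable l p"
proof (rule C1_approximable_limit)
  define k where "k n x = 1 - (1 - 2 / l * x) ^ (2 * n)" for n :: nat and x :: real
  have kp: "polynomial_function (k (Suc n))" for n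
    unfolding k_def real_polynomial_function_eq[symmetric]
    by (intro real_polynomial_function_diff real_polynomial_function_power
        real_polynomial_function.intros bounded_linear_ident)
  have kb: "0 \<le> (1 - 2 / l * x) ^ (2 * Suc n)" "(1 - 2 / l * x) ^ (2 * Suc n) \<le> 1" if "x \<in> {0<..<l}" for x n
  proof -
    have "\<bar>1 - 2 / l * x\<bar> \<le> 1" using that l by (auto simp: abs_le_iff field_simps)
    then have "(1 - 2 / l * x)\<^sup>2 \<le> 1" by (simp add: abs_square_le_1)
    then show "0 \<le> (1 - 2 / l * x) ^ (2 * Suc n)" "(1 - 2 / l * x) ^ (2 * Suc n) \<le> 1"
      by (simp_all only: power_mult zero_le_power zero_le_power2 power_le_one)
  qed
  have pc: "continuous_on S p" for S by (rule continuous_on_polymonial_function[OF p])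
  have kpc: "continuous_on S (\<lambda>x. k (Suc n) x *\<^sub>R p x)" for n S
    by (rule continuous_on_polymonial_function[OF polynomial_function_mult[OF kp p]])
  show "p \<in> L2 l" by (rule L2_continuous[OF pc])
  show "(\<lambda>x. k (Suc n) x *\<^sub>R p x) \<in> L2 l" for n by (rule L2_continuous[OF kpc])
  show "C1_approximable l (\<lambda>x. k (Suc n) x *\<^sub>R p x)" for n
  proof -
    obtain p' where "polynomial_function p'" "\<And>x. ((\<lambda>x. k (Suc n) x *\<^sub>R p x) has_vector_derivative p' x) (at x)"
      using has_vector_derivative_polynomial_function[OF polynomial_function_mult[OF kp p]] by blast
    then show ?thesis unfolding C1_approximable_def using l
      by (intro allI impI exI[of _ "\<lambda>x. k (Suc n) x *\<^sub>R p x"] exI[of _ p'])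
        (auto simp: continuous_on_polymonial_function k_def sqnorm_def)
  qed
  show "(\<lambda>n. sqnorm l (\<lambda>x. p x - k (Suc n) x *\<^sub>R p x)) \<longlonglongrightarrow> 0"
  proof (rule L2_dominated_convergence[OF _ _ L2_continuous[OF pc]])
    show "p \<in> borel_measurable (interval_measure l)" by (rule continuous_interval_measurable[OF pc])
    show "(\<lambda>x. k (Suc n) x *\<^sub>R p x) \<in> borel_measurable (interval_measure l)" for n
      by (rule continuous_interval_measurable[OF kpc])
    have e: "p x - k (Suc n) x *\<^sub>R p x = ((1 - 2 / l * x) ^ (2 * Suc n)) *\<^sub>R p x" for n x
      by (simp add: k_def algebra_simps)
    show "cmod (p x - k (Suc n) x *\<^sub>R p x) \<le> cmod (p x)" if "x \<in> {0<..<l}" for n x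
      unfolding e norm_scaleR using kb[OF that, of n] by (simp add: mult_left_le_one_le)
    show "AE x in interval_measure l. (\<lambda>n. k (Suc n) x *\<^sub>R p x) \<longlonglongrightarrow> p x"
    proof (rule AE_I2)
      fix x assume "x \<in> space (interval_measure l)"
      then have x: "0 < x" "x < l" by auto
      then have "\<bar>1 - 2 / l * x\<bar> < 1" by (auto simp: abs_less_iff field_simps)
      then have "(1 - 2 / l * x)\<^sup>2 < 1" by (simp add: abs_square_less_1)
      then have "(\<lambda>n. ((1 - 2 / l * x)\<^sup>2) ^ Suc n) \<longlonglongrightarrow> 0"
        by (intro LIMSEQ_ignore_initial_segment[where k = 1, simplified] LIMSEQ_realpow_zero) auto
      then have "(\<lambda>n. (1 - ((1 - 2 / l * x)\<^sup>2) ^ Suc n) *\<^sub>R p x) \<longlonglongrightarrow> (1 - 0) *\<^sub>R p x"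
        by (intro tendsto_intros)
      then show "(\<lambda>n. k (Suc n) x *\<^sub>R p x) \<longlonglongrightarrow> p x"
        unfolding k_def power_mult by simp
    qed
  qed
qed

lemma C1_approximable_continuous:
  assumes l: "l > 0" and h: "continuous_on {0..l} h"
  shows "C1_approximable l h"
proof -
  have "\<exists>p. polynomial_function p \<and> (\<forall>x\<in>{0..l}. cmod (h x - p x) < inverse (real (Suc n)))" for n
    using h by (intro Stone_Weierstrass_polynomial_function) auto
  then obtain p where p: "\<And>n. polynomial_function (p n)"
    "\<And>n x. x \<in> {0..l} \<Longrightarrow> cmod (h x - p n x) < inverse (real (Suc n))" by metis
  have pc: "continuous_on S (p n)" for S n by (rule continuous_on_polymonial_function[OF p(1)])
  show ?thesis
  proof (rule C1_approximable_limit[OF L2_continuous[OF h] L2_continuous[OF pc] C1_approximable_polynomial[OF l p(1)]])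
    show "(\<lambda>n. sqnorm l (\<lambda>x. h x - p n x)) \<longlonglongrightarrow> 0"
    proof (rule L2_dominated_convergence[OF _ _ L2_const[of 1]])
      show "h \<in> borel_measurable (interval_measure l)" by (rule continuous_interval_measurable[OF h])
      show "p n \<in> borel_measurable (interval_measure l)" for n by (rule continuous_interval_measurable[OF pc])
      show "cmod (h x - p n x) \<le> cmod 1" if "x \<in> {0<..<l}" for n x
      proof -
        have "inverse (real (Suc n)) \<le> 1" by (simp add: inverse_le_1_iff)
        then show ?thesis using p(2)[of x n] that by auto
      qed
      show "AE x in interval_measure l. (\<lambda>n. p n x) \<longlonglongrightarrow> h x"
      proof (rule AE_I2)
        fix x assume "x \<in> space (interval_measure l)"
        then have x: "x \<in> {0..l}" by auto
        show "(\<lambda>n. p n x) \<longlonglongrightarrow> h x"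
          by (rule Lim_transform2[OF tendsto_const], rule Lim_null_comparison[OF _ LIMSEQ_inverse_real_of_nat])
             (use p(2)[OF x] in \<open>auto intro!: always_eventually less_imp_le\<close>)
      qed
    qed
  qed
qed

text \<open>The radial retraction onto the disc of radius \<open>k\<close>, used for truncation since it is continuous.\<close>

definition clip :: "real \<Rightarrow> complex \<Rightarrow> complex"
  where "clip k z = (1 / max 1 (cmod z / k)) *\<^sub>R z"

lemma clip_le: assumes "k > 0" shows "cmod (clip k z) \<le> k" "cmod (clip k z) \<le> cmod z" "cmod z \<le> k \<Longrightarrow> clip k z = z"
  "cmod (z - clip k z) \<le> cmod z"
proof -
  have m: "max 1 (cmod z / k) \<ge> 1" "max 1 (cmod z / k) \<ge> cmod z / k" by auto
  have "cmod (clip k z) = cmod z / max 1 (cmod z / k)" by (simp add: clip_def)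
  moreover have "cmod z / max 1 (cmod z / k) \<le> k"
  proof -
    have "cmod z \<le> k * max 1 (cmod z / k)" using mult_left_mono[OF m(2), of k] assms by simp
    then show ?thesis using m(1) by (subst pos_divide_le_eq) auto
  qed
  moreover have "cmod z / max 1 (cmod z / k) \<le> cmod z"
    using m(1) by (subst pos_divide_le_eq) (auto simp: mult_le_cancel_left1)
  ultimately show "cmod (clip k z) \<le> k" "cmod (clip k z) \<le> cmod z" by auto
  show "clip k z = z" if "cmod z \<le> k"
  proof -
    have "max 1 (cmod z / k) = 1" using that assms by (simp add: max_def field_simps)
    then show ?thesis by (simp add: clip_def)
  qed
  have "z - clip k z = (1 - 1 / max 1 (cmod z / k)) *\<^sub>R z" by (simp add: clip_def scaleR_diff_left)
  moreover have "\<bar>1 - 1 / max 1 (cmod z / k)\<bar> \<le> 1" using m(1) by (simp add: field_simps)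
  ultimately show "cmod (z - clip k z) \<le> cmod z" by (simp add: mult_left_le_one_le)
qed

lemma clip_diff_le: "k > 0 \<Longrightarrow> cmod (clip k z - clip k w) \<le> 2 * k"
  using norm_triangle_ineq4[of "clip k z" "clip k w"] clip_le(1)[of k z] clip_le(1)[of k w] by linarith

lemma continuous_clip: "k > 0 \<Longrightarrow> continuous_on UNIV (clip k)"
  unfolding clip_def by (intro continuous_intros) auto

text \<open>A measurable function is an almost everywhere limit of continuous functions. Truncation by
\<open>clip\<close> supplies the bound for dominated convergence, first in the approximating sequence and then
in the truncation level.\<close>

theorem C1_dense_L2:
  assumes l: "l > 0" and h: "h \<in> L2 l"
  shows "C1_approximable l h"
proof -
  have "h measurable_on {0<..<l}"
    using L2_measurable[OF h] by (simp add: measurable_on_iff_borel_measurable)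
  then obtain N g where N: "negligible N" and g: "\<And>n. continuous_on UNIV (g n)"
    and lim: "\<And>x. x \<notin> N \<Longrightarrow> (\<lambda>n. g n x) \<longlonglongrightarrow> (if x \<in> {0<..<l} then h x else 0)"
    unfolding measurable_on_def by blast
  have clipm: "(\<lambda>x. clip (real (Suc k)) (h x)) \<in> borel_measurable (interval_measure l)" for k
    using borel_measurable_continuous_on[OF continuous_clip L2_measurable[OF h], of "real (Suc k)"] by simp
  have gc: "continuous_on S (\<lambda>x. clip (real (Suc k)) (g n x))" for k n S
    using continuous_on_compose2[OF continuous_clip[of "real (Suc k)"] continuous_on_subset[OF g[of n]], of S] by simp
  have AEN: "AE x in interval_measure l. x \<notin> N"
  proof -
    have "N \<in> null_sets lebesgue" using N by (simp add: negligible_iff_null_sets)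
    then have "AE x in lebesgue. x \<notin> N" by (rule AE_not_in)
    then show ?thesis by (subst AE_restrict_space_iff) (auto elim: eventually_mono)
  qed
  have clipL2: "(\<lambda>x. clip (real (Suc k)) (h x)) \<in> L2 l" for k
    by (rule L2_bounded[OF clipm, where B = "real (Suc k)"]) (rule clip_le, simp)
  have c: "C1_approximable l (\<lambda>x. clip (real (Suc k)) (h x))" for k
  proof (rule C1_approximable_limit[OF clipL2 L2_continuous[OF gc] C1_approximable_continuous[OF l gc]])
    show "(\<lambda>n. sqnorm l (\<lambda>x. clip (real (Suc k)) (h x) - clip (real (Suc k)) (g n x))) \<longlonglongrightarrow> 0"
    proof (rule L2_dominated_convergence[OF clipm _ L2_const[of "of_real (2 * real (Suc k))"]])
      show "(\<lambda>x. clip (real (Suc k)) (g n x)) \<in> borel_measurable (interval_measure l)" for n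
        by (rule continuous_interval_measurable[OF gc])
      show "cmod (clip (real (Suc k)) (h x) - clip (real (Suc k)) (g n x)) \<le> cmod (of_real (2 * real (Suc k)))" for n x
        unfolding norm_of_real by (rule order_trans[OF clip_diff_le abs_ge_self]) simp
      show "AE x in interval_measure l. (\<lambda>n. clip (real (Suc k)) (g n x)) \<longlonglongrightarrow> clip (real (Suc k)) (h x)"
        using AEN AE_space
      proof eventually_elim
        case (elim x)
        then have "(\<lambda>n. g n x) \<longlonglongrightarrow> h x" using lim[of x] by simp
        moreover have "isCont (clip (real (Suc k))) (h x)"
          using continuous_clip[of "real (Suc k)"] by (simp add: continuous_on_eq_continuous_at)
        ultimately show ?case using isCont_tendsto_compose by blast
      qed
    qed
  qed
  show ?thesis
  proof (rule C1_approximable_limit[OF h clipL2 c])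
    show "(\<lambda>k. sqnorm l (\<lambda>x. h x - clip (real (Suc k)) (h x))) \<longlonglongrightarrow> 0"
    proof (rule L2_dominated_convergence[OF L2_measurable[OF h] clipm h])
      show "cmod (h x - clip (real (Suc k)) (h x)) \<le> cmod (h x)" for k x
        by (rule clip_le) simp
      show "AE x in interval_measure l. (\<lambda>k. clip (real (Suc k)) (h x)) \<longlonglongrightarrow> h x"
      proof (rule AE_I2)
        fix x
        obtain K where K: "cmod (h x) \<le> real K" using real_arch_simple by blast
        have "clip (real (Suc k)) (h x) = h x" if "k \<ge> K" for k
          using K that by (intro clip_le) auto
        then show "(\<lambda>k. clip (real (Suc k)) (h x)) \<longlonglongrightarrow> h x"
          by (intro tendsto_eventually eventually_sequentiallyI[of K])
      qed
    qed
  qed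
qed

section \<open>Primitives of square-integrable functions\<close>

text \<open>Absolute continuity with a square-integrable derivative, stated as the fundamental theorem of
calculus.\<close>

definition is_primitive :: "real \<Rightarrow> (real \<Rightarrow> complex) \<Rightarrow> (real \<Rightarrow> complex) \<Rightarrow> bool"
  where "is_primitive l u g \<longleftrightarrow> g \<in> L2 l \<and>
    (\<forall>x\<in>{0..l}. u x = u 0 + (LINT y|interval_measure x. g y))"

lemma integrable_subinterval:
  fixes f :: "real \<Rightarrow> 'b::euclidean_space"
  assumes "integrable (interval_measure l) f" "x \<le> l"
  shows "integrable (interval_measure x) f"
proof -
  have "integrable lebesgue (\<lambda>y. indicator {0<..<l} y *\<^sub>R f y)"
    using assms(1) by (subst (asm) integrable_restrict_space) auto
  then have "integrable lebesgue (\<lambda>y. indicator {0<..<x} y *\<^sub>R (indicator {0<..<l} y *\<^sub>R f y))"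
    by (rule integrable_mult_indicator[rotated]) auto
  moreover have "(\<lambda>y. indicator {0<..<x} y *\<^sub>R (indicator {0<..<l} y *\<^sub>R f y)) = (\<lambda>y. indicator {0<..<x} y *\<^sub>R f y)"
    using assms(2) by (auto simp: fun_eq_iff indicator_def)
  ultimately show ?thesis by (subst integrable_restrict_space) auto
qed

lemma LINT_subinterval:
  fixes f :: "real \<Rightarrow> 'b::euclidean_space"
  assumes "x \<le> l"
  shows "(LINT y|interval_measure x. f y) = (LINT y|interval_measure l. indicator {..<x} y *\<^sub>R f y)"
proof -
  have "(LINT y|interval_measure l. indicator {..<x} y *\<^sub>R f y)
      = (LINT y|lebesgue. indicator {0<..<l} y *\<^sub>R (indicator {..<x} y *\<^sub>R f y))"
    by (subst integral_restrict_space) auto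
  also have "\<dots> = (LINT y|lebesgue. indicator {0<..<x} y *\<^sub>R f y)"
    using assms by (intro Bochner_Integration.integral_cong) (auto simp: indicator_def)
  also have "\<dots> = (LINT y|interval_measure x. f y)"
    by (subst integral_restrict_space) auto
  finally show ?thesis by simp
qed

lemma LINT_eq_integral:
  fixes f :: "real \<Rightarrow> 'b::euclidean_space"
  assumes "integrable (interval_measure l) f" "x \<le> l"
  shows "(LINT y|interval_measure x. f y) = integral {0..x} f"
  using lebesgue_integral_eq_integral[OF integrable_subinterval[OF assms]]
  by (simp add: integral_open_interval_real)

lemma LINT_eq_integral_continuous:
  fixes f :: "real \<Rightarrow> 'b::euclidean_space"
  assumes "continuous_on {0..l} f"
  shows "integrable (interval_measure l) f" "(LINT y|interval_measure l. f y) = integral {0..l} f"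
proof -
  have "f absolutely_integrable_on {0<..<l}"
    using absolutely_integrable_continuous_real[OF assms] set_integrable_subset
    by (metis greaterThanLessThan_subseteq_atLeastAtMost_iff lmeasurable_iff_integrable order_refl
        sets_completionI_sets sets_lborel borel_open open_greaterThanLessThan)
  then show *: "integrable (interval_measure l) f"
    by (simp add: set_integrable_def integrable_restrict_space)
  show "(LINT y|interval_measure l. f y) = integral {0..l} f"
    by (rule LINT_eq_integral[OF *]) simp
qed

text \<open>Both integrals are integrals of \<open>g x * h y\<close>, one over the triangle \<open>y < x\<close> and one over \<open>x < y\<close>;
the diagonal is a null set.\<close>

lemma LINT_product_triangles:
  fixes g h :: "real \<Rightarrow> complex"
  assumes g: "integrable (interval_measure l) g" and h: "integrable (interval_measure l) h"
  shows "(LINT x|interval_measure l. g x * (LINT y|interval_measure x. h y)) +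
         (LINT y|interval_measure l. h y * (LINT x|interval_measure y. g x)) =
         (LINT x|interval_measure l. g x) * (LINT y|interval_measure l. h y)"
proof -
  let ?M = "interval_measure l"
  interpret M: finite_measure ?M by (rule finite_measure_interval)
  interpret P: pair_sigma_finite ?M ?M ..
  have id: "(\<lambda>x. x) \<in> borel_measurable ?M"
    by (rule continuous_interval_measurable) (rule continuous_on_id)
  have fs: "(\<lambda>p. fst p) \<in> borel_measurable (?M \<Otimes>\<^sub>M ?M)" "(\<lambda>p. snd p) \<in> borel_measurable (?M \<Otimes>\<^sub>M ?M)"
    using measurable_compose[OF measurable_fst id] measurable_compose[OF measurable_snd id] by auto
  have gh: "integrable (?M \<Otimes>\<^sub>M ?M) (\<lambda>(x, y). g x * h y)"
  proof (rule P.Fubini_integrable)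
    have "(\<lambda>p. g (fst p)) \<in> borel_measurable (?M \<Otimes>\<^sub>M ?M)" "(\<lambda>p. h (snd p)) \<in> borel_measurable (?M \<Otimes>\<^sub>M ?M)"
      using measurable_compose[OF measurable_fst borel_measurable_integrable[OF g]]
        measurable_compose[OF measurable_snd borel_measurable_integrable[OF h]] by auto
    then show "(\<lambda>(x, y). g x * h y) \<in> borel_measurable (?M \<Otimes>\<^sub>M ?M)"
      unfolding case_prod_beta by (rule borel_measurable_times)
    show "integrable ?M (\<lambda>x. LINT y|?M. norm (case (x, y) of (x, y) \<Rightarrow> g x * h y))"
      using g h by (simp add: norm_mult integrable_norm)
    show "AE x in ?M. integrable ?M (\<lambda>y. case (x, y) of (x, y) \<Rightarrow> g x * h y)"
      using h by simp
  qed
  have tri: "integrable (?M \<Otimes>\<^sub>M ?M) (\<lambda>p. indicator T p *\<^sub>R (case p of (x, y) \<Rightarrow> g x * h y))"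
    if "T \<in> sets (?M \<Otimes>\<^sub>M ?M)" for T
    by (rule integrable_mult_indicator[OF that gh])
  have T1: "{p \<in> space (?M \<Otimes>\<^sub>M ?M). snd p < fst p} \<in> sets (?M \<Otimes>\<^sub>M ?M)" (is "?T1 \<in> _")
    using fs by measurable
  have T2: "{p \<in> space (?M \<Otimes>\<^sub>M ?M). fst p < snd p} \<in> sets (?M \<Otimes>\<^sub>M ?M)" (is "?T2 \<in> _")
    using fs by measurable
  let ?f1 = "\<lambda>x y. indicator ?T1 (x, y) *\<^sub>R (g x * h y)"
  let ?f2 = "\<lambda>x y. indicator ?T2 (x, y) *\<^sub>R (g x * h y)"
  have i1: "integrable (?M \<Otimes>\<^sub>M ?M) (\<lambda>(x, y). ?f1 x y)"
    by (rule Bochner_Integration.integrable_cong[THEN iffD1, OF refl _ tri[OF T1]]) auto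
  have i2: "integrable (?M \<Otimes>\<^sub>M ?M) (\<lambda>(x, y). ?f2 x y)"
    by (rule Bochner_Integration.integrable_cong[THEN iffD1, OF refl _ tri[OF T2]]) auto
  have e1: "(LINT x|?M. g x * (LINT y|interval_measure x. h y)) = (LINT x|?M. (LINT y|?M. ?f1 x y))"
  proof (intro Bochner_Integration.integral_cong refl)
    fix x assume "x \<in> space ?M"
    then have x: "0 < x" "x < l" by auto
    have "g x * (LINT y|interval_measure x. h y) = (LINT y|?M. g x * (indicator {..<x} y *\<^sub>R h y))"
      using x by (simp add: LINT_subinterval[of x l] del: mult_scaleR_right)
    also have "\<dots> = (LINT y|?M. ?f1 x y)"
      using x by (intro Bochner_Integration.integral_cong refl) (auto simp: indicator_def space_pair_measure)
    finally show "g x * (LINT y|interval_measure x. h y) = (LINT y|?M. ?f1 x y)" .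
  qed
  have e2: "(LINT y|?M. h y * (LINT x|interval_measure y. g x)) = (LINT y|?M. (LINT x|?M. ?f2 x y))"
  proof (intro Bochner_Integration.integral_cong refl)
    fix y assume "y \<in> space ?M"
    then have y: "0 < y" "y < l" by auto
    have "h y * (LINT x|interval_measure y. g x) = (LINT x|?M. h y * (indicator {..<y} x *\<^sub>R g x))"
      using y by (simp add: LINT_subinterval[of y l] del: mult_scaleR_right)
    also have "\<dots> = (LINT x|?M. ?f2 x y)"
      using y by (intro Bochner_Integration.integral_cong refl) (auto simp: indicator_def space_pair_measure)
    finally show "h y * (LINT x|interval_measure y. g x) = (LINT x|?M. ?f2 x y)" .
  qed
  have "(LINT y|?M. (LINT x|?M. ?f2 x y)) = (LINT x|?M. (LINT y|?M. ?f2 x y))"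
    by (rule P.Fubini_integral[OF i2])
  moreover have "(LINT x|?M. (LINT y|?M. ?f1 x y)) + (LINT x|?M. (LINT y|?M. ?f2 x y))
     = (LINT x|?M. (LINT y|?M. ?f1 x y) + (LINT y|?M. ?f2 x y))"
    using P.integrable_fst[OF i1] P.integrable_fst[OF i2]
    by (intro Bochner_Integration.integral_add[symmetric]) auto
  moreover have "\<dots> = (LINT x|?M. g x * (LINT y|?M. h y))"
  proof (intro Bochner_Integration.integral_cong refl)
    fix x assume x: "x \<in> space ?M"
    have ind: "integrable ?M (\<lambda>y. indicator S y *\<^sub>R h y)" if "S \<in> sets ?M" for S
      using that h by (intro integrable_mult_indicator)
    have meas: "{..<x} \<inter> space ?M \<in> sets ?M" "{x<..} \<inter> space ?M \<in> sets ?M"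
      by (auto simp: sets_restrict_space)
    have f1: "(LINT y|?M. ?f1 x y) = (LINT y|?M. g x * (indicator ({..<x} \<inter> space ?M) y *\<^sub>R h y))"
      using x by (intro Bochner_Integration.integral_cong refl) (auto simp: indicator_def space_pair_measure)
    have f2: "(LINT y|?M. ?f2 x y) = (LINT y|?M. g x * (indicator ({x<..} \<inter> space ?M) y *\<^sub>R h y))"
      using x by (intro Bochner_Integration.integral_cong refl) (auto simp: indicator_def space_pair_measure)
    have "(LINT y|?M. ?f1 x y) + (LINT y|?M. ?f2 x y) =
       (LINT y|?M. g x * (indicator ({..<x} \<inter> space ?M) y *\<^sub>R h y) + g x * (indicator ({x<..} \<inter> space ?M) y *\<^sub>R h y))"
      unfolding f1 f2 using ind[OF meas(1)] ind[OF meas(2)]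
      by (intro Bochner_Integration.integral_add[symmetric] integrable_mult_right) auto
    also have "\<dots> = (LINT y|?M. g x * h y)"
    proof (rule integral_cong_AE)
      have "AE y in lebesgue. y \<notin> {x}"
        by (rule AE_not_in) (simp add: negligible_iff_null_sets[symmetric])
      then have "AE y in ?M. y \<noteq> x"
        by (subst AE_restrict_space_iff) (auto elim: eventually_mono)
      then show "AE y in ?M. g x * (indicator ({..<x} \<inter> space ?M) y *\<^sub>R h y) + g x * (indicator ({x<..} \<inter> space ?M) y *\<^sub>R h y) = g x * h y"
        using AE_space by eventually_elim (auto simp: indicator_def)
      show "(\<lambda>y. g x * (indicator ({..<x} \<inter> space ?M) y *\<^sub>R h y) + g x * (indicator ({x<..} \<inter> space ?M) y *\<^sub>R h y)) \<in> borel_measurable ?M"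
        using ind[OF meas(1)] ind[OF meas(2)]
        by (intro borel_measurable_integrable Bochner_Integration.integrable_add integrable_mult_right) auto
      show "(\<lambda>y. g x * h y) \<in> borel_measurable ?M"
        using h by (intro borel_measurable_integrable integrable_mult_right) auto
    qed
    also have "\<dots> = g x * (LINT y|?M. h y)" by simp
    finally show "(LINT y|?M. ?f1 x y) + (LINT y|?M. ?f2 x y) = g x * (LINT y|?M. h y)" .
  qed
  moreover have "\<dots> = (LINT x|?M. g x) * (LINT y|?M. h y)" by simp
  ultimately show ?thesis unfolding e1 e2 by simp
qed

lemma is_primitive_L2: "is_primitive l u g \<Longrightarrow> g \<in> L2 l"
  by (simp add: is_primitive_def)

lemma is_primitive_eval:
  "is_primitive l u g \<Longrightarrow> x \<in> {0..l} \<Longrightarrow> u x = u 0 + (LINT y|interval_measure x. g y)"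
  unfolding is_primitive_def by blast

lemma is_primitive_integral:
  assumes "is_primitive l u g" "x \<in> {0..l}"
  shows "u x = u 0 + integral {0..x} g"
  using assms is_primitive_eval[OF assms] LINT_eq_integral[OF L2_integrable[OF is_primitive_L2[OF assms(1)]], of x]
  by simp

lemma L2_HK_integrable:
  assumes "g \<in> L2 l" shows "g integrable_on {0..l}"
proof -
  have "g absolutely_integrable_on {0<..<l}"
    using L2_integrable[OF assms] by (simp add: set_integrable_def integrable_restrict_space)
  then have "g integrable_on {0<..<l}" by (rule set_lebesgue_integral_eq_integral(1))
  then show ?thesis by (simp add: integrable_on_open_interval_real)
qed

lemma is_primitive_continuous:
  assumes "is_primitive l u g" shows "continuous_on {0..l} u"
proof -
  have "continuous_on {0..l} (\<lambda>x. u 0 + integral {0..x} g)"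
    by (intro continuous_intros indefinite_integral_continuous_1 L2_HK_integrable is_primitive_L2[OF assms])
  then show ?thesis by (rule continuous_on_eq) (rule is_primitive_integral[OF assms, symmetric])
qed

lemma is_primitive_in_L2: "is_primitive l u g \<Longrightarrow> u \<in> L2 l"
  by (intro L2_continuous is_primitive_continuous)

lemma is_primitive_const: "is_primitive l (\<lambda>x. c) (\<lambda>x. 0)"
  by (simp add: is_primitive_def L2_const)

lemma is_primitive_add:
  assumes u: "is_primitive l u g" and v: "is_primitive l v h"
  shows "is_primitive l (\<lambda>x. u x + v x) (\<lambda>x. g x + h x)"
  unfolding is_primitive_def
proof (intro conjI ballI)
  show "(\<lambda>x. g x + h x) \<in> L2 l" using u v by (intro L2_add is_primitive_L2)
  fix x assume x: "x \<in> {0..l}"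
  have "integrable (interval_measure x) g" "integrable (interval_measure x) h"
    using x integrable_subinterval[OF L2_integrable[OF is_primitive_L2[OF u]]]
      integrable_subinterval[OF L2_integrable[OF is_primitive_L2[OF v]]] by auto
  then show "u x + v x = u 0 + v 0 + (LINT y|interval_measure x. g y + h y)"
    using is_primitive_eval[OF u x] is_primitive_eval[OF v x] by simp
qed

lemma is_primitive_cmult:
  assumes u: "is_primitive l u g"
  shows "is_primitive l (\<lambda>x. c * u x) (\<lambda>x. c * g x)"
  unfolding is_primitive_def
proof (intro conjI ballI)
  show "(\<lambda>x. c * g x) \<in> L2 l" using u by (intro L2_cmult is_primitive_L2)
  fix x assume x: "x \<in> {0..l}"
  then show "c * u x = c * u 0 + (LINT y|interval_measure x. c * g y)"
    using is_primitive_eval[OF u x] by (simp add: algebra_simps)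
qed

lemma is_primitive_diff:
  "is_primitive l u g \<Longrightarrow> is_primitive l v h \<Longrightarrow> is_primitive l (\<lambda>x. u x - v x) (\<lambda>x. g x - h x)"
  using is_primitive_add[OF _ is_primitive_cmult[of l v h "-1"]] by simp

lemma is_primitive_cnj:
  assumes u: "is_primitive l u g"
  shows "is_primitive l (\<lambda>x. cnj (u x)) (\<lambda>x. cnj (g x))"
  unfolding is_primitive_def
proof (intro conjI ballI)
  show "(\<lambda>x. cnj (g x)) \<in> L2 l" using u by (intro L2_cnj is_primitive_L2)
  fix x assume x: "x \<in> {0..l}"
  have "integrable (interval_measure x) g"
    using x integrable_subinterval[OF L2_integrable[OF is_primitive_L2[OF u]]] by auto
  then show "cnj (u x) = cnj (u 0) + (LINT y|interval_measure x. cnj (g y))"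
    using is_primitive_eval[OF u x] by simp
qed

lemma is_primitive_cong:
  assumes u: "is_primitive l u g" and uv: "\<And>x. x \<in> {0..l} \<Longrightarrow> u x = v x"
    and h: "h \<in> L2 l" "AE x in interval_measure l. g x = h x"
  shows "is_primitive l v h"
  unfolding is_primitive_def
proof (intro conjI ballI h)
  fix x assume x: "x \<in> {0..l}"
  have "AE y in interval_measure x. g y = h y"
  proof -
    have "AE y in lebesgue. y \<in> {0<..<l} \<longrightarrow> g y = h y"
      using h(2) by (subst (asm) AE_restrict_space_iff) auto
    then have "AE y in lebesgue. y \<in> {0<..<x} \<longrightarrow> g y = h y"
      by eventually_elim (use x in auto)
    then show ?thesis by (subst AE_restrict_space_iff) auto
  qed
  then have "(LINT y|interval_measure x. g y) = (LINT y|interval_measure x. h y)"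
    using x interval_subset_measurable[OF L2_measurable[OF is_primitive_L2[OF u]], of x]
      interval_subset_measurable[OF L2_measurable[OF h(1)], of x]
    by (intro integral_cong_AE) auto
  moreover have "u x = v x" "u 0 = v 0" using x by (auto intro!: uv)
  ultimately show "v x = v 0 + (LINT y|interval_measure x. h y)"
    using is_primitive_eval[OF u x] by metis
qed

lemma is_primitive_C1:
  assumes d: "\<And>x. x \<in> {0..l} \<Longrightarrow> (u has_vector_derivative g x) (at x within {0..l})"
    and g: "continuous_on {0..l} g"
  shows "is_primitive l u g"
  unfolding is_primitive_def
proof (intro conjI ballI)
  show gL: "g \<in> L2 l" by (rule L2_continuous[OF g])
  fix x assume x: "x \<in> {0..l}"
  have "(g has_integral (u x - u 0)) {0..x}"
    using x by (intro fundamental_theorem_of_calculus)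
      (auto intro!: has_vector_derivative_within_subset[OF d])
  then have "integral {0..x} g = u x - u 0" by (rule integral_unique)
  then show "u x = u 0 + (LINT y|interval_measure x. g y)"
    using LINT_eq_integral[OF L2_integrable[OF gL], of x] x by simp
qed

lemma is_primitive_has_derivative:
  assumes u: "is_primitive l u g" and g: "continuous_on {0..l} g" and x: "x \<in> {0..l}"
  shows "(u has_vector_derivative g x) (at x within {0..l})"
proof -
  have "((\<lambda>x. u 0 + integral {0..x} g) has_vector_derivative 0 + g x) (at x within {0..l})"
    by (intro has_vector_derivative_add has_vector_derivative_const integral_has_vector_derivative[OF g x])
  then have "((\<lambda>x. u 0 + integral {0..x} g) has_vector_derivative g x) (at x within {0..l})" by simp
  then show ?thesis
    by (rule has_vector_derivative_transform[OF x, rotated]) (rule is_primitive_integral[OF u])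
qed

theorem integration_by_parts_primitive:
  assumes u: "is_primitive l u g" and w: "is_primitive l w h" and l: "l > 0"
  shows "(LINT x|interval_measure l. u x * h x) + (LINT x|interval_measure l. g x * w x) = u l * w l - u 0 * w 0"
proof -
  let ?M = "interval_measure l"
  define G where "G x = (LINT y|interval_measure x. g y)" for x
  define H where "H x = (LINT y|interval_measure x. h y)" for x
  have uG: "u x = u 0 + G x" and wH: "w x = w 0 + H x" if "x \<in> {0..l}" for x
    using is_primitive_eval[OF u that] is_primitive_eval[OF w that] by (auto simp: G_def H_def)
  have gi: "integrable ?M g" and hi: "integrable ?M h"
    using u w by (auto intro: L2_integrable is_primitive_L2)
  have Gh: "integrable ?M (\<lambda>x. h x * G x)"
  proof (rule Bochner_Integration.integrable_cong[THEN iffD1, OF refl])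
    show "integrable ?M (\<lambda>x. h x * (u x - u 0))"
      using is_primitive_L2[OF w] is_primitive_in_L2[OF u] by (intro L2_mult_integrable L2_diff L2_const)
    fix x assume "x \<in> space ?M"
    then show "h x * (u x - u 0) = h x * G x" using uG[of x] by auto
  qed
  have Hg: "integrable ?M (\<lambda>x. g x * H x)"
  proof (rule Bochner_Integration.integrable_cong[THEN iffD1, OF refl])
    show "integrable ?M (\<lambda>x. g x * (w x - w 0))"
      using is_primitive_L2[OF u] is_primitive_in_L2[OF w] by (intro L2_mult_integrable L2_diff L2_const)
    fix x assume "x \<in> space ?M"
    then show "g x * (w x - w 0) = g x * H x" using wH[of x] by auto
  qed
  have "(LINT x|?M. u x * h x) = (LINT x|?M. u 0 * h x + h x * G x)"
  proof (intro Bochner_Integration.integral_cong refl)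
    fix x assume "x \<in> space ?M"
    then have "u x = u 0 + G x" by (intro uG) auto
    then show "u x * h x = u 0 * h x + h x * G x" by (metis distrib_right mult.commute)
  qed
  also have "\<dots> = u 0 * H l + (LINT x|?M. h x * G x)"
    using Gh hi by (simp add: H_def)
  finally have 1: "(LINT x|?M. u x * h x) = u 0 * H l + (LINT x|?M. h x * G x)" .
  have "(LINT x|?M. g x * w x) = (LINT x|?M. w 0 * g x + g x * H x)"
  proof (intro Bochner_Integration.integral_cong refl)
    fix x assume "x \<in> space ?M"
    then have "w x = w 0 + H x" by (intro wH) auto
    then show "g x * w x = w 0 * g x + g x * H x" by (metis distrib_left mult.commute)
  qed
  also have "\<dots> = w 0 * G l + (LINT x|?M. g x * H x)"
    using Hg gi by (simp add: G_def)
  finally have 2: "(LINT x|?M. g x * w x) = w 0 * G l + (LINT x|?M. g x * H x)" .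
  have 3: "(LINT x|?M. g x * H x) + (LINT x|?M. h x * G x) = G l * H l"
    using LINT_product_triangles[OF gi hi] by (simp add: G_def H_def)
  show ?thesis unfolding 1 2 using 3 uG[of l] wH[of l] l by (simp add: algebra_simps)
qed

lemma sqnorm_LINT:
  assumes "f \<in> L2 l" shows "(LINT x|interval_measure l. f x * cnj (f x)) = of_real (sqnorm l f)"
proof -
  have "(LINT x|interval_measure l. f x * cnj (f x)) = (LINT x|interval_measure l. of_real ((cmod (f x))\<^sup>2))"
    by (intro Bochner_Integration.integral_cong refl) (simp only: complex_norm_square)
  also have "\<dots> = of_real (sqnorm l f)" unfolding sqnorm_def by (rule integral_of_real[OF L2_sq_integrable[OF assms]])
  finally show ?thesis .
qed

lemma sqnorm_eq_0:
  assumes "f \<in> L2 l" "sqnorm l f = 0" shows "AE x in interval_measure l. f x = 0"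
proof -
  have "AE x in interval_measure l. (cmod (f x))\<^sup>2 = 0"
    using integral_nonneg_eq_0_iff_AE[OF L2_sq_integrable[OF assms(1)]] assms(2) by (simp add: sqnorm_def)
  then show ?thesis by eventually_elim simp
qed

lemma C1_is_primitive:
  assumes "\<forall>x. (f has_vector_derivative f' x) (at x)" "continuous_on UNIV f'"
  shows "is_primitive l f f'"
  using assms by (intro is_primitive_C1) (auto intro: has_vector_derivative_at_within continuous_on_subset)

text \<open>Bounded sequences of square-integrable functions need to be tested for weak convergence on a dense
set only.\<close>

theorem weak_null_by_density:
  assumes l: "l > 0" and X: "\<And>n. X n \<in> L2 l" "\<And>n. sqnorm l (X n) \<le> M"
    and null: "\<And>f f'. is_primitive l f f' \<Longrightarrow> f 0 = 0 \<Longrightarrow> f l = 0 \<Longrightarrow>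
      (\<lambda>n. LINT x|interval_measure l. X n x * f x) \<longlonglongrightarrow> 0"
    and h: "h \<in> L2 l"
  shows "(\<lambda>n. LINT x|interval_measure l. X n x * h x) \<longlonglongrightarrow> 0"
proof (rule LIMSEQ_I)
  fix e :: real assume e: "e > 0"
  have M: "M \<ge> 0" using X(2)[of 0] sqnorm_nonneg[of l "X 0"] by linarith
  define d where "d = (e / 2 / (sqrt M + 1))\<^sup>2"
  have d: "d > 0" "sqrt M * sqrt d < e / 2"
  proof -
    show "d > 0" using e M unfolding d_def by (intro zero_less_power) (auto intro!: divide_pos_pos add_nonneg_pos)
    have "sqrt d = e / 2 / (sqrt M + 1)" using e M unfolding d_def by simp
    then have "sqrt M * sqrt d = e / 2 * (sqrt M / (sqrt M + 1))" by simp
    also have "\<dots> < e / 2 * 1"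
      using e M by (intro mult_strict_left_mono) (auto simp: divide_less_eq_1 add_nonneg_pos)
    finally show "sqrt M * sqrt d < e / 2" by simp
  qed
  obtain f f' where f: "\<forall>x. (f has_vector_derivative f' x) (at x)" "continuous_on UNIV f'" "f 0 = 0" "f l = 0"
      "sqnorm l (\<lambda>x. h x - f x) < d"
    using C1_dense_L2[OF l h, unfolded C1_approximable_def, rule_format, OF d(1)] by blast
  have fp: "is_primitive l f f'" by (rule C1_is_primitive[OF f(1,2)])
  have fL: "f \<in> L2 l" by (rule is_primitive_in_L2[OF fp])
  obtain K where K: "\<And>n. n \<ge> K \<Longrightarrow> cmod (LINT x|interval_measure l. X n x * f x) < e / 2"
    using LIMSEQ_D[OF null[OF fp f(3,4)], of "e / 2"] e by auto
  show "\<exists>K. \<forall>n\<ge>K. norm ((LINT x|interval_measure l. X n x * h x) - 0) < e"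
  proof (intro exI[of _ K] allI impI)
    fix n assume n: "n \<ge> K"
    have "(LINT x|interval_measure l. X n x * h x)
       = (LINT x|interval_measure l. X n x * f x + X n x * (h x - f x))"
      by (simp add: algebra_simps)
    also have "\<dots> = (LINT x|interval_measure l. X n x * f x) + (LINT x|interval_measure l. X n x * (h x - f x))"
      by (intro Bochner_Integration.integral_add L2_mult_integrable L2_diff X fL h)
    finally have "cmod (LINT x|interval_measure l. X n x * h x)
       \<le> cmod (LINT x|interval_measure l. X n x * f x) + cmod (LINT x|interval_measure l. X n x * (h x - f x))"
      by (simp add: norm_triangle_ineq)
    also have "cmod (LINT x|interval_measure l. X n x * (h x - f x)) \<le> sqrt (sqnorm l (X n)) * sqrt (sqnorm l (\<lambda>x. h x - f x))"
      by (intro L2_Cauchy_Schwarz L2_diff X fL h)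
    also have "\<dots> \<le> sqrt M * sqrt d"
      using X(2)[of n] f(5) sqnorm_nonneg M by (intro mult_mono) auto
    finally show "norm ((LINT x|interval_measure l. X n x * h x) - 0) < e"
      using K[OF n] d(2) by simp
  qed
qed

text \<open>The difference of two derivatives of the same function is orthogonal to every \<open>C1\<close> function that
vanishes at both ends, hence to its own conjugate.\<close>

theorem is_primitive_unique:
  assumes g: "is_primitive l u g" and h: "is_primitive l u h" and l: "l > 0"
  shows "AE x in interval_measure l. g x = h x"
proof -
  define d where "d x = g x - h x" for x
  have dp: "is_primitive l (\<lambda>x. 0) d"
    using is_primitive_diff[OF g h] by (simp add: d_def[abs_def])
  have dL: "d \<in> L2 l" by (rule is_primitive_L2[OF dp])
  have "(\<lambda>n::nat. LINT x|interval_measure l. d x * cnj (d x)) \<longlonglongrightarrow> 0"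
  proof (rule weak_null_by_density[OF l dL order_refl _ L2_cnj[OF dL]])
    fix f f' assume f: "is_primitive l f f'" "f 0 = 0" "f l = 0"
    show "(\<lambda>n::nat. LINT x|interval_measure l. d x * f x) \<longlonglongrightarrow> 0"
      using integration_by_parts_primitive[OF dp f(1) l] f by simp
  qed
  then have "(LINT x|interval_measure l. d x * cnj (d x)) = 0"
    using LIMSEQ_unique tendsto_const by blast
  then have "sqnorm l d = 0" using sqnorm_LINT[OF dL] by simp
  from sqnorm_eq_0[OF dL this] show ?thesis by eventually_elim (simp add: d_def)
qed

section \<open>Weak derivatives are primitives\<close>

lemma test_function_primitive:
  assumes "test_function l \<phi> \<phi>'"
  shows "is_primitive l (\<lambda>x. of_real (\<phi> x)) (\<lambda>x. of_real (\<phi>' x))" "\<phi> 0 = 0" "\<phi> l = 0"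
proof -
  have d: "(\<phi> has_vector_derivative \<phi>' x) (at x)" for x
    using assms by (simp add: test_function_def has_real_derivative_iff_has_vector_derivative)
  have "((\<lambda>x. complex_of_real (\<phi> x)) has_vector_derivative of_real (\<phi>' x)) (at x)" for x
    by (rule bounded_linear.has_vector_derivative[OF bounded_linear_of_real d])
  moreover have "continuous_on UNIV (\<lambda>x. complex_of_real (\<phi>' x))"
    using assms by (auto simp: test_function_def intro!: continuous_intros)
  ultimately show "is_primitive l (\<lambda>x. of_real (\<phi> x)) (\<lambda>x. of_real (\<phi>' x))"
    by (intro C1_is_primitive) auto
  show "\<phi> 0 = 0" "\<phi> l = 0" using assms by (fastforce simp: test_function_def)+
qed

lemma is_primitive_has_weak_deriv:
  assumes l: "l > 0" and u: "is_primitive l u g"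
  shows "has_weak_deriv l u g"
  unfolding has_weak_deriv_def
proof (intro conjI allI impI)
  fix \<phi> \<phi>' assume t: "test_function l \<phi> \<phi>'"
  from integration_by_parts_primitive[OF u test_function_primitive(1)[OF t] l] test_function_primitive(2,3)[OF t]
  show "(LINT x|interval_measure l. u x * of_real (\<phi>' x)) = - (LINT x|interval_measure l. g x * of_real (\<phi> x))"
    by (simp add: eq_neg_iff_add_eq_0)
qed (use is_primitive_in_L2[OF u] is_primitive_L2[OF u] in auto)

lemma continuous_antiderivative_compact_support:
  fixes \<psi> :: "real \<Rightarrow> real"
  assumes \<psi>: "continuous_on UNIV \<psi>" and ab: "0 < a" "a < b" "b < l"
    and supp: "\<And>x. x \<notin> {a..b} \<Longrightarrow> \<psi> x = 0" and zero: "integral {0..l} \<psi> = 0"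
  obtains \<phi> where "test_function l \<phi> \<psi>"
proof -
  have "\<exists>F. \<forall>x::real. -\<infinity> < ereal x \<longrightarrow> ereal x < \<infinity> \<longrightarrow> (F has_vector_derivative \<psi> x) (at x)"
    using \<psi> by (intro einterval_antiderivative) (simp_all add: continuous_on_eq_continuous_at)
  then have "\<exists>F. \<forall>x. (F has_vector_derivative \<psi> x) (at x)" by simp
  then obtain F where "\<forall>x. (F has_vector_derivative \<psi> x) (at x)" by (rule exE)
  then have F: "(F has_vector_derivative \<psi> x) (at x)" for x by (rule spec)
  have FTC: "(\<psi> has_integral (F y - F x)) {x..y}" if "x \<le> y" for x y
    by (rule fundamental_theorem_of_calculus[OF that has_vector_derivative_at_within[OF F]])
  have left: "F x = F a" if "x \<le> a" for x
  proof -
    have "(\<psi> has_integral 0) {x..a}"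
      by (rule has_integral_spike_finite[of "{a}" _ _ "\<lambda>x. 0"]) (auto intro: supp)
    then have "F a - F x = 0" by (rule has_integral_unique[OF FTC[OF that]])
    then show ?thesis by simp
  qed
  have right: "F x = F l" if "x \<ge> b" for x
  proof -
    have *: "(\<psi> has_integral 0) {b..y}" for y
      by (rule has_integral_spike_finite[of "{b}" _ _ "\<lambda>x. 0"]) (auto intro: supp)
    have "F x - F b = 0" by (rule has_integral_unique[OF FTC[OF that] *])
    moreover have "F l - F b = 0" by (rule has_integral_unique[OF FTC *]) (use ab in simp)
    ultimately show ?thesis by simp
  qed
  have "F l - F 0 = 0" using FTC[of 0 l] zero ab by (simp add: integral_unique)
  then have Fl: "F l = F a" using left[of 0] ab by simp
  have "test_function l (\<lambda>x. F x - F a) \<psi>"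
    unfolding test_function_def
  proof (intro conjI allI \<psi>)
    show "((\<lambda>x. F x - F a) has_real_derivative \<psi> x) (at x)" for x
      using F[of x] unfolding has_real_derivative_iff_has_vector_derivative
      by (auto intro!: derivative_eq_intros)
    have "F x - F a = 0" if "x \<notin> {a..b}" for x
      using left[of x] right[of x] Fl that by auto
    then have "0 < a \<and> a \<le> b \<and> b < l \<and> (\<forall>x. x \<notin> {a..b} \<longrightarrow> F x - F a = 0)"
      using ab by simp
    then have "\<exists>b'. 0 < a \<and> a \<le> b' \<and> b' < l \<and> (\<forall>x. x \<notin> {a..b'} \<longrightarrow> F x - F a = 0)"
      by (rule exI)
    then show "\<exists>a' b'. 0 < a' \<and> a' \<le> b' \<and> b' < l \<and> (\<forall>x. x \<notin> {a'..b'} \<longrightarrow> F x - F a = 0)"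
      by (rule exI)
  qed
  then show ?thesis using that by blast
qed

text \<open>A continuous function whose weak derivative is zero is constant. With a weight \<open>\<eta> \<ge> 0\<close> of compact
support and the weighted mean \<open>m\<close> of \<open>c\<close>, the function \<open>\<eta> (c - m)\<close> has integral zero and is therefore
the derivative of a test function; testing with it gives \<open>\<integral> \<eta> (c - m)\<^sup>2 = 0\<close>.\<close>

lemma du_Bois_Reymond_real:
  fixes c :: "real \<Rightarrow> real"
  assumes l: "l > 0" and c: "continuous_on {0..l} c"
    and test: "\<And>\<phi> \<phi>'. test_function l \<phi> \<phi>' \<Longrightarrow> (LINT x|interval_measure l. c x * \<phi>' x) = 0"
    and xy: "x \<in> {0..l}"
  shows "c x = c 0"
proof -
  have inner: "c x = c y" if xy: "x \<in> {0<..<l}" "y \<in> {0<..<l}" for x y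
  proof -
    \<comment> \<open>An interval \<open>{a..b}\<close> inside \<open>{0<..<l}\<close> that contains \<open>x\<close> and \<open>y\<close> in its interior.\<close>
    define a where "a = min x y / 2"
    define b where "b = (max x y + l) / 2"
    have ab: "0 < a" "a < b" "b < l" "a < x" "x < b" "a < y" "y < b"
      using xy by (auto simp: a_def b_def min_def max_def)
    define \<eta> where "\<eta> x = max 0 ((x - a) * (b - x))" for x
    \<comment> \<open>The continuous extension of \<open>c\<close> to the real line.\<close>
    define d where "d x = c (max 0 (min l x))" for x
    have \<eta>c: "continuous_on S \<eta>" for S unfolding \<eta>_def by (intro continuous_intros)
    have dc: "continuous_on S d" for S unfolding d_def
      by (rule continuous_on_compose2[OF c]) (use l in \<open>auto intro!: continuous_intros\<close>)
    have cd: "c x = d x" if "x \<in> {0..l}" for x using that by (simp add: d_def)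
    have \<eta>0: "\<eta> x \<ge> 0" for x by (simp add: \<eta>_def)
    have \<eta>pos: "\<eta> x > 0" if "a < x" "x < b" for x using that by (simp add: \<eta>_def)
    have \<eta>supp: "\<eta> x = 0" if "x \<notin> {a..b}" for x
      using that ab(2) unfolding \<eta>_def by (auto simp: max_def mult_le_0_iff zero_le_mult_iff not_le)
    have I: "\<eta> integrable_on {0..l}" "(\<lambda>x. \<eta> x * d x) integrable_on {0..l}"
      by (auto intro!: integrable_continuous_real continuous_intros \<eta>c dc)
    have Ipos: "integral {0..l} \<eta> > 0"
    proof -
      have "integral {0..l} \<eta> \<noteq> 0"
        using integral_eq_0_iff[OF \<eta>c l \<eta>0] \<eta>pos[of x] ab by auto
      moreover have "integral {0..l} \<eta> \<ge> 0" by (intro integral_nonneg I \<eta>0)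
      ultimately show ?thesis by linarith
    qed
    define m where "m = integral {0..l} (\<lambda>x. \<eta> x * d x) / integral {0..l} \<eta>"
    define \<psi> where "\<psi> x = \<eta> x * (d x - m)" for x
    have \<psi>c: "continuous_on S \<psi>" for S unfolding \<psi>_def by (intro continuous_intros \<eta>c dc)
    have "integral {0..l} \<psi> = integral {0..l} (\<lambda>x. \<eta> x * d x - m * \<eta> x)"
      unfolding \<psi>_def by (rule arg_cong[where f = "integral _"]) (auto simp: algebra_simps)
    also have "\<dots> = integral {0..l} (\<lambda>x. \<eta> x * d x) - m * integral {0..l} \<eta>"
      using I by (subst Henstock_Kurzweil_Integration.integral_diff) (auto intro: integrable_on_mult_right)
    also have "\<dots> = 0" using Ipos by (simp add: m_def)
    finally have I\<psi>: "integral {0..l} \<psi> = 0" .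
    obtain \<phi> where \<phi>: "test_function l \<phi> \<psi>"
      using continuous_antiderivative_compact_support[OF \<psi>c ab(1,2,3) _ I\<psi>] \<eta>supp
      by (metis \<psi>_def mult_zero_left)
    have "0 = (LINT x|interval_measure l. c x * \<psi> x)" using test[OF \<phi>] by simp
    also have "\<dots> = integral {0..l} (\<lambda>x. c x * \<psi> x)"
      by (intro LINT_eq_integral_continuous continuous_intros c \<psi>c)
    also have "\<dots> = integral {0..l} (\<lambda>x. \<eta> x * (d x - m)\<^sup>2 + m * \<psi> x)"
      by (intro integral_cong) (simp add: cd \<psi>_def algebra_simps power2_eq_square)
    also have "\<dots> = integral {0..l} (\<lambda>x. \<eta> x * (d x - m)\<^sup>2) + m * integral {0..l} \<psi>"
    proof -
      have "(\<lambda>x. \<eta> x * (d x - m)\<^sup>2) integrable_on {0..l}" "\<psi> integrable_on {0..l}"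
        by (auto intro!: integrable_continuous_real continuous_intros \<eta>c dc \<psi>c)
      then show ?thesis
        by (subst Henstock_Kurzweil_Integration.integral_add) (auto intro: integrable_on_mult_right)
    qed
    finally have "integral {0..l} (\<lambda>x. \<eta> x * (d x - m)\<^sup>2) = 0" using I\<psi> by simp
    moreover have "continuous_on {0..l} (\<lambda>x. \<eta> x * (d x - m)\<^sup>2)"
      by (intro continuous_intros \<eta>c dc)
    ultimately have z: "\<eta> x * (d x - m)\<^sup>2 = 0" if "x \<in> {0..l}" for x
      using integral_eq_0_iff[of 0 l "\<lambda>x. \<eta> x * (d x - m)\<^sup>2"] l \<eta>0 that by simp
    have "d x = m" "d y = m"
      using z[of x] z[of y] \<eta>pos[of x] \<eta>pos[of y] ab xy by auto
    then show ?thesis using cd[of x] cd[of y] xy by auto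
  qed
  have cl: "closure {0<..<l} = {0..l}" using l by (intro closure_greaterThanLessThan)
  have "c z = c (l/2)" if "z \<in> {0..l}" for z
    by (rule continuous_constant_on_closure[of "{0<..<l}" c "c (l/2)"])
       (use cl c l that in \<open>auto intro: inner\<close>)
  from this[of x] this[of 0] show ?thesis using xy l by auto
qed

lemma du_Bois_Reymond:
  fixes c :: "real \<Rightarrow> complex"
  assumes l: "l > 0" and c: "continuous_on {0..l} c"
    and test: "\<And>\<phi> \<phi>'. test_function l \<phi> \<phi>' \<Longrightarrow> (LINT x|interval_measure l. c x * of_real (\<phi>' x)) = 0"
    and x: "x \<in> {0..l}"
  shows "c x = c 0"
proof (rule complex_eqI)
  have int: "integrable (interval_measure l) (\<lambda>x. c x * of_real (\<phi>' x))" if "test_function l \<phi> \<phi>'" for \<phi> \<phi>'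
    by (intro L2_mult_integrable L2_continuous c is_primitive_L2[OF test_function_primitive(1)[OF that]])
  show "Re (c x) = Re (c 0)"
  proof (rule du_Bois_Reymond_real[OF l _ _ x])
    fix \<phi> \<phi>' assume t: "test_function l \<phi> \<phi>'"
    show "(LINT x|interval_measure l. Re (c x) * \<phi>' x) = 0"
      using integral_Re[OF int[OF t]] test[OF t] by simp
  qed (intro continuous_intros c)
  show "Im (c x) = Im (c 0)"
  proof (rule du_Bois_Reymond_real[OF l _ _ x])
    fix \<phi> \<phi>' assume t: "test_function l \<phi> \<phi>'"
    show "(LINT x|interval_measure l. Im (c x) * \<phi>' x) = 0"
      using integral_Im[OF int[OF t]] test[OF t] by simp
  qed (intro continuous_intros c)
qed

theorem has_weak_deriv_iff_primitive:
  assumes l: "l > 0" and u: "continuous_on {0..l} u"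
  shows "has_weak_deriv l u g \<longleftrightarrow> is_primitive l u g"
proof
  assume w: "has_weak_deriv l u g"
  then have gL: "g \<in> L2 l" by (simp add: has_weak_deriv_def)
  define G where "G x = (LINT y|interval_measure x. g y)" for x
  have G0: "G 0 = 0"
  proof -
    have "G 0 = integral {0..0} g" unfolding G_def
      using LINT_eq_integral[OF L2_integrable[OF gL], of 0] l by simp
    then show ?thesis by simp
  qed
  have G: "is_primitive l G g"
    unfolding is_primitive_def using gL G0 by (simp add: G_def)
  note wG = is_primitive_has_weak_deriv[OF l G]
  have "u x - G x = u 0 - G 0" if "x \<in> {0..l}" for x
  proof (rule du_Bois_Reymond[OF l _ _ that])
    show "continuous_on {0..l} (\<lambda>x. u x - G x)"
      by (intro continuous_intros u is_primitive_continuous[OF G])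
    fix \<phi> \<phi>' assume t: "test_function l \<phi> \<phi>'"
    have tL: "(\<lambda>x. complex_of_real (\<phi>' x)) \<in> L2 l"
      by (rule is_primitive_L2[OF test_function_primitive(1)[OF t]])
    have "(LINT x|interval_measure l. (u x - G x) * of_real (\<phi>' x)) =
      (LINT x|interval_measure l. u x * of_real (\<phi>' x)) - (LINT x|interval_measure l. G x * of_real (\<phi>' x))"
      unfolding left_diff_distrib
      by (intro Bochner_Integration.integral_diff L2_mult_integrable tL L2_continuous u is_primitive_continuous[OF G])
    also have "\<dots> = 0" using w wG t unfolding has_weak_deriv_def by simp
    finally show "(LINT x|interval_measure l. (u x - G x) * of_real (\<phi>' x)) = 0" .
  qed
  then have "u x = u 0 + G x" if "x \<in> {0..l}" for x using that G0 by (metis add.commute diff_add_cancel diff_zero)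
  then show "is_primitive l u g" unfolding is_primitive_def G_def using gL by blast
qed (rule is_primitive_has_weak_deriv[OF l])

lemma H1_continuous: "u \<in> H1 l \<Longrightarrow> continuous_on {0..l} u"
  by (simp add: H1_def)

lemma H1_outside: "u \<in> H1 l \<Longrightarrow> x \<notin> {0..l} \<Longrightarrow> u x = 0"
  by (simp add: H1_def)

lemma H1I:
  assumes "l > 0" "is_primitive l u g" "\<And>x. x \<notin> {0..l} \<Longrightarrow> u x = 0"
  shows "u \<in> H1 l"
  using assms is_primitive_continuous is_primitive_has_weak_deriv unfolding H1_def by blast

lemma weak_deriv_is_primitive:
  assumes l: "l > 0" and u: "u \<in> H1 l"
  shows "is_primitive l u (weak_deriv l u)"
proof -
  have "\<exists>g. has_weak_deriv l u g" using u by (simp add: H1_def)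
  then have "has_weak_deriv l u (weak_deriv l u)" unfolding weak_deriv_def by (rule someI_ex)
  then show ?thesis using has_weak_deriv_iff_primitive[OF l H1_continuous[OF u]] by simp
qed

lemma weak_deriv_AE:
  assumes l: "l > 0" and u: "u \<in> H1 l" "is_primitive l u g"
  shows "AE x in interval_measure l. weak_deriv l u x = g x"
  by (rule is_primitive_unique[OF weak_deriv_is_primitive[OF l u(1)] u(2) l])

lemma has_weak_deriv_cong_AE:
  assumes "has_weak_deriv l u g" "v \<in> L2 l" "AE x in interval_measure l. u x = v x"
  shows "has_weak_deriv l v g"
  unfolding has_weak_deriv_def
proof (intro conjI allI impI assms)
  fix \<phi> \<phi>' assume t: "test_function l \<phi> \<phi>'"
  have m: "u \<in> borel_measurable (interval_measure l)" "v \<in> borel_measurable (interval_measure l)"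
      "(\<lambda>x. complex_of_real (\<phi>' x)) \<in> borel_measurable (interval_measure l)"
    using assms is_primitive_L2[OF test_function_primitive(1)[OF t]] by (auto simp: has_weak_deriv_def L2_measurable)
  have "(LINT x|interval_measure l. v x * of_real (\<phi>' x)) = (LINT x|interval_measure l. u x * of_real (\<phi>' x))"
    using assms(3) m by (intro integral_cong_AE borel_measurable_times) (auto elim: eventually_mono)
  then show "(LINT x|interval_measure l. v x * of_real (\<phi>' x)) = - (LINT x|interval_measure l. g x * of_real (\<phi> x))"
    using assms(1) t by (simp add: has_weak_deriv_def)
qed (use assms(1) in \<open>simp add: has_weak_deriv_def\<close>)

text \<open>The iterated operator \<open>weak_deriv\<close> starts from a representative of the first derivative that is
determined almost everywhere only; the second derivative does not depend on this choice.\<close>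

lemma second_weak_deriv_AE:
  assumes l: "l > 0" and w: "w \<in> H1 l" and g: "is_primitive l w g" and k: "is_primitive l g k"
  shows "AE x in interval_measure l. weak_deriv l (weak_deriv l w) x = k x"
proof -
  have gc: "continuous_on {0..l} g" by (rule is_primitive_continuous[OF k])
  have ae: "AE x in interval_measure l. weak_deriv l w x = g x" by (rule weak_deriv_AE[OF l w g])
  have wL: "weak_deriv l w \<in> L2 l" by (rule is_primitive_L2[OF weak_deriv_is_primitive[OF l w]])
  have "has_weak_deriv l (weak_deriv l w) k"
    by (rule has_weak_deriv_cong_AE[OF is_primitive_has_weak_deriv[OF l k] wL])
       (use ae in \<open>auto elim: eventually_mono\<close>)
  then have "has_weak_deriv l (weak_deriv l w) (weak_deriv l (weak_deriv l w))"
    unfolding weak_deriv_def[of l "weak_deriv l w"] by (rule someI[where P = "has_weak_deriv l (weak_deriv l w)"])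
  then have "has_weak_deriv l g (weak_deriv l (weak_deriv l w))"
    by (rule has_weak_deriv_cong_AE) (use ae is_primitive_in_L2[OF k] in auto)
  then have "is_primitive l g (weak_deriv l (weak_deriv l w))"
    using has_weak_deriv_iff_primitive[OF l gc] by simp
  from is_primitive_unique[OF this k l] show ?thesis .
qed

section \<open>The energy space of the network\<close>

lemma H1e_H1:
  assumes "u \<in> H1e N l" "j \<in> {1..N}"
  shows "u j \<in> H1 (l j)" "u j (l j) = 0" "u j 0 = u 1 0"
proof -
  show "u j \<in> H1 (l j)" "u j (l j) = 0" using assms by (auto simp: H1e_def)
  have "1 \<in> {1..N}" using assms(2) by auto
  then show "u j 0 = u 1 0" using assms unfolding H1e_def by blast
qed

lemma H1e_outside: "u \<in> H1e N l \<Longrightarrow> j \<notin> {1..N} \<Longrightarrow> u j = (\<lambda>x. 0)"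
  by (auto simp: H1e_def)

lemma H1eI:
  assumes "\<And>j. j \<in> {1..N} \<Longrightarrow> u j \<in> H1 (l j)" "\<And>j. j \<in> {1..N} \<Longrightarrow> u j (l j) = 0"
    "\<And>j. j \<in> {1..N} \<Longrightarrow> u j 0 = c" "\<And>j. j \<notin> {1..N} \<Longrightarrow> u j = (\<lambda>x. 0)"
  shows "u \<in> H1e N l"
  using assms unfolding H1e_def by simp

lemma dx_is_primitive:
  assumes "\<forall>j\<in>{1..N}. l j > 0" "u \<in> H1e N l" "j \<in> {1..N}"
  shows "is_primitive (l j) (u j) (dx l u j)"
  using assms unfolding dx_def by (intro weak_deriv_is_primitive H1e_H1(1)) auto

text \<open>The inner product may be evaluated with any representatives of the derivatives.\<close>

lemma H1_inner_eq:
  assumes l: "\<forall>j\<in>{1..N}. l j > 0" and uv: "u \<in> H1e N l" "v \<in> H1e N l"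
    and g: "\<And>j. j \<in> {1..N} \<Longrightarrow> is_primitive (l j) (u j) (g j)"
    and h: "\<And>j. j \<in> {1..N} \<Longrightarrow> is_primitive (l j) (v j) (h j)"
  shows "H1_inner N l u v = (\<Sum>j=1..N. (LINT x|interval_measure (l j). u j x * cnj (v j x)) +
     (LINT x|interval_measure (l j). g j x * cnj (h j x)))"
  unfolding H1_inner_def
proof (intro sum.cong refl)
  fix j assume j: "j \<in> {1..N}"
  let ?M = "interval_measure (l j)"
  have edge_pos: "l j > 0" using l j by auto
  note u' = weak_deriv_is_primitive[OF edge_pos H1e_H1(1)[OF uv(1) j]]
  note v' = weak_deriv_is_primitive[OF edge_pos H1e_H1(1)[OF uv(2) j]]
  have "(LINT x|?M. u j x * cnj (v j x) + weak_deriv (l j) (u j) x * cnj (weak_deriv (l j) (v j) x))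
    = (LINT x|?M. u j x * cnj (v j x)) + (LINT x|?M. weak_deriv (l j) (u j) x * cnj (weak_deriv (l j) (v j) x))"
    using u' v' by (intro Bochner_Integration.integral_add L2_mult_integrable L2_cnj)
      (auto intro: is_primitive_L2 is_primitive_in_L2)
  also have "(LINT x|?M. weak_deriv (l j) (u j) x * cnj (weak_deriv (l j) (v j) x)) = (LINT x|?M. g j x * cnj (h j x))"
  proof (rule integral_cong_AE)
    show "AE x in ?M. weak_deriv (l j) (u j) x * cnj (weak_deriv (l j) (v j) x) = g j x * cnj (h j x)"
      using weak_deriv_AE[OF edge_pos H1e_H1(1)[OF uv(1) j] g[OF j]] weak_deriv_AE[OF edge_pos H1e_H1(1)[OF uv(2) j] h[OF j]]
      by eventually_elim simp
    show "(\<lambda>x. weak_deriv (l j) (u j) x * cnj (weak_deriv (l j) (v j) x)) \<in> borel_measurable ?M"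
      using u' v' by (intro borel_measurable_times L2_measurable L2_cnj) (auto intro: is_primitive_L2)
    show "(\<lambda>x. g j x * cnj (h j x)) \<in> borel_measurable ?M"
      using g[OF j] h[OF j] by (intro borel_measurable_times L2_measurable L2_cnj) (auto intro: is_primitive_L2)
  qed
  finally show "(LINT x|?M. u j x * cnj (v j x) + weak_deriv (l j) (u j) x * cnj (weak_deriv (l j) (v j) x))
    = (LINT x|?M. u j x * cnj (v j x)) + (LINT x|?M. g j x * cnj (h j x))" .
qed

lemma H1_inner_dx:
  assumes l: "\<forall>j\<in>{1..N}. l j > 0" and uv: "u \<in> H1e N l" "v \<in> H1e N l"
  shows "H1_inner N l u v = (\<Sum>j=1..N. (LINT x|interval_measure (l j). u j x * cnj (v j x)) +
     (LINT x|interval_measure (l j). dx l u j x * cnj (dx l v j x)))"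
  by (rule H1_inner_eq[OF l uv]) (auto intro: dx_is_primitive[OF l] uv)

definition H1_ip :: "nat \<Rightarrow> (nat \<Rightarrow> real) \<Rightarrow> network_fun \<Rightarrow> network_fun \<Rightarrow> real"
  where "H1_ip N l u v = Re (H1_inner N l u v)"

lemma H1e_add:
  assumes l: "\<forall>j\<in>{1..N}. l j > 0" and u: "u \<in> H1e N l" and v: "v \<in> H1e N l"
  shows "u + v \<in> H1e N l"
proof (rule H1eI)
  fix j assume j: "j \<in> {1..N}"
  then have edge_pos: "l j > 0" using l by auto
  show "(u + v) j \<in> H1 (l j)"
  proof (rule H1I[OF edge_pos])
    show "is_primitive (l j) ((u + v) j) (\<lambda>x. dx l u j x + dx l v j x)"
      using is_primitive_add[OF dx_is_primitive[OF l u j] dx_is_primitive[OF l v j]]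
      by (simp add: plus_fun_def)
  qed (use H1_outside[OF H1e_H1(1)[OF u j]] H1_outside[OF H1e_H1(1)[OF v j]] in auto)
  show "(u + v) j (l j) = 0" "(u + v) j 0 = u 1 0 + v 1 0"
    using H1e_H1[OF u j] H1e_H1[OF v j] by auto
qed (use H1e_outside[OF u] H1e_outside[OF v] in \<open>auto simp: fun_eq_iff\<close>)

text \<open>The abstract theory uses real scalars; the complex structure enters through this operation.\<close>

definition cscale :: "complex \<Rightarrow> network_fun \<Rightarrow> network_fun"
  where "cscale c u = (\<lambda>j x. c * u j x)"

lemma H1e_cscale:
  assumes l: "\<forall>j\<in>{1..N}. l j > 0" and u: "u \<in> H1e N l"
  shows "cscale c u \<in> H1e N l"
proof (rule H1eI)
  fix j assume j: "j \<in> {1..N}"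
  then have edge_pos: "l j > 0" using l by auto
  show "cscale c u j \<in> H1 (l j)"
  proof (rule H1I[OF edge_pos])
    show "is_primitive (l j) (cscale c u j) (\<lambda>x. c * dx l u j x)"
      using is_primitive_cmult[OF dx_is_primitive[OF l u j]] by (simp add: cscale_def)
  qed (use H1_outside[OF H1e_H1(1)[OF u j]] in \<open>auto simp: cscale_def\<close>)
  show "cscale c u j (l j) = 0" "cscale c u j 0 = c * u 1 0"
    using H1e_H1[OF u j] by (auto simp: cscale_def)
qed (use H1e_outside[OF u] in \<open>auto simp: fun_eq_iff cscale_def\<close>)

lemma scaleR_eq_cscale: "r *\<^sub>R u = cscale (of_real r) u"
  by (simp add: fun_eq_iff cscale_def scaleR_conv_of_real)

lemma H1_inner_add:
  assumes l: "\<forall>j\<in>{1..N}. l j > 0" and u: "u \<in> H1e N l" and v: "v \<in> H1e N l" and w: "w \<in> H1e N l"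
  shows "H1_inner N l (u + v) w = H1_inner N l u w + H1_inner N l v w"
proof -
  note p = dx_is_primitive[OF l]
  have "H1_inner N l (u + v) w = (\<Sum>j=1..N. (LINT x|interval_measure (l j). (u + v) j x * cnj (w j x)) +
     (LINT x|interval_measure (l j). (dx l u j x + dx l v j x) * cnj (dx l w j x)))"
  proof (rule H1_inner_eq[OF l H1e_add[OF l u v] w])
    fix j assume j: "j \<in> {1..N}"
    show "is_primitive (l j) ((u + v) j) (\<lambda>x. dx l u j x + dx l v j x)"
      using is_primitive_add[OF p[OF u j] p[OF v j]] by (simp add: plus_fun_def)
    show "is_primitive (l j) (w j) (dx l w j)" by (rule p[OF w j])
  qed
  also have "\<dots> = (\<Sum>j=1..N. ((LINT x|interval_measure (l j). u j x * cnj (w j x)) +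
     (LINT x|interval_measure (l j). dx l u j x * cnj (dx l w j x))) +
     ((LINT x|interval_measure (l j). v j x * cnj (w j x)) +
     (LINT x|interval_measure (l j). dx l v j x * cnj (dx l w j x))))"
  proof (intro sum.cong refl)
    fix j assume j: "j \<in> {1..N}"
    have L: "u j \<in> L2 (l j)" "v j \<in> L2 (l j)" "(\<lambda>x. cnj (w j x)) \<in> L2 (l j)"
      "dx l u j \<in> L2 (l j)" "dx l v j \<in> L2 (l j)" "(\<lambda>x. cnj (dx l w j x)) \<in> L2 (l j)"
      using p[OF u j] p[OF v j] p[OF w j] by (auto intro: is_primitive_L2 is_primitive_in_L2 L2_cnj)
    show "(LINT x|interval_measure (l j). (u + v) j x * cnj (w j x)) +
     (LINT x|interval_measure (l j). (dx l u j x + dx l v j x) * cnj (dx l w j x)) =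
      ((LINT x|interval_measure (l j). u j x * cnj (w j x)) +
     (LINT x|interval_measure (l j). dx l u j x * cnj (dx l w j x))) +
     ((LINT x|interval_measure (l j). v j x * cnj (w j x)) +
     (LINT x|interval_measure (l j). dx l v j x * cnj (dx l w j x)))"
      using L by (simp add: distrib_right L2_mult_integrable)
  qed
  also have "\<dots> = H1_inner N l u w + H1_inner N l v w"
    unfolding H1_inner_dx[OF l u w] H1_inner_dx[OF l v w]
    by (rule sum.distrib)
  finally show ?thesis .
qed

lemma H1_inner_cscale:
  assumes l: "\<forall>j\<in>{1..N}. l j > 0" and u: "u \<in> H1e N l" and w: "w \<in> H1e N l"
  shows "H1_inner N l (cscale c u) w = c * H1_inner N l u w"
proof -
  note p = dx_is_primitive[OF l]
  have "H1_inner N l (cscale c u) w = (\<Sum>j=1..N. (LINT x|interval_measure (l j). cscale c u j x * cnj (w j x)) +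
     (LINT x|interval_measure (l j). (c * dx l u j x) * cnj (dx l w j x)))"
  proof (rule H1_inner_eq[OF l H1e_cscale[OF l u] w])
    fix j assume j: "j \<in> {1..N}"
    show "is_primitive (l j) (cscale c u j) (\<lambda>x. c * dx l u j x)"
      using is_primitive_cmult[OF p[OF u j]] by (simp add: cscale_def)
    show "is_primitive (l j) (w j) (dx l w j)" by (rule p[OF w j])
  qed
  also have "\<dots> = c * H1_inner N l u w"
    unfolding H1_inner_dx[OF l u w]
    by (simp add: sum_distrib_left distrib_left cscale_def mult.assoc)
  finally show ?thesis .
qed

lemma H1_inner_cnj:
  assumes l: "\<forall>j\<in>{1..N}. l j > 0" and u: "u \<in> H1e N l" and v: "v \<in> H1e N l"
  shows "H1_inner N l v u = cnj (H1_inner N l u v)"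
proof -
  note p = dx_is_primitive[OF l]
  have "cnj (LINT x|M. a x * cnj (b x)) = (LINT x|M. b x * cnj (a x))" for M and a b :: "real \<Rightarrow> complex"
    using Bochner_Integration.integral_cnj[of M "\<lambda>x. a x * cnj (b x)"] by (simp add: mult.commute)
  then show ?thesis
    unfolding H1_inner_dx[OF l u v] H1_inner_dx[OF l v u]
    by simp
qed

lemma H1_inner_self:
  assumes l: "\<forall>j\<in>{1..N}. l j > 0" and u: "u \<in> H1e N l"
    and g: "\<And>j. j \<in> {1..N} \<Longrightarrow> is_primitive (l j) (u j) (g j)"
  shows "H1_inner N l u u = of_real (\<Sum>j=1..N. sqnorm (l j) (u j) + sqnorm (l j) (g j))"
proof -
  have "H1_inner N l u u = (\<Sum>j=1..N. (LINT x|interval_measure (l j). u j x * cnj (u j x)) +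
     (LINT x|interval_measure (l j). g j x * cnj (g j x)))"
    by (rule H1_inner_eq[OF l u u g g])
  also have "\<dots> = (\<Sum>j=1..N. of_real (sqnorm (l j) (u j) + sqnorm (l j) (g j)))"
  proof (intro sum.cong refl)
    fix j assume j: "j \<in> {1..N}"
    show "(LINT x|interval_measure (l j). u j x * cnj (u j x)) + (LINT x|interval_measure (l j). g j x * cnj (g j x))
       = of_real (sqnorm (l j) (u j) + sqnorm (l j) (g j))"
      using sqnorm_LINT[OF is_primitive_in_L2[OF g[OF j]]] sqnorm_LINT[OF is_primitive_L2[OF g[OF j]]] by simp
  qed
  finally show ?thesis by simp
qed

lemma sqnorm_continuous_eq_0:
  assumes l: "l > 0" and f: "continuous_on {0..l} f" "sqnorm l f = 0" and x: "x \<in> {0..l}"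
  shows "f x = 0"
proof -
  have c: "continuous_on {0..l} (\<lambda>x. (cmod (f x))\<^sup>2)" by (intro continuous_intros f)
  have "integral {0..l} (\<lambda>x. (cmod (f x))\<^sup>2) = 0"
    using f(2) LINT_eq_integral_continuous(2)[OF c] by (simp add: sqnorm_def)
  then have "(cmod (f x))\<^sup>2 = 0" using integral_eq_0_iff[OF c l] x by auto
  then show ?thesis by simp
qed

lemma inner_on_H1e:
  assumes l: "\<forall>j\<in>{1..N}. l j > 0"
  shows "inner_on (H1e N l) (H1_ip N l)"
proof
  show "subspace (H1e N l)"
    unfolding subspace_def
  proof (intro conjI ballI allI)
    show "0 \<in> H1e N l"
    proof (rule H1eI)
      fix j assume j: "j \<in> {1..N}"
      show "(0::network_fun) j \<in> H1 (l j)"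
        using l j is_primitive_const[of "l j" 0] by (intro H1I[of _ _ "\<lambda>x. 0"]) (auto simp: zero_fun_def)
    qed (auto simp: fun_eq_iff)
    show "x + y \<in> H1e N l" if "x \<in> H1e N l" "y \<in> H1e N l" for x y by (rule H1e_add[OF l that])
    show "c *\<^sub>R x \<in> H1e N l" if "x \<in> H1e N l" for c x
      unfolding scaleR_eq_cscale by (rule H1e_cscale[OF l that])
  qed
  show "H1_ip N l (x + y) z = H1_ip N l x z + H1_ip N l y z"
    if "x \<in> H1e N l" "y \<in> H1e N l" "z \<in> H1e N l" for x y z
    using H1_inner_add[OF l that] by (simp add: H1_ip_def)
  show "H1_ip N l (c *\<^sub>R x) y = c * H1_ip N l x y" if "x \<in> H1e N l" "y \<in> H1e N l" for c x y
    using H1_inner_cscale[OF l that, of "of_real c"] by (simp add: H1_ip_def scaleR_eq_cscale)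
  show "H1_ip N l x y = H1_ip N l y x" if "x \<in> H1e N l" "y \<in> H1e N l" for x y
    using H1_inner_cnj[OF l that] by (simp add: H1_ip_def)
  fix u assume u: "u \<in> H1e N l" "u \<noteq> 0"
  note p = dx_is_primitive[OF l u(1)]
  let ?s = "\<lambda>j. sqnorm (l j) (u j) + sqnorm (l j) (dx l u j)"
  have e: "H1_ip N l u u = (\<Sum>j=1..N. ?s j)"
    using H1_inner_self[OF l u(1) p] by (simp add: H1_ip_def del: of_real_sum)
  have nn: "?s j \<ge> 0" for j by (intro add_nonneg_nonneg sqnorm_nonneg)
  have "H1_ip N l u u \<noteq> 0"
  proof
    assume "H1_ip N l u u = 0"
    then have z: "?s j = 0" if "j \<in> {1..N}" for j
      using e sum_nonneg_eq_0_iff[of "{1..N}" ?s] nn that by simp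
    have "u j x = 0" for j x
    proof (cases "j \<in> {1..N}")
      case True
      then have s0: "sqnorm (l j) (u j) = 0" using z[OF True] sqnorm_nonneg[of "l j"] by (smt (verit))
      show ?thesis
      proof (cases "x \<in> {0..l j}")
        case x: True
        show ?thesis using l True
          by (intro sqnorm_continuous_eq_0[OF _ H1_continuous[OF H1e_H1(1)[OF u(1) True]] s0 x]) auto
      next
        case False
        then show ?thesis by (rule H1_outside[OF H1e_H1(1)[OF u(1) True]])
      qed
    next
      case False
      then show ?thesis using H1e_outside[OF u(1)] by simp
    qed
    then have "u = 0" by (simp add: fun_eq_iff)
    then show False using u(2) by simp
  qed
  moreover have "H1_ip N l u u \<ge> 0" unfolding e by (intro sum_nonneg nn)
  ultimately show "H1_ip N l u u > 0" by linarith
qed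

section \<open>The boundary value problem on the network\<close>

text \<open>The variational characterization of an element makes every uniqueness and linearity statement about
the operator immediate.\<close>

lemma H1e_eqI:
  assumes l: "\<forall>j\<in>{1..N}. l j > 0" and u: "u \<in> H1e N l" and v: "v \<in> H1e N l"
    and eq: "\<And>f. f \<in> H1e N l \<Longrightarrow> H1_inner N l u f = H1_inner N l v f"
  shows "u = v"
proof -
  interpret inner_on "H1e N l" "H1_ip N l" by (rule inner_on_H1e[OF l])
  have "H1_ip N l (u - v) (u - v) = H1_ip N l u (u - v) - H1_ip N l v (u - v)"
    using u v by (intro ip_diff) auto
  also have "\<dots> = 0" using eq[of "u - v"] u v by (simp add: H1_ip_def)
  finally have "u - v = 0" using ip_pos[of "u - v"] u v by fastforce
  then show ?thesis by simp
qed

text \<open>Integration by parts on every edge. At the outer ends \<open>f\<close> vanishes, and at the node its common value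
is multiplied by the total flux of \<open>w\<close>.\<close>

lemma variational_form:
  assumes l: "\<forall>j\<in>{1..N}. l j > 0" and w: "w \<in> H1e N l" and f: "f \<in> H1e N l"
    and g: "\<And>j. j \<in> {1..N} \<Longrightarrow> is_primitive (l j) (w j) (g j)"
    and k: "\<And>j. j \<in> {1..N} \<Longrightarrow> is_primitive (l j) (g j) (k j)"
  shows "H1_inner N l w f = (\<Sum>j=1..N. LINT x|interval_measure (l j). (w j x - k j x) * cnj (f j x))
     - (\<Sum>j=1..N. g j 0) * cnj (f 1 0)"
proof -
  have "H1_inner N l w f = (\<Sum>j=1..N. (LINT x|interval_measure (l j). w j x * cnj (f j x)) +
     (LINT x|interval_measure (l j). g j x * cnj (dx l f j x)))"
    by (rule H1_inner_eq[OF l w f g dx_is_primitive[OF l f]])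
  also have "\<dots> = (\<Sum>j=1..N. (LINT x|interval_measure (l j). (w j x - k j x) * cnj (f j x)) - g j 0 * cnj (f 1 0))"
  proof (intro sum.cong refl)
    fix j assume j: "j \<in> {1..N}"
    have edge_pos: "l j > 0" using l j by auto
    note cf = is_primitive_cnj[OF dx_is_primitive[OF l f j]]
    have "(LINT x|interval_measure (l j). g j x * cnj (dx l f j x)) + (LINT x|interval_measure (l j). k j x * cnj (f j x))
      = g j (l j) * cnj (f j (l j)) - g j 0 * cnj (f j 0)"
      by (rule integration_by_parts_primitive[OF k[OF j] cf edge_pos])
    then have G: "(LINT x|interval_measure (l j). g j x * cnj (dx l f j x))
      = - g j 0 * cnj (f 1 0) - (LINT x|interval_measure (l j). k j x * cnj (f j x))"
      unfolding H1e_H1(2,3)[OF f j] by (simp add: eq_diff_eq)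
    have D: "(LINT x|interval_measure (l j). (w j x - k j x) * cnj (f j x))
       = (LINT x|interval_measure (l j). w j x * cnj (f j x)) - (LINT x|interval_measure (l j). k j x * cnj (f j x))"
      unfolding left_diff_distrib
      by (intro Bochner_Integration.integral_diff L2_mult_integrable is_primitive_in_L2[OF cf]
          is_primitive_in_L2[OF g[OF j]] is_primitive_L2[OF k[OF j]])
    show "(LINT x|interval_measure (l j). w j x * cnj (f j x)) + (LINT x|interval_measure (l j). g j x * cnj (dx l f j x))
      = (LINT x|interval_measure (l j). (w j x - k j x) * cnj (f j x)) - g j 0 * cnj (f 1 0)"
      unfolding G D by simp
  qed
  finally show ?thesis by (simp add: sum_subtractf sum_distrib_right)
qed

lemma deriv_at_node_primitive:
  assumes "l > 0" "is_primitive l w g" "continuous_on {0..l} g"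
  shows "deriv_at_node l w = g 0"
  unfolding deriv_at_node_def
  using assms by (intro vector_derivative_within_closed_interval is_primitive_has_derivative) auto

lemma resolvent_problemD:
  assumes l: "\<forall>j\<in>{1..N}. l j > 0" and w: "resolvent_problem N l q w"
  obtains g k where "w \<in> H1e N l" "\<And>j. j \<in> {1..N} \<Longrightarrow> is_primitive (l j) (w j) (g j)"
    "\<And>j. j \<in> {1..N} \<Longrightarrow> is_primitive (l j) (g j) (k j)"
    "\<And>j. j \<in> {1..N} \<Longrightarrow> AE x in interval_measure (l j). w j x - k j x = q j x"
    "(\<Sum>j=1..N. g j 0) = 0"
proof -
  have "\<exists>g. g \<in> H1 (l j) \<and> has_weak_deriv (l j) (w j) g" if "j \<in> {1..N}" for j
    using w that unfolding resolvent_problem_def H2_def by blast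
  then obtain g where g: "\<And>j. j \<in> {1..N} \<Longrightarrow> g j \<in> H1 (l j)"
      "\<And>j. j \<in> {1..N} \<Longrightarrow> has_weak_deriv (l j) (w j) (g j)" by metis
  define k where "k j = weak_deriv (l j) (g j)" for j
  have wH: "w j \<in> H1 (l j)" if "j \<in> {1..N}" for j
    using w that unfolding resolvent_problem_def H2_def by blast
  have wg: "is_primitive (l j) (w j) (g j)" if j: "j \<in> {1..N}" for j
    using has_weak_deriv_iff_primitive[of "l j" "w j" "g j"] H1_continuous[OF wH[OF j]] g(2)[OF j] l j by auto
  have gk: "is_primitive (l j) (g j) (k j)" if j: "j \<in> {1..N}" for j
    unfolding k_def using l j by (intro weak_deriv_is_primitive g) auto
  have "AE x in interval_measure (l j). w j x - k j x = q j x" if j: "j \<in> {1..N}" for j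
  proof -
    have "AE x in interval_measure (l j). w j x - dx l (dx l w) j x = q j x"
      using w j unfolding resolvent_problem_def by blast
    moreover have "AE x in interval_measure (l j). dx l (dx l w) j x = k j x"
      unfolding dx_def using l j by (intro second_weak_deriv_AE[OF _ wH[OF j] wg[OF j] gk[OF j]]) auto
    ultimately show ?thesis by eventually_elim simp
  qed
  moreover have "w \<in> H1e N l"
    using w wH unfolding resolvent_problem_def H1e_def by blast
  moreover have "(\<Sum>j=1..N. g j 0) = 0"
  proof -
    have "deriv_at_node (l j) (w j) = g j 0" if j: "j \<in> {1..N}" for j
      using l j by (intro deriv_at_node_primitive[OF _ wg[OF j]] H1_continuous g) auto
    then have "(\<Sum>j=1..N. g j 0) = (\<Sum>j=1..N. deriv_at_node (l j) (w j))" by simp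
    then show ?thesis using w unfolding resolvent_problem_def by simp
  qed
  ultimately show ?thesis using that wg gk by blast
qed

lemma resolvent_problemI:
  assumes l: "\<forall>j\<in>{1..N}. l j > 0" and w: "w \<in> H1e N l"
    and wg: "\<And>j. j \<in> {1..N} \<Longrightarrow> is_primitive (l j) (w j) (g j)"
    and gk: "\<And>j. j \<in> {1..N} \<Longrightarrow> is_primitive (l j) (g j) (k j)"
    and ae: "\<And>j. j \<in> {1..N} \<Longrightarrow> AE x in interval_measure (l j). w j x - k j x = q j x"
    and flux: "(\<Sum>j=1..N. g j 0) = 0"
  shows "resolvent_problem N l q w"
  unfolding resolvent_problem_def
proof (intro conjI ballI allI impI)
  fix j assume j: "j \<in> {1..N}"
  then have edge_pos: "l j > 0" using l by auto
  show "w j \<in> H2 (l j)"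
    unfolding H2_def
  proof (intro CollectI conjI bexI)
    \<comment> \<open>Elements of \<open>H1\<close> vanish outside the interval.\<close>
    define g' where "g' x = (if x \<in> {0..l j} then g j x else 0)" for x
    have gL: "g j \<in> L2 (l j)" by (rule is_primitive_L2[OF wg[OF j]])
    have ae': "AE x in interval_measure (l j). g j x = g' x"
      by (rule AE_I2) (simp add: g'_def)
    have g'L: "g' \<in> L2 (l j)"
    proof (rule L2_cong_AE[OF gL _ ae'])
      show "g' \<in> borel_measurable (interval_measure (l j))"
        by (rule measurable_cong[THEN iffD1, OF _ L2_measurable[OF gL]]) (simp add: g'_def)
    qed
    have "is_primitive (l j) (w j) g'"
      by (rule is_primitive_cong[OF wg[OF j] refl g'L ae'])
    then show "has_weak_deriv (l j) (w j) g'" by (rule is_primitive_has_weak_deriv[OF edge_pos])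
    have "is_primitive (l j) g' (k j)"
      by (rule is_primitive_cong[OF gk[OF j] _ is_primitive_L2[OF gk[OF j]]]) (auto simp: g'_def)
    then show "g' \<in> H1 (l j)"
      by (rule H1I[OF edge_pos]) (auto simp: g'_def)
  qed (rule H1e_H1[OF w j])
  show "w j (l j) = 0" by (rule H1e_H1[OF w j])
  have "AE x in interval_measure (l j). dx l (dx l w) j x = k j x"
    unfolding dx_def by (rule second_weak_deriv_AE[OF edge_pos H1e_H1(1)[OF w j] wg[OF j] gk[OF j]])
  then show "AE x in interval_measure (l j). w j x - dx l (dx l w) j x = q j x"
    using ae[OF j] by eventually_elim simp
next
  have "deriv_at_node (l j) (w j) = g j 0" if j: "j \<in> {1..N}" for j
    using l j by (intro deriv_at_node_primitive[OF _ wg[OF j]] is_primitive_continuous[OF gk]) auto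
  then show "(\<Sum>j=1..N. deriv_at_node (l j) (w j)) = 0" using flux by simp
next
  fix j k assume "j \<in> {1..N}" "k \<in> {1..N}"
  then show "w j 0 = w k 0" using H1e_H1(3)[OF w] by metis
next
  fix j assume "j \<notin> {1..N}"
  then show "w j = (\<lambda>x. 0)" by (rule H1e_outside[OF w])
qed

text \<open>By \<open>variational_form\<close>, the right-hand side \<open>q\<close> determines the inner product of a solution with every
element of the space.\<close>

lemma resolvent_problem_unique:
  assumes l: "\<forall>j\<in>{1..N}. l j > 0" and w: "resolvent_problem N l q w" and v: "resolvent_problem N l q v"
  shows "w = v"
proof -
  obtain g k where W: "w \<in> H1e N l" "\<And>j. j \<in> {1..N} \<Longrightarrow> is_primitive (l j) (w j) (g j)"
    "\<And>j. j \<in> {1..N} \<Longrightarrow> is_primitive (l j) (g j) (k j)"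
    "\<And>j. j \<in> {1..N} \<Longrightarrow> AE x in interval_measure (l j). w j x - k j x = q j x"
    "(\<Sum>j=1..N. g j 0) = 0" using resolvent_problemD[OF l w] by blast
  obtain g' k' where V: "v \<in> H1e N l" "\<And>j. j \<in> {1..N} \<Longrightarrow> is_primitive (l j) (v j) (g' j)"
    "\<And>j. j \<in> {1..N} \<Longrightarrow> is_primitive (l j) (g' j) (k' j)"
    "\<And>j. j \<in> {1..N} \<Longrightarrow> AE x in interval_measure (l j). v j x - k' j x = q j x"
    "(\<Sum>j=1..N. g' j 0) = 0" using resolvent_problemD[OF l v] by blast
  show ?thesis
  proof (rule H1e_eqI[OF l W(1) V(1)])
    fix f assume f: "f \<in> H1e N l"
    have "(LINT x|interval_measure (l j). (w j x - k j x) * cnj (f j x))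
        = (LINT x|interval_measure (l j). (v j x - k' j x) * cnj (f j x))" if j: "j \<in> {1..N}" for j
    proof (rule integral_cong_AE)
      note cf = is_primitive_in_L2[OF is_primitive_cnj[OF dx_is_primitive[OF l f j]]]
      show "(\<lambda>x. (w j x - k j x) * cnj (f j x)) \<in> borel_measurable (interval_measure (l j))"
        by (intro borel_measurable_times borel_measurable_diff L2_measurable cf
            is_primitive_in_L2[OF W(2)[OF j]] is_primitive_L2[OF W(3)[OF j]])
      show "(\<lambda>x. (v j x - k' j x) * cnj (f j x)) \<in> borel_measurable (interval_measure (l j))"
        by (intro borel_measurable_times borel_measurable_diff L2_measurable cf
            is_primitive_in_L2[OF V(2)[OF j]] is_primitive_L2[OF V(3)[OF j]])
      show "AE x in interval_measure (l j). (w j x - k j x) * cnj (f j x) = (v j x - k' j x) * cnj (f j x)"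
        using W(4)[OF j] V(4)[OF j] by eventually_elim simp
    qed
    then show "H1_inner N l w f = H1_inner N l v f"
      using variational_form[OF l W(1) f W(2,3), unfolded W(5)] variational_form[OF l V(1) f V(2,3), unfolded V(5)]
      by (metis (no_types, lifting) sum.cong)
  qed
qed

lemma inv_I_minus_Laplacian_eq:
  assumes "\<forall>j\<in>{1..N}. l j > 0" "resolvent_problem N l q w"
  shows "inv_I_minus_Laplacian N l q = w"
  unfolding inv_I_minus_Laplacian_def
  by (rule the_equality[where P = "resolvent_problem N l q", OF assms(2) resolvent_problem_unique[OF assms(1) _ assms(2)]])

section \<open>Variation of constants\<close>

definition cosh_int :: "(real \<Rightarrow> complex) \<Rightarrow> real \<Rightarrow> complex"
  where "cosh_int f x = integral {0..x} (\<lambda>y. of_real (cosh y) * f y)"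

definition sinh_int :: "(real \<Rightarrow> complex) \<Rightarrow> real \<Rightarrow> complex"
  where "sinh_int f x = integral {0..x} (\<lambda>y. of_real (sinh y) * f y)"

text \<open>The solution of \<open>v - v'' = - f'\<close> on one edge with \<open>v 0 = a\<close> and \<open>v' 0 = f 0 + b\<close>. The variation of
constants formula has been integrated by parts, so that only \<open>f\<close> itself and not its derivative occurs.\<close>

definition edge_sol :: "complex \<Rightarrow> complex \<Rightarrow> (real \<Rightarrow> complex) \<Rightarrow> real \<Rightarrow> complex"
  where "edge_sol a b f x = of_real (cosh x) * (cosh_int f x + a) - of_real (sinh x) * (sinh_int f x - b)"

text \<open>The derivative of \<open>edge_sol a b f\<close>.\<close>

definition edge_deriv :: "complex \<Rightarrow> complex \<Rightarrow> (real \<Rightarrow> complex) \<Rightarrow> real \<Rightarrow> complex"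
  where "edge_deriv a b f x = f x + of_real (sinh x) * (cosh_int f x + a) - of_real (cosh x) * (sinh_int f x - b)"

lemma hyperbolic_derivs:
  "((\<lambda>x. complex_of_real (cosh x)) has_vector_derivative of_real (sinh x)) (at x within S)"
  "((\<lambda>x. complex_of_real (sinh x)) has_vector_derivative of_real (cosh x)) (at x within S)"
proof -
  have "(cosh has_vector_derivative sinh x) (at x within S)" "(sinh has_vector_derivative cosh x) (at x within S)"
    unfolding has_real_derivative_iff_has_vector_derivative[symmetric]
    by (auto intro!: derivative_eq_intros)
  then show "((\<lambda>x. complex_of_real (cosh x)) has_vector_derivative of_real (sinh x)) (at x within S)"
    "((\<lambda>x. complex_of_real (sinh x)) has_vector_derivative of_real (cosh x)) (at x within S)"
    by (auto intro: bounded_linear.has_vector_derivative[OF bounded_linear_of_real])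
qed

lemma cosh_sinh_int_derivs:
  assumes f: "continuous_on {0..L} f" and x: "x \<in> {0..L}"
  shows "(cosh_int f has_vector_derivative of_real (cosh x) * f x) (at x within {0..L})"
    "(sinh_int f has_vector_derivative of_real (sinh x) * f x) (at x within {0..L})"
  unfolding cosh_int_def[abs_def] sinh_int_def[abs_def]
  by (rule integral_has_vector_derivative[OF _ x], intro continuous_intros f)+

text \<open>The derivative \<open>v'\<close> of the solution is \<open>f\<close> plus a continuously differentiable function with derivative
\<open>v\<close>. This splitting stays meaningful when \<open>f\<close> is only continuous.\<close>

lemma edge_sol_deriv:
  assumes f: "continuous_on {0..L} f" and x: "x \<in> {0..L}"
  shows "(edge_sol a b f has_vector_derivative edge_deriv a b f x) (at x within {0..L})"
    "((\<lambda>x. edge_deriv a b f x - f x) has_vector_derivative edge_sol a b f x) (at x within {0..L})"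
proof -
  note d = cosh_sinh_int_derivs[OF f x] hyperbolic_derivs[where S = "{0..L}" and x = x]
  have e: "of_real (cosh x) * (of_real (cosh x) * f x) - of_real (sinh x) * (of_real (sinh x) * f x) = f x"
    using hyperbolic_pythagoras[of x]
    by (simp add: mult.assoc[symmetric] left_diff_distrib[symmetric] power2_eq_square
        of_real_mult[symmetric] of_real_diff[symmetric] del: of_real_mult of_real_diff)
  have "((\<lambda>x. of_real (cosh x) * (cosh_int f x + a) - of_real (sinh x) * (sinh_int f x - b)) has_vector_derivative
      (of_real (cosh x) * (of_real (cosh x) * f x + 0) + of_real (sinh x) * (cosh_int f x + a)
      - (of_real (sinh x) * (of_real (sinh x) * f x - 0) + of_real (cosh x) * (sinh_int f x - b)))) (at x within {0..L})"
    by (intro has_vector_derivative_diff has_vector_derivative_mult has_vector_derivative_add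
        has_vector_derivative_const d)
  moreover have "(of_real (cosh x) * (of_real (cosh x) * f x + 0) + of_real (sinh x) * (cosh_int f x + a)
      - (of_real (sinh x) * (of_real (sinh x) * f x - 0) + of_real (cosh x) * (sinh_int f x - b))) = edge_deriv a b f x"
    unfolding edge_deriv_def using e by (simp add: algebra_simps)
  ultimately show "(edge_sol a b f has_vector_derivative edge_deriv a b f x) (at x within {0..L})"
    unfolding edge_sol_def[abs_def] by simp
  have "((\<lambda>x. of_real (sinh x) * (cosh_int f x + a) - of_real (cosh x) * (sinh_int f x - b)) has_vector_derivative
      (of_real (sinh x) * (of_real (cosh x) * f x + 0) + of_real (cosh x) * (cosh_int f x + a)
      - (of_real (cosh x) * (of_real (sinh x) * f x - 0) + of_real (sinh x) * (sinh_int f x - b)))) (at x within {0..L})"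
    by (intro has_vector_derivative_diff has_vector_derivative_mult has_vector_derivative_add
        has_vector_derivative_const d)
  moreover have "(of_real (sinh x) * (of_real (cosh x) * f x + 0) + of_real (cosh x) * (cosh_int f x + a)
      - (of_real (cosh x) * (of_real (sinh x) * f x - 0) + of_real (sinh x) * (sinh_int f x - b))) = edge_sol a b f x"
    unfolding edge_sol_def by (simp add: algebra_simps)
  moreover have "(\<lambda>x. edge_deriv a b f x - f x) = (\<lambda>x. of_real (sinh x) * (cosh_int f x + a) - of_real (cosh x) * (sinh_int f x - b))"
    by (simp add: edge_deriv_def fun_eq_iff)
  ultimately show "((\<lambda>x. edge_deriv a b f x - f x) has_vector_derivative edge_sol a b f x) (at x within {0..L})"
    by simp
qed

lemma edge_sol_continuous:
  assumes f: "continuous_on {0..L} f"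
  shows "continuous_on {0..L} (edge_sol a b f)" "continuous_on {0..L} (edge_deriv a b f)"
proof -
  have "continuous_on {0..L} (cosh_int f)" "continuous_on {0..L} (sinh_int f)"
    unfolding continuous_on_eq_continuous_within
    using has_vector_derivative_continuous[OF cosh_sinh_int_derivs(1)[OF f]]
      has_vector_derivative_continuous[OF cosh_sinh_int_derivs(2)[OF f]] by blast+
  then show "continuous_on {0..L} (edge_sol a b f)" "continuous_on {0..L} (edge_deriv a b f)"
    unfolding edge_sol_def[abs_def] edge_deriv_def[abs_def] by (auto intro!: continuous_intros f)
qed

lemma edge_sol_primitive:
  assumes f: "continuous_on {0..L} f"
  shows "is_primitive L (edge_sol a b f) (edge_deriv a b f)"
    "is_primitive L f f' \<Longrightarrow> is_primitive L (edge_deriv a b f) (\<lambda>x. f' x + edge_sol a b f x)"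
proof -
  show "is_primitive L (edge_sol a b f) (edge_deriv a b f)"
    by (rule is_primitive_C1[OF edge_sol_deriv(1)[OF f] edge_sol_continuous(2)[OF f]])
  have h: "is_primitive L (\<lambda>x. edge_deriv a b f x - f x) (edge_sol a b f)"
    by (rule is_primitive_C1[OF edge_sol_deriv(2)[OF f] edge_sol_continuous(1)[OF f]])
  assume "is_primitive L f f'"
  from is_primitive_add[OF this h]
  show "is_primitive L (edge_deriv a b f) (\<lambda>x. f' x + edge_sol a b f x)" by simp
qed

lemma edge_sol_0: "edge_sol a b f 0 = a" "edge_deriv a b f 0 = f 0 + b"
  by (simp_all add: edge_sol_def edge_deriv_def cosh_int_def sinh_int_def)

locale star_network =
  fixes N :: nat and l :: "nat \<Rightarrow> real" and \<alpha> :: real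
  assumes N1: "N \<ge> 1" and lpos: "\<forall>j\<in>{1..N}. l j > 0" and \<alpha>: "\<alpha> > real N / 2"
begin

lemma edge_pos: "j \<in> {1..N} \<Longrightarrow> l j > 0"
  using lpos by auto

lemma one_in: "1 \<in> {1..N}"
  using N1 by auto

definition coth_end :: "nat \<Rightarrow> real" where "coth_end j = cosh (l j) / sinh (l j)"

definition coth_sum :: real where "coth_sum = (\<Sum>j=1..N. coth_end j)"

lemma coth_end_pos: "j \<in> {1..N} \<Longrightarrow> coth_end j > 0"
  using edge_pos by (simp add: coth_end_def)

lemma coth_sum_pos: "coth_sum > 0"
  unfolding coth_sum_def using one_in coth_end_pos by (intro sum_pos) auto

text \<open>The common value at the node of the solution with total flux \<open>\<beta>\<close>; it is obtained by solving the
conditions at the outer ends for the slopes and inserting these into the flux condition.\<close>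

definition node_value :: "network_fun \<Rightarrow> complex \<Rightarrow> complex"
  where "node_value u \<beta> = (of_nat N * u 1 0 + (\<Sum>j=1..N. sinh_int (u j) (l j) - of_real (coth_end j) * cosh_int (u j) (l j)) - \<beta>)
     / of_real coth_sum"

text \<open>The choice of \<open>b\<close> for which \<open>edge_sol a b f\<close> vanishes at the outer end of edge \<open>j\<close>.\<close>

definition slope_coeff :: "network_fun \<Rightarrow> complex \<Rightarrow> nat \<Rightarrow> complex"
  where "slope_coeff u \<beta> j = sinh_int (u j) (l j) - of_real (coth_end j) * (cosh_int (u j) (l j) + node_value u \<beta>)"

text \<open>The solution \<open>v\<close> of \<open>v\<^sub>j - v\<^sub>j'' = - u\<^sub>j'\<close> with zero values at the outer ends, continuity at the node and
total flux \<open>\<beta>\<close>. With \<open>\<beta> = 0\<close> it is minus the resolvent of \<open>dx l u\<close>; with \<open>u = 0\<close> and \<open>\<beta> = 1\<close> it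
is the part of \<open>varphi\<close> that the resolvent does not remove.\<close>

definition bvp_sol :: "network_fun \<Rightarrow> complex \<Rightarrow> network_fun"
  where "bvp_sol u \<beta> = (\<lambda>j x. if j \<in> {1..N} \<and> x \<in> {0..l j} then edge_sol (node_value u \<beta>) (slope_coeff u \<beta> j) (u j) x else 0)"

definition bvp_deriv :: "network_fun \<Rightarrow> complex \<Rightarrow> network_fun"
  where "bvp_deriv u \<beta> = (\<lambda>j x. edge_deriv (node_value u \<beta>) (slope_coeff u \<beta> j) (u j) x)"

text \<open>Uniform limits of elements of the energy space are of this kind.\<close>

definition continuous_network :: "network_fun \<Rightarrow> bool"
  where "continuous_network u \<longleftrightarrow> (\<forall>j\<in>{1..N}. continuous_on {0..l j} (u j) \<and> u j 0 = u 1 0)"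

lemma continuous_network_H1e: "u \<in> H1e N l \<Longrightarrow> continuous_network u"
  using H1e_H1 H1_continuous by (auto simp: continuous_network_def)

lemma bvp_sol_primitive:
  assumes u: "continuous_network u" and j: "j \<in> {1..N}"
  shows "is_primitive (l j) (bvp_sol u \<beta> j) (bvp_deriv u \<beta> j)"
    "is_primitive (l j) (u j) g \<Longrightarrow> is_primitive (l j) (bvp_deriv u \<beta> j) (\<lambda>x. g x + bvp_sol u \<beta> j x)"
proof -
  have c: "continuous_on {0..l j} (u j)" using u j by (auto simp: continuous_network_def)
  have e: "edge_sol (node_value u \<beta>) (slope_coeff u \<beta> j) (u j) x = bvp_sol u \<beta> j x" if "x \<in> {0..l j}" for x
    using that j by (simp add: bvp_sol_def)
  note p = edge_sol_primitive[OF c, where a = "node_value u \<beta>" and b = "slope_coeff u \<beta> j"]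
  show 1: "is_primitive (l j) (bvp_sol u \<beta> j) (bvp_deriv u \<beta> j)"
    unfolding bvp_deriv_def by (rule is_primitive_cong[OF p(1) e is_primitive_L2[OF p(1)]]) auto
  assume g: "is_primitive (l j) (u j) g"
  show "is_primitive (l j) (bvp_deriv u \<beta> j) (\<lambda>x. g x + bvp_sol u \<beta> j x)"
    unfolding bvp_deriv_def
  proof (rule is_primitive_cong[OF p(2)[OF g] refl])
    show "(\<lambda>x. g x + bvp_sol u \<beta> j x) \<in> L2 (l j)"
      by (intro L2_add is_primitive_L2[OF g] is_primitive_in_L2[OF 1])
    show "AE x in interval_measure (l j). g x + edge_sol (node_value u \<beta>) (slope_coeff u \<beta> j) (u j) x = g x + bvp_sol u \<beta> j x"
      by (rule AE_I2) (simp add: bvp_sol_def, use j in auto)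
  qed
qed

lemma bvp_sol_H1e:
  assumes u: "continuous_network u"
  shows "bvp_sol u \<beta> \<in> H1e N l"
proof (rule H1eI)
  fix j assume j: "j \<in> {1..N}"
  show "bvp_sol u \<beta> j \<in> H1 (l j)"
    by (rule H1I[OF edge_pos[OF j] bvp_sol_primitive(1)[OF u j]]) (auto simp: bvp_sol_def)
  have "sinh (l j) > 0" using edge_pos[OF j] by simp
  then have s: "complex_of_real (cosh (l j)) = of_real (sinh (l j)) * of_real (coth_end j)"
    unfolding coth_end_def of_real_mult[symmetric] by simp
  show "bvp_sol u \<beta> j (l j) = 0"
    using edge_pos[OF j] j unfolding bvp_sol_def edge_sol_def slope_coeff_def s by (simp add: algebra_simps)
  show "bvp_sol u \<beta> j 0 = node_value u \<beta>"
    using edge_pos[OF j] j by (simp add: bvp_sol_def edge_sol_0)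
qed (auto simp: bvp_sol_def)

lemma bvp_sol_flux:
  assumes u: "continuous_network u"
  shows "(\<Sum>j=1..N. bvp_deriv u \<beta> j 0) = \<beta>"
proof -
  have S: "complex_of_real coth_sum \<noteq> 0" using coth_sum_pos by simp
  have "(\<Sum>j=1..N. bvp_deriv u \<beta> j 0) = (\<Sum>j=1..N. u 1 0 + slope_coeff u \<beta> j)"
  proof (intro sum.cong refl)
    fix j assume j: "j \<in> {1..N}"
    have "u j 0 = u 1 0" using u j unfolding continuous_network_def by blast
    then show "bvp_deriv u \<beta> j 0 = u 1 0 + slope_coeff u \<beta> j" unfolding bvp_deriv_def edge_sol_0 by (rule arg_cong)
  qed
  also have "\<dots> = of_nat N * u 1 0 + (\<Sum>j=1..N. (sinh_int (u j) (l j) - of_real (coth_end j) * cosh_int (u j) (l j)) - of_real (coth_end j) * node_value u \<beta>)"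
  proof -
    have "slope_coeff u \<beta> j = (sinh_int (u j) (l j) - of_real (coth_end j) * cosh_int (u j) (l j)) - of_real (coth_end j) * node_value u \<beta>" for j
      by (simp add: slope_coeff_def distrib_left)
    then show ?thesis by (simp only: sum.distrib sum_constant) simp
  qed
  also have "\<dots> = of_nat N * u 1 0 + (\<Sum>j=1..N. sinh_int (u j) (l j) - of_real (coth_end j) * cosh_int (u j) (l j)) - of_real coth_sum * node_value u \<beta>"
    unfolding coth_sum_def by (simp only: sum_subtractf of_real_sum sum_distrib_right) simp
  also have "\<dots> = \<beta>" using S by (simp add: node_value_def)
  finally show ?thesis .
qed

text \<open>A special case of \<open>variational_form\<close>, since \<open>v - v'' = - g\<close> for \<open>v = bvp_sol u \<beta>\<close> and its flux is \<open>\<beta>\<close>.\<close>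

lemma bvp_sol_variational:
  assumes u: "continuous_network u" and f: "f \<in> H1e N l"
    and g: "\<And>j. j \<in> {1..N} \<Longrightarrow> is_primitive (l j) (u j) (g j)"
  shows "H1_inner N l (bvp_sol u \<beta>) f = - (\<Sum>j=1..N. LINT x|interval_measure (l j). g j x * cnj (f j x)) - \<beta> * cnj (f 1 0)"
proof -
  have "H1_inner N l (bvp_sol u \<beta>) f = (\<Sum>j=1..N. LINT x|interval_measure (l j). (bvp_sol u \<beta> j x - (g j x + bvp_sol u \<beta> j x)) * cnj (f j x))
     - (\<Sum>j=1..N. bvp_deriv u \<beta> j 0) * cnj (f 1 0)"
    by (rule variational_form[OF lpos bvp_sol_H1e[OF u] f bvp_sol_primitive(1)[OF u] bvp_sol_primitive(2)[OF u _ g]])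
  then show ?thesis unfolding bvp_sol_flux[OF u] by (simp add: sum_negf)
qed

lemma bvp_sol_affine:
  "bvp_sol u \<beta> j x = bvp_sol u 0 j x + \<beta> * bvp_sol 0 1 j x"
proof -
  have S: "complex_of_real coth_sum \<noteq> 0" using coth_sum_pos by simp
  have a: "node_value u \<beta> = node_value u 0 + \<beta> * node_value 0 1"
    using S by (simp add: node_value_def field_simps cosh_int_def sinh_int_def)
  have b: "slope_coeff u \<beta> j = slope_coeff u 0 j + \<beta> * slope_coeff 0 1 j"
    unfolding slope_coeff_def a by (simp add: algebra_simps cosh_int_def sinh_int_def)
  show ?thesis unfolding bvp_sol_def a b edge_sol_def
    by (simp add: algebra_simps cosh_int_def sinh_int_def)
qed

lemma continuous_network_zero: "continuous_network 0"
  by (simp add: continuous_network_def zero_fun_def)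

lemma inv_Laplacian_dx:
  assumes u: "u \<in> H1e N l"
  shows "inv_I_minus_Laplacian N l (dx l u) = (\<lambda>j x. - bvp_sol u 0 j x)"
proof (rule inv_I_minus_Laplacian_eq[OF lpos resolvent_problemI[OF lpos]])
  note nw = continuous_network_H1e[OF u]
  have neg: "(\<lambda>j x. - bvp_sol u 0 j x) = cscale (-1) (bvp_sol u 0)" by (simp add: cscale_def)
  show "(\<lambda>j x. - bvp_sol u 0 j x) \<in> H1e N l"
    unfolding neg by (rule H1e_cscale[OF lpos bvp_sol_H1e[OF nw]])
  fix j assume j: "j \<in> {1..N}"
  show "is_primitive (l j) (\<lambda>x. - bvp_sol u 0 j x) (\<lambda>x. - bvp_deriv u 0 j x)"
    using is_primitive_cmult[OF bvp_sol_primitive(1)[OF nw j], of "-1"] by simp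
  show "is_primitive (l j) (\<lambda>x. - bvp_deriv u 0 j x) (\<lambda>x. - (dx l u j x + bvp_sol u 0 j x))"
    using is_primitive_cmult[OF bvp_sol_primitive(2)[OF nw j dx_is_primitive[OF lpos u j]], of "-1"] by simp
  show "AE x in interval_measure (l j). - bvp_sol u 0 j x - - (dx l u j x + bvp_sol u 0 j x) = dx l u j x"
    by simp
next
  show "(\<Sum>j=1..N. - bvp_deriv u 0 j 0) = 0"
    using bvp_sol_flux[OF continuous_network_H1e[OF u], of 0] by (simp add: sum_negf)
qed

text \<open>The function \<open>varphi\<close> is affine on each edge, so its second derivative is zero; it has total flux one,
which is compensated by \<open>bvp_sol 0 1\<close>.\<close>

lemma inv_Laplacian_varphi:
  "inv_I_minus_Laplacian N l (\<lambda>k y. varphi N l k y - dx l (dx l (varphi N l)) k y)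
    = (\<lambda>j x. varphi N l j x - bvp_sol 0 1 j x)"
proof (rule inv_I_minus_Laplacian_eq[OF lpos resolvent_problemI[OF lpos]])
  define s where "s = inverse (\<Sum>i=1..N. inverse (l i))"
  have spos: "(\<Sum>i=1..N. inverse (l i)) > 0" using one_in edge_pos by (intro sum_pos) auto
  define c where "c j = complex_of_real (s / l j)" for j
  have phi: "is_primitive (l j) (varphi N l j) (\<lambda>x. c j)" if j: "j \<in> {1..N}" for j
  proof (rule is_primitive_cong)
    have "((\<lambda>x. c j * of_real (x - l j)) has_vector_derivative c j) (at x within {0..l j})" for x
    proof -
      have "((\<lambda>x. c j * complex_of_real (x - l j)) has_vector_derivative c j * of_real (1 - 0)) (at x within {0..l j})"
        by (intro has_vector_derivative_mult_right bounded_linear.has_vector_derivative[OF bounded_linear_of_real]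
            has_vector_derivative_diff has_vector_derivative_id has_vector_derivative_const)
      then show ?thesis by simp
    qed
    then show "is_primitive (l j) (\<lambda>x. c j * of_real (x - l j)) (\<lambda>x. c j)"
      by (intro is_primitive_C1) auto
    show "c j * of_real (x - l j) = varphi N l j x" if "x \<in> {0..l j}" for x
      using that j by (simp add: varphi_def c_def s_def field_simps)
  qed (auto intro: L2_const)
  have phiH: "varphi N l \<in> H1e N l"
  proof (rule H1eI)
    fix j assume j: "j \<in> {1..N}"
    show "varphi N l j \<in> H1 (l j)" by (rule H1I[OF edge_pos[OF j] phi[OF j]]) (auto simp: varphi_def)
    show "varphi N l j (l j) = 0" "varphi N l j 0 = of_real (- s)"
      using edge_pos[OF j] j by (auto simp: varphi_def s_def)
  qed (auto simp: varphi_def)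
  have cp: "is_primitive (l j) (\<lambda>x. c j) (\<lambda>x. 0)" for j by (rule is_primitive_const)
  have dd: "AE x in interval_measure (l j). dx l (dx l (varphi N l)) j x = 0" if j: "j \<in> {1..N}" for j
    unfolding dx_def by (rule second_weak_deriv_AE[OF edge_pos[OF j] H1e_H1(1)[OF phiH j] phi[OF j] cp])
  note nw = continuous_network_zero
  have e: "(\<lambda>j x. varphi N l j x - bvp_sol 0 1 j x) = varphi N l + cscale (-1) (bvp_sol 0 1)"
    by (simp add: cscale_def fun_eq_iff)
  show "(\<lambda>j x. varphi N l j x - bvp_sol 0 1 j x) \<in> H1e N l"
    unfolding e by (intro H1e_add[OF lpos] H1e_cscale[OF lpos] bvp_sol_H1e nw phiH)
  show "(\<Sum>j=1..N. c j - bvp_deriv 0 1 j 0) = 0"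
  proof -
    have "(\<Sum>j=1..N. c j) = of_real (s * (\<Sum>j=1..N. inverse (l j)))"
      by (simp add: c_def sum_distrib_left divide_inverse)
    also have "\<dots> = 1" using spos by (simp add: s_def)
    finally show ?thesis using bvp_sol_flux[OF nw, of 1] by (simp add: sum_subtractf)
  qed
  fix j assume j: "j \<in> {1..N}"
  show "is_primitive (l j) (\<lambda>x. varphi N l j x - bvp_sol 0 1 j x) (\<lambda>x. c j - bvp_deriv 0 1 j x)"
    by (rule is_primitive_diff[OF phi[OF j] bvp_sol_primitive(1)[OF nw j]])
  have z: "is_primitive (l j) ((0::network_fun) j) (\<lambda>x. 0)"
    using is_primitive_const[of "l j" 0] by (simp add: zero_fun_def)
  show "is_primitive (l j) (\<lambda>x. c j - bvp_deriv 0 1 j x) (\<lambda>x. 0 - (0 + bvp_sol 0 1 j x))"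
    by (rule is_primitive_diff[OF cp bvp_sol_primitive(2)[OF nw j z]])
  show "AE x in interval_measure (l j). varphi N l j x - bvp_sol 0 1 j x - (0 - (0 + bvp_sol 0 1 j x))
     = varphi N l j x - dx l (dx l (varphi N l)) j x"
    using dd[OF j] by eventually_elim simp
qed

definition A :: "network_fun \<Rightarrow> network_fun"
  where "A u = bvp_sol u (of_real \<alpha> * u 1 0)"

theorem BBM_op_eq:
  assumes u: "u \<in> H1e N l"
  shows "BBM_op N l \<alpha> u = A u"
  unfolding BBM_op_def inv_Laplacian_dx[OF u] inv_Laplacian_varphi A_def
  by (intro ext) (subst (2) bvp_sol_affine, simp)

text \<open>The node condition in the domain holds for every element of the energy space, because \<open>A u\<close> has the
prescribed flux by construction.\<close>

theorem BBM_domain_eq: "BBM_domain N l \<alpha> = H1e N l"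
proof -
  have "(\<Sum>i=1..N. deriv_at_node (l i) (A u i)) = of_real \<alpha> * u 1 0" if u: "u \<in> H1e N l" for u
  proof -
    note nw = continuous_network_H1e[OF u]
    have "deriv_at_node (l i) (A u i) = bvp_deriv u (of_real \<alpha> * u 1 0) i 0" if i: "i \<in> {1..N}" for i
      unfolding A_def
      by (rule deriv_at_node_primitive[OF edge_pos[OF i] bvp_sol_primitive(1)[OF nw i]
          is_primitive_continuous[OF bvp_sol_primitive(2)[OF nw i dx_is_primitive[OF lpos u i]]]])
    then show ?thesis using bvp_sol_flux[OF nw] by simp
  qed
  then show ?thesis unfolding BBM_domain_def using BBM_op_eq by auto
qed

lemma A_H1e: "u \<in> H1e N l \<Longrightarrow> A u \<in> H1e N l"
  unfolding A_def by (intro bvp_sol_H1e continuous_network_H1e)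

lemma A_variational:
  assumes u: "u \<in> H1e N l" and f: "f \<in> H1e N l"
    and g: "\<And>j. j \<in> {1..N} \<Longrightarrow> is_primitive (l j) (u j) (g j)"
  shows "H1_inner N l (A u) f = - (\<Sum>j=1..N. LINT x|interval_measure (l j). g j x * cnj (f j x))
    - of_real \<alpha> * u 1 0 * cnj (f 1 0)"
  unfolding A_def by (rule bvp_sol_variational[OF continuous_network_H1e[OF u] f g])

end

section \<open>Compactness and dissipation\<close>

lemma LINT_const_interval: "0 \<le> x \<Longrightarrow> (LINT y|interval_measure x. (1::real)) = x"
  using LINT_eq_integral_continuous(2)[of x "\<lambda>_. 1::real"] by simp

text \<open>The increment of \<open>u\<close> is the pairing of its derivative with the indicator function of the interval from
\<open>x\<close> to \<open>y\<close>.\<close>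

lemma primitive_Holder:
  assumes u: "is_primitive l u g" and xy: "0 \<le> x" "x \<le> y" "y \<le> l"
  shows "cmod (u y - u x) \<le> sqrt (y - x) * sqrt (sqnorm l g)"
proof -
  let ?M = "interval_measure l"
  define k where "k t = (indicator {..<y} t - indicator {..<x} t :: real)" for t
  have gL: "g \<in> L2 l" by (rule is_primitive_L2[OF u])
  have i1: "integrable ?M (\<lambda>_. 1::real)"
    by (rule LINT_eq_integral_continuous(1)) (rule continuous_on_const)
  have meas: "{..<z} \<inter> space ?M \<in> sets ?M" for z
    by (auto simp: sets_restrict_space)
  have ind: "integrable ?M (\<lambda>t. indicator {..<z} t *\<^sub>R f t)"
    if f: "integrable ?M f" for z and f :: "real \<Rightarrow> 'b::euclidean_space"
  proof (rule Bochner_Integration.integrable_cong[THEN iffD1, OF refl _ integrable_mult_indicator[OF meas[of z] f]])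
    show "indicator ({..<z} \<inter> space ?M) t *\<^sub>R f t = indicator {..<z} t *\<^sub>R f t" if "t \<in> space ?M" for t
      using that by (auto simp: indicator_def)
  qed
  have km: "(\<lambda>t. complex_of_real (k t)) \<in> borel_measurable ?M"
  proof -
    have "(\<lambda>t. k t) \<in> borel_measurable ?M"
      using borel_measurable_integrable[OF ind[OF i1, of y]] borel_measurable_integrable[OF ind[OF i1, of x]]
      unfolding k_def by simp
    then show ?thesis by measurable
  qed
  have kL: "(\<lambda>t. complex_of_real (k t)) \<in> L2 l"
    by (rule L2_bounded[OF km, where B = 1]) (auto simp: k_def indicator_def)
  have "u y - u x = (LINT t|interval_measure y. g t) - (LINT t|interval_measure x. g t)"
    using is_primitive_eval[OF u, of x] is_primitive_eval[OF u, of y] xy by simp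
  also have "\<dots> = (LINT t|?M. indicator {..<y} t *\<^sub>R g t) - (LINT t|?M. indicator {..<x} t *\<^sub>R g t)"
    using xy LINT_subinterval[of y l g] LINT_subinterval[of x l g] by simp
  also have "\<dots> = (LINT t|?M. indicator {..<y} t *\<^sub>R g t - indicator {..<x} t *\<^sub>R g t)"
    by (intro Bochner_Integration.integral_diff[symmetric] ind L2_integrable gL)
  also have "\<dots> = (LINT t|?M. of_real (k t) * g t)"
    by (intro Bochner_Integration.integral_cong refl) (simp add: k_def scaleR_conv_of_real left_diff_distrib)
  finally have "cmod (u y - u x) \<le> sqrt (sqnorm l (\<lambda>t. of_real (k t))) * sqrt (sqnorm l g)"
    using L2_Cauchy_Schwarz[OF kL gL] by simp
  moreover have "sqnorm l (\<lambda>t. of_real (k t)) = y - x"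
  proof -
    have "sqnorm l (\<lambda>t. of_real (k t)) = (LINT t|?M. indicator {..<y} t *\<^sub>R (1::real) - indicator {..<x} t *\<^sub>R 1)"
      unfolding sqnorm_def using xy
      by (intro Bochner_Integration.integral_cong refl) (auto simp: k_def indicator_def)
    also have "\<dots> = (LINT t|?M. indicator {..<y} t *\<^sub>R (1::real)) - (LINT t|?M. indicator {..<x} t *\<^sub>R 1)"
      by (intro Bochner_Integration.integral_diff ind i1)
    also have "\<dots> = y - x"
      using xy LINT_subinterval[of y l "\<lambda>_. 1::real"] LINT_subinterval[of x l "\<lambda>_. 1::real"]
        LINT_const_interval[of x] LINT_const_interval[of y] by simp
    finally show ?thesis .
  qed
  ultimately show ?thesis by simp
qed

lemma primitive_Holder_abs:
  assumes u: "is_primitive l u g" and "x \<in> {0..l}" "y \<in> {0..l}"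
  shows "cmod (u x - u y) \<le> sqrt \<bar>x - y\<bar> * sqrt (sqnorm l g)"
  using primitive_Holder[OF u, of x y] primitive_Holder[OF u, of y x] assms(2,3)
  by (cases "x \<le> y") (auto simp: norm_minus_commute abs_if)

lemma cosh_le_cosh: "0 \<le> (x::real) \<Longrightarrow> x \<le> y \<Longrightarrow> cosh x \<le> cosh y"
  by (simp add: cosh_real_nonneg_le_iff)

lemma cosh_sinh_int_bound:
  assumes f: "continuous_on {0..L} f" and b: "\<And>x. x \<in> {0..L} \<Longrightarrow> cmod (f x) \<le> d" and x: "x \<in> {0..L}"
  shows "cmod (cosh_int f x) \<le> cosh L * L * d" "cmod (sinh_int f x) \<le> cosh L * L * d"
proof -
  have fx: "continuous_on {0..x} f" using f x by (auto elim: continuous_on_subset)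
  have d: "d \<ge> 0" using b[OF x] norm_ge_zero order_trans by blast
  have "cmod (cosh_int f x) \<le> (cosh L * d) * (x - 0)"
    unfolding cosh_int_def
  proof (rule integral_bound)
    fix t assume t: "t \<in> {0..x}"
    then show "cmod (of_real (cosh t) * f t) \<le> cosh L * d"
      using x b[of t] cosh_le_cosh[of t L] unfolding norm_mult by (intro mult_mono) auto
  qed (use x in \<open>auto intro!: continuous_intros fx\<close>)
  also have "\<dots> \<le> (cosh L * d) * L" using x d by (intro mult_left_mono) auto
  finally show "cmod (cosh_int f x) \<le> cosh L * L * d" by (simp add: mult_ac)
  have "cmod (sinh_int f x) \<le> (cosh L * d) * (x - 0)"
    unfolding sinh_int_def
  proof (rule integral_bound)
    fix t assume t: "t \<in> {0..x}"
    have "\<bar>sinh t\<bar> \<le> cosh L" using t x cosh_le_cosh[of t L] sinh_le_cosh_real[of t] by (auto simp: abs_if)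
    then show "cmod (of_real (sinh t) * f t) \<le> cosh L * d"
      using t x b[of t] unfolding norm_mult by (intro mult_mono) auto
  qed (use x in \<open>auto intro!: continuous_intros fx\<close>)
  also have "\<dots> \<le> (cosh L * d) * L" using x d by (intro mult_left_mono) auto
  finally show "cmod (sinh_int f x) \<le> cosh L * L * d" by (simp add: mult_ac)
qed

lemma cosh_sinh_int_diff:
  assumes f: "continuous_on {0..L} f" and g: "continuous_on {0..L} g" and x: "x \<in> {0..L}"
  shows "cosh_int (\<lambda>y. f y - g y) x = cosh_int f x - cosh_int g x"
    "sinh_int (\<lambda>y. f y - g y) x = sinh_int f x - sinh_int g x"
proof -
  have c: "continuous_on {0..x} f" "continuous_on {0..x} g" using f g x by (auto elim: continuous_on_subset)
  show "cosh_int (\<lambda>y. f y - g y) x = cosh_int f x - cosh_int g x"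
    unfolding cosh_int_def right_diff_distrib
    by (intro Henstock_Kurzweil_Integration.integral_diff integrable_continuous_real continuous_intros c)
  show "sinh_int (\<lambda>y. f y - g y) x = sinh_int f x - sinh_int g x"
    unfolding sinh_int_def right_diff_distrib
    by (intro Henstock_Kurzweil_Integration.integral_diff integrable_continuous_real continuous_intros c)
qed

context star_network begin

lemma A_add:
  assumes u: "u \<in> H1e N l" and v: "v \<in> H1e N l"
  shows "A (u + v) = A u + A v"
proof (rule H1e_eqI[OF lpos A_H1e[OF H1e_add[OF lpos u v]] H1e_add[OF lpos A_H1e[OF u] A_H1e[OF v]]])
  fix f assume f: "f \<in> H1e N l"
  note p = dx_is_primitive[OF lpos]
  have s: "is_primitive (l j) ((u + v) j) (\<lambda>x. dx l u j x + dx l v j x)" if "j \<in> {1..N}" for j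
    using is_primitive_add[OF p[OF u that] p[OF v that]] by (simp add: plus_fun_def)
  have e: "(LINT x|interval_measure (l j). (dx l u j x + dx l v j x) * cnj (f j x)) =
     (LINT x|interval_measure (l j). dx l u j x * cnj (f j x)) + (LINT x|interval_measure (l j). dx l v j x * cnj (f j x))"
    if j: "j \<in> {1..N}" for j
    unfolding distrib_right
    by (intro Bochner_Integration.integral_add L2_mult_integrable is_primitive_L2[OF p[OF u j]]
        is_primitive_L2[OF p[OF v j]] L2_cnj is_primitive_in_L2[OF p[OF f j]])
  have s4: "(\<Sum>j=1..N. LINT x|interval_measure (l j). (dx l u j x + dx l v j x) * cnj (f j x)) =
     (\<Sum>j=1..N. LINT x|interval_measure (l j). dx l u j x * cnj (f j x)) +
     (\<Sum>j=1..N. LINT x|interval_measure (l j). dx l v j x * cnj (f j x))"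
    unfolding sum.distrib[symmetric] by (intro sum.cong refl e)
  have s1: "H1_inner N l (A (u + v)) f =
     - (\<Sum>j=1..N. LINT x|interval_measure (l j). (dx l u j x + dx l v j x) * cnj (f j x))
     - of_real \<alpha> * (u + v) 1 0 * cnj (f 1 0)"
    by (rule A_variational[OF H1e_add[OF lpos u v] f s])
  have s2: "H1_inner N l (A u) f = - (\<Sum>j=1..N. LINT x|interval_measure (l j). dx l u j x * cnj (f j x))
     - of_real \<alpha> * u 1 0 * cnj (f 1 0)"
    by (rule A_variational[OF u f p[OF u]])
  have s3: "H1_inner N l (A v) f = - (\<Sum>j=1..N. LINT x|interval_measure (l j). dx l v j x * cnj (f j x))
     - of_real \<alpha> * v 1 0 * cnj (f 1 0)"
    by (rule A_variational[OF v f p[OF v]])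
  show "H1_inner N l (A (u + v)) f = H1_inner N l (A u + A v) f"
    unfolding H1_inner_add[OF lpos A_H1e[OF u] A_H1e[OF v] f] s1 s2 s3 s4
    by (simp add: distrib_left distrib_right)
qed

lemma A_cscale:
  assumes u: "u \<in> H1e N l"
  shows "A (cscale c u) = cscale c (A u)"
proof (rule H1e_eqI[OF lpos A_H1e[OF H1e_cscale[OF lpos u]] H1e_cscale[OF lpos A_H1e[OF u]]])
  fix f assume f: "f \<in> H1e N l"
  note p = dx_is_primitive[OF lpos]
  have s: "is_primitive (l j) (cscale c u j) (\<lambda>x. c * dx l u j x)" if "j \<in> {1..N}" for j
    using is_primitive_cmult[OF p[OF u that]] by (simp add: cscale_def)
  have "H1_inner N l (A (cscale c u)) f = - (\<Sum>j=1..N. LINT x|interval_measure (l j). c * dx l u j x * cnj (f j x))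
    - of_real \<alpha> * cscale c u 1 0 * cnj (f 1 0)"
    by (rule A_variational[OF H1e_cscale[OF lpos u] f s])
  also have "\<dots> = c * (- (\<Sum>j=1..N. LINT x|interval_measure (l j). dx l u j x * cnj (f j x))
    - of_real \<alpha> * u 1 0 * cnj (f 1 0))"
    by (simp add: mult.assoc sum_distrib_left right_diff_distrib cscale_def mult.left_commute)
  also have "\<dots> = c * H1_inner N l (A u) f"
    by (subst A_variational[OF u f p[OF u]]) auto
  also have "\<dots> = H1_inner N l (cscale c (A u)) f"
    by (rule H1_inner_cscale[OF lpos A_H1e[OF u] f, symmetric])
  finally show "H1_inner N l (A (cscale c u)) f = H1_inner N l (cscale c (A u)) f" .
qed

text \<open>On each edge \<open>2 Re (u' \<cdot> cnj u)\<close> is the derivative of \<open>|u|\<^sup>2\<close>, which contributes \<open>|u\<^sub>1(0)|\<^sup>2 / 2\<close>; the flux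
contributes \<open>- \<alpha> |u\<^sub>1(0)|\<^sup>2\<close>.\<close>

lemma A_energy:
  assumes u: "u \<in> H1e N l"
  shows "H1_ip N l (A u) u = - (\<alpha> - real N / 2) * (cmod (u 1 0))\<^sup>2"
proof -
  note p = dx_is_primitive[OF lpos u]
  let ?I = "\<lambda>j. LINT x|interval_measure (l j). dx l u j x * cnj (u j x)"
  have "Re (?I j) = - (cmod (u 1 0))\<^sup>2 / 2" if j: "j \<in> {1..N}" for j
  proof -
    have "(LINT x|interval_measure (l j). u j x * cnj (dx l u j x)) + ?I j
        = u j (l j) * cnj (u j (l j)) - u j 0 * cnj (u j 0)"
      by (rule integration_by_parts_primitive[OF p[OF j] is_primitive_cnj[OF p[OF j]] edge_pos[OF j]])
    moreover have "(LINT x|interval_measure (l j). u j x * cnj (dx l u j x)) = cnj (?I j)"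
      using Bochner_Integration.integral_cnj[of "interval_measure (l j)" "\<lambda>x. dx l u j x * cnj (u j x)"]
      by (simp add: mult.commute)
    ultimately have "cnj (?I j) + ?I j = - (u 1 0 * cnj (u 1 0))"
      unfolding H1e_H1(2,3)[OF u j] by simp
    then have "Re (cnj (?I j) + ?I j) = Re (- (u 1 0 * cnj (u 1 0)))" by (rule arg_cong)
    then have "2 * Re (?I j) = - (cmod (u 1 0))\<^sup>2"
      unfolding complex_norm_square[symmetric] by simp
    then show ?thesis by simp
  qed
  then have "Re (\<Sum>j=1..N. ?I j) = - real N * (cmod (u 1 0))\<^sup>2 / 2" by simp
  moreover have E: "H1_inner N l (A u) u = - (\<Sum>j=1..N. ?I j) - of_real \<alpha> * u 1 0 * cnj (u 1 0)"
    by (rule A_variational[OF u u p])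
  have "H1_ip N l (A u) u = - Re (\<Sum>j=1..N. ?I j) - Re (of_real \<alpha> * u 1 0 * cnj (u 1 0))"
    unfolding H1_ip_def E by (simp only: minus_complex.simps uminus_complex.simps)
  moreover have "Re (of_real \<alpha> * u 1 0 * cnj (u 1 0)) = \<alpha> * (cmod (u 1 0))\<^sup>2"
    unfolding mult.assoc complex_norm_square[symmetric] by simp
  ultimately show ?thesis by (simp only:) (simp add: left_diff_distrib)
qed

lemma H1_ip_self:
  assumes u: "u \<in> H1e N l" and g: "\<And>j. j \<in> {1..N} \<Longrightarrow> is_primitive (l j) (u j) (g j)"
  shows "H1_ip N l u u = (\<Sum>j=1..N. sqnorm (l j) (u j) + sqnorm (l j) (g j))"
  using H1_inner_self[OF lpos u g] by (simp add: H1_ip_def del: of_real_sum)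

lemma sqnorm_dx_le:
  assumes u: "u \<in> H1e N l" and j: "j \<in> {1..N}"
  shows "sqnorm (l j) (dx l u j) \<le> H1_ip N l u u"
proof -
  have "sqnorm (l j) (dx l u j) \<le> sqnorm (l j) (u j) + sqnorm (l j) (dx l u j)"
    using sqnorm_nonneg[of "l j" "u j"] by simp
  also have "\<dots> \<le> (\<Sum>j=1..N. sqnorm (l j) (u j) + sqnorm (l j) (dx l u j))"
    by (rule member_le_sum[OF j]) (auto intro: add_nonneg_nonneg sqnorm_nonneg)
  also have "\<dots> = H1_ip N l u u" by (rule H1_ip_self[OF u dx_is_primitive[OF lpos u], symmetric])
  finally show ?thesis .
qed

lemma bvp_sol_diff:
  assumes u: "continuous_network u" and v: "continuous_network v"
  shows "bvp_sol (u - v) (\<beta> - \<gamma>) = bvp_sol u \<beta> - bvp_sol v \<gamma>"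
proof -
  have c: "continuous_on {0..l j} (u j)" "continuous_on {0..l j} (v j)" if "j \<in> {1..N}" for j
    using u v that by (auto simp: continuous_network_def)
  have d: "(u - v) j = (\<lambda>y. u j y - v j y)" for j by (simp add: fun_eq_iff)
  have i: "cosh_int ((u - v) j) x = cosh_int (u j) x - cosh_int (v j) x"
      "sinh_int ((u - v) j) x = sinh_int (u j) x - sinh_int (v j) x" if "j \<in> {1..N}" "x \<in> {0..l j}" for j x
    unfolding d by (rule cosh_sinh_int_diff[OF c[OF that(1)] that(2)])+
  have S: "complex_of_real coth_sum \<noteq> 0" using coth_sum_pos by simp
  have end_in: "l j \<in> {0..l j}" if "j \<in> {1..N}" for j using edge_pos[OF that] by simp
  have "(\<Sum>j=1..N. sinh_int ((u - v) j) (l j) - of_real (coth_end j) * cosh_int ((u - v) j) (l j))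
     = (\<Sum>j=1..N. (sinh_int (u j) (l j) - of_real (coth_end j) * cosh_int (u j) (l j))
         - (sinh_int (v j) (l j) - of_real (coth_end j) * cosh_int (v j) (l j)))"
    by (intro sum.cong refl) (simp only: i end_in right_diff_distrib, simp)
  then have a: "node_value (u - v) (\<beta> - \<gamma>) = node_value u \<beta> - node_value v \<gamma>"
    unfolding node_value_def sum_subtractf by (simp add: diff_divide_distrib[symmetric] algebra_simps)
  have b: "slope_coeff (u - v) (\<beta> - \<gamma>) j = slope_coeff u \<beta> j - slope_coeff v \<gamma> j" if "j \<in> {1..N}" for j
    unfolding slope_coeff_def a i(1)[OF that end_in[OF that]] i(2)[OF that end_in[OF that]]
    by (simp add: algebra_simps)
  show ?thesis
  proof (intro ext)
    fix j x
    show "bvp_sol (u - v) (\<beta> - \<gamma>) j x = (bvp_sol u \<beta> - bvp_sol v \<gamma>) j x"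
    proof (cases "j \<in> {1..N} \<and> x \<in> {0..l j}")
      case True
      then have j: "j \<in> {1..N}" and x: "x \<in> {0..l j}" by auto
      show ?thesis
        using j x unfolding fun_diff_def[of "bvp_sol u \<beta>"] fun_diff_def[of "bvp_sol u \<beta> j"] bvp_sol_def edge_sol_def
          i(1)[OF j x] i(2)[OF j x] a b[OF j] by (simp add: algebra_simps)
    qed (auto simp: bvp_sol_def)
  qed
qed

lemma continuous_network_diff:
  assumes u: "continuous_network u" and v: "continuous_network v"
  shows "continuous_network (u - v)"
  unfolding continuous_network_def
proof (intro ballI conjI)
  fix j assume j: "j \<in> {1..N}"
  have "continuous_on {0..l j} (\<lambda>x. u j x - v j x)"
    using u v j unfolding continuous_network_def by (intro continuous_on_diff) blast+
  then show "continuous_on {0..l j} ((u - v) j)" by (simp add: fun_diff_def)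
  have "u j 0 = u 1 0" "v j 0 = v 1 0" using u v j unfolding continuous_network_def by blast+
  then show "(u - v) j 0 = (u - v) 1 0" by simp
qed

text \<open>Only values and integrals of \<open>u\<close> enter the formulas for the solution and its derivative, so the uniform
norm of \<open>u\<close> controls \<open>A u\<close> together with its first derivative.\<close>

lemma A_sup_bound:
  "\<exists>C\<ge>0. \<forall>u d. continuous_network u \<longrightarrow> (\<forall>j\<in>{1..N}. \<forall>x\<in>{0..l j}. cmod (u j x) \<le> d) \<longrightarrow>
     (\<forall>j\<in>{1..N}. \<forall>x\<in>{0..l j}. cmod (A u j x) \<le> C * d \<and> cmod (bvp_deriv u (of_real \<alpha> * u 1 0) j x) \<le> C * d)"
proof -
  define P where "P = (\<Sum>j=1..N. cosh (l j) * l j)"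
  define D where "D = (\<Sum>j=1..N. cosh (l j))"
  define CA where "CA = (real N + (real N * P + coth_sum * P) + \<bar>\<alpha>\<bar>) / coth_sum"
  define CB where "CB = P + coth_sum * (P + CA)"
  define C where "C = 1 + D * (P + CA) + D * (P + CB)"
  have Pj: "cosh (l j) * l j \<le> P" if "j \<in> {1..N}" for j
    unfolding P_def using that edge_pos by (intro member_le_sum) (auto intro!: mult_nonneg_nonneg less_imp_le)
  have Dj: "cosh (l j) \<le> D" if "j \<in> {1..N}" for j
    unfolding D_def using that by (intro member_le_sum) auto
  have cthj: "coth_end j \<le> coth_sum" if "j \<in> {1..N}" for j
    unfolding coth_sum_def using that coth_end_pos by (intro member_le_sum) (auto intro: less_imp_le)
  have P0: "P \<ge> 0" unfolding P_def using edge_pos by (intro sum_nonneg mult_nonneg_nonneg) (auto intro: less_imp_le)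
  have D0: "D \<ge> 0" unfolding D_def by (intro sum_nonneg) auto
  have S0: "coth_sum > 0" by (rule coth_sum_pos)
  have CA0: "CA \<ge> 0" unfolding CA_def using P0 S0 by (intro divide_nonneg_pos add_nonneg_nonneg mult_nonneg_nonneg) auto
  have CB0: "CB \<ge> 0" unfolding CB_def using P0 S0 CA0 by (intro add_nonneg_nonneg mult_nonneg_nonneg) auto
  have C0: "C \<ge> 0" unfolding C_def using P0 D0 CA0 CB0 by (intro add_nonneg_nonneg mult_nonneg_nonneg) auto
  show ?thesis
  proof (intro exI[of _ C] conjI C0 allI impI)
    fix u d assume nw: "continuous_network u" and ud: "\<forall>j\<in>{1..N}. \<forall>x\<in>{0..l j}. cmod (u j x) \<le> d"
    let ?\<beta> = "of_real \<alpha> * u 1 0"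
    have c: "continuous_on {0..l j} (u j)" if "j \<in> {1..N}" for j
      using nw that by (auto simp: continuous_network_def)
    have u0: "cmod (u 1 0) \<le> d" using ud one_in edge_pos[OF one_in] by auto
    have d0: "d \<ge> 0" using u0 norm_ge_zero order_trans by blast
    have int: "cmod (cosh_int (u j) x) \<le> P * d" "cmod (sinh_int (u j) x) \<le> P * d"
      if j: "j \<in> {1..N}" and x: "x \<in> {0..l j}" for j x
      using cosh_sinh_int_bound[OF c[OF j] _ x, of d] ud j mult_right_mono[OF Pj[OF j] d0] by (auto intro: order_trans)
    have end_in: "l j \<in> {0..l j}" if "j \<in> {1..N}" for j using edge_pos[OF that] by simp
    have sum_b: "cmod (\<Sum>j=1..N. sinh_int (u j) (l j) - of_real (coth_end j) * cosh_int (u j) (l j)) \<le> real N * (P * d) + coth_sum * (P * d)"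
    proof -
      have "cmod (\<Sum>j=1..N. sinh_int (u j) (l j) - of_real (coth_end j) * cosh_int (u j) (l j))
         \<le> (\<Sum>j=1..N. P * d + coth_end j * (P * d))"
      proof (rule sum_norm_le)
        fix j assume j: "j \<in> {1..N}"
        have "cmod (sinh_int (u j) (l j) - of_real (coth_end j) * cosh_int (u j) (l j))
          \<le> cmod (sinh_int (u j) (l j)) + coth_end j * cmod (cosh_int (u j) (l j))"
          using norm_triangle_ineq4[of "sinh_int (u j) (l j)" "of_real (coth_end j) * cosh_int (u j) (l j)"] coth_end_pos[OF j]
          by (simp add: norm_mult)
        also have "\<dots> \<le> P * d + coth_end j * (P * d)"
          using int[OF j end_in[OF j]] coth_end_pos[OF j] by (intro add_mono mult_left_mono) auto
        finally show "cmod (sinh_int (u j) (l j) - of_real (coth_end j) * cosh_int (u j) (l j)) \<le> P * d + coth_end j * (P * d)" .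
      qed
      also have "\<dots> = real N * (P * d) + coth_sum * (P * d)"
        by (simp add: sum.distrib coth_sum_def sum_distrib_right)
      finally show ?thesis .
    qed
    have a: "cmod (node_value u ?\<beta>) \<le> CA * d"
    proof -
      have "cmod (of_nat N * u 1 0 + (\<Sum>j=1..N. sinh_int (u j) (l j) - of_real (coth_end j) * cosh_int (u j) (l j)) - ?\<beta>)
         \<le> cmod (of_nat N * u 1 0) + cmod (\<Sum>j=1..N. sinh_int (u j) (l j) - of_real (coth_end j) * cosh_int (u j) (l j)) + cmod ?\<beta>"
        by (intro order_trans[OF norm_triangle_ineq4] add_right_mono norm_triangle_ineq)
      also have "\<dots> \<le> real N * d + (real N * (P * d) + coth_sum * (P * d)) + \<bar>\<alpha>\<bar> * d"
        using u0 by (intro add_mono sum_b) (auto simp: norm_mult intro: mult_left_mono)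
      also have "\<dots> = (CA * coth_sum) * d" using S0 by (simp add: CA_def) (simp add: algebra_simps)
      also have "\<dots> = CA * d * coth_sum" by simp
      finally have "cmod (of_nat N * u 1 0 + (\<Sum>j=1..N. sinh_int (u j) (l j) - of_real (coth_end j) * cosh_int (u j) (l j)) - ?\<beta>)
         \<le> CA * d * coth_sum" .
      then show ?thesis unfolding node_value_def norm_divide using S0 by (simp add: pos_divide_le_eq)
    qed
    have b: "cmod (slope_coeff u ?\<beta> j) \<le> CB * d" if j: "j \<in> {1..N}" for j
    proof -
      have "cmod (slope_coeff u ?\<beta> j) \<le> cmod (sinh_int (u j) (l j)) + coth_end j * cmod (cosh_int (u j) (l j) + node_value u ?\<beta>)"
        unfolding slope_coeff_def using coth_end_pos[OF j]
          norm_triangle_ineq4[of "sinh_int (u j) (l j)" "of_real (coth_end j) * (cosh_int (u j) (l j) + node_value u ?\<beta>)"]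
        by (simp add: norm_mult)
      also have "\<dots> \<le> P * d + coth_sum * (P * d + CA * d)"
        using int[OF j end_in[OF j]] coth_end_pos[OF j] cthj[OF j] a
        by (intro add_mono mult_mono order_trans[OF norm_triangle_ineq]) auto
      also have "\<dots> = CB * d" by (simp add: CB_def algebra_simps)
      finally show ?thesis .
    qed
    have hyp: "\<bar>cosh x\<bar> \<le> D" "\<bar>sinh x\<bar> \<le> D" if j: "j \<in> {1..N}" and x: "x \<in> {0..l j}" for j x
    proof -
      have "cosh x \<le> D" using cosh_le_cosh[of x "l j"] x Dj[OF j] by auto
      then show "\<bar>cosh x\<bar> \<le> D" "\<bar>sinh x\<bar> \<le> D"
        using sinh_le_cosh_real[of x] cosh_real_pos[of x] x by (auto simp: abs_if simp del: cosh_real_pos)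
    qed
    have comb: "cmod (of_real s * (cosh_int (u j) x + node_value u ?\<beta>) - of_real t * (sinh_int (u j) x - slope_coeff u ?\<beta> j))
        \<le> (D * (P + CA) + D * (P + CB)) * d"
      if j: "j \<in> {1..N}" and x: "x \<in> {0..l j}" and st: "\<bar>s\<bar> \<le> D" "\<bar>t\<bar> \<le> D" for j x s t
    proof -
      have "cmod (of_real s * (cosh_int (u j) x + node_value u ?\<beta>) - of_real t * (sinh_int (u j) x - slope_coeff u ?\<beta> j))
        \<le> \<bar>s\<bar> * cmod (cosh_int (u j) x + node_value u ?\<beta>) + \<bar>t\<bar> * cmod (sinh_int (u j) x - slope_coeff u ?\<beta> j)"
        using norm_triangle_ineq4[of "of_real s * (cosh_int (u j) x + node_value u ?\<beta>)" "of_real t * (sinh_int (u j) x - slope_coeff u ?\<beta> j)"]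
        by (simp add: norm_mult)
      also have "\<dots> \<le> D * (P * d + CA * d) + D * (P * d + CB * d)"
        using st D0 int[OF j x] a b[OF j]
        by (intro add_mono mult_mono order_trans[OF norm_triangle_ineq] order_trans[OF norm_triangle_ineq4]) auto
      finally show ?thesis by (simp add: algebra_simps)
    qed
    show "\<forall>j\<in>{1..N}. \<forall>x\<in>{0..l j}. cmod (A u j x) \<le> C * d \<and> cmod (bvp_deriv u ?\<beta> j x) \<le> C * d"
    proof (intro ballI conjI)
      fix j x assume j: "j \<in> {1..N}" and x: "x \<in> {0..l j}"
      have "cmod (A u j x) \<le> (D * (P + CA) + D * (P + CB)) * d"
        using comb[OF j x hyp[OF j x]] j x by (simp add: A_def bvp_sol_def edge_sol_def)
      also have "\<dots> \<le> C * d" using d0 by (intro mult_right_mono) (auto simp: C_def)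
      finally show "cmod (A u j x) \<le> C * d" .
      have "bvp_deriv u ?\<beta> j x = u j x + (of_real (sinh x) * (cosh_int (u j) x + node_value u ?\<beta>) - of_real (cosh x) * (sinh_int (u j) x - slope_coeff u ?\<beta> j))"
        by (simp add: bvp_deriv_def edge_deriv_def)
      then have "cmod (bvp_deriv u ?\<beta> j x) \<le> cmod (u j x) + cmod (of_real (sinh x) * (cosh_int (u j) x + node_value u ?\<beta>) - of_real (cosh x) * (sinh_int (u j) x - slope_coeff u ?\<beta> j))"
        by (simp only: norm_triangle_ineq)
      also have "\<dots> \<le> d + (D * (P + CA) + D * (P + CB)) * d"
        using ud j x by (intro add_mono comb[OF j x hyp(2,1)[OF j x]]) auto
      also have "\<dots> = C * d" by (simp add: C_def algebra_simps)
      finally show "cmod (bvp_deriv u ?\<beta> j x) \<le> C * d" .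
    qed
  qed
qed

lemma sqnorm_bound:
  assumes "L > 0" "f \<in> L2 L" "\<And>x. x \<in> {0..L} \<Longrightarrow> cmod (f x) \<le> B"
  shows "sqnorm L f \<le> B\<^sup>2 * L"
proof -
  have "sqnorm L f \<le> (LINT x|interval_measure L. B\<^sup>2)"
    unfolding sqnorm_def
  proof (rule integral_mono[OF L2_sq_integrable[OF assms(2)]])
    show "integrable (interval_measure L) (\<lambda>x. B\<^sup>2)"
      by (rule LINT_eq_integral_continuous(1)) (rule continuous_on_const)
    show "(cmod (f x))\<^sup>2 \<le> B\<^sup>2" if "x \<in> space (interval_measure L)" for x
      using that by (intro power_mono assms(3)) auto
  qed
  also have "\<dots> = B\<^sup>2 * L"
    using LINT_eq_integral_continuous(2)[of L "\<lambda>_. B\<^sup>2"] assms(1) by simp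
  finally show ?thesis .
qed

text \<open>Bounded derivatives in the mean make the functions equicontinuous by \<open>primitive_Holder\<close>, and bounded
since they vanish at the outer end. The subsequence is refined from edge to edge.\<close>

lemma Arzela_Ascoli_network:
  fixes X :: "nat \<Rightarrow> network_fun"
  assumes X: "\<And>n. X n \<in> H1e N l" and B: "\<And>n j. j \<in> {1..N} \<Longrightarrow> sqnorm (l j) (dx l (X n) j) \<le> B"
  shows "k \<le> N \<Longrightarrow> \<exists>(r::nat \<Rightarrow> nat) U. strict_mono r \<and> (\<forall>j\<in>{1..k}. continuous_on {0..l j} (U j) \<and>
    uniform_limit {0..l j} (\<lambda>n. X (r n) j) (U j) sequentially)"
proof (induction k)
  case 0
  show ?case by (intro exI[of _ id]) (auto simp: strict_mono_def)
next
  case (Suc k)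
  have "\<exists>(r::nat \<Rightarrow> nat) U. strict_mono r \<and> (\<forall>j\<in>{1..k}. continuous_on {0..l j} (U j) \<and>
    uniform_limit {0..l j} (\<lambda>n. X (r n) j) (U j) sequentially)"
    using Suc by simp
  then obtain r :: "nat \<Rightarrow> nat" and U where r: "strict_mono r"
    and U_all: "\<forall>j\<in>{1..k}. continuous_on {0..l j} (U j) \<and>
      uniform_limit {0..l j} (\<lambda>n. X (r n) j) (U j) sequentially" by (elim exE conjE)
  have U: "continuous_on {0..l j} (U j)" "uniform_limit {0..l j} (\<lambda>n. X (r n) j) (U j) sequentially"
    if "j \<in> {1..k}" for j using U_all that by blast+
  let ?j = "Suc k"
  have j: "?j \<in> {1..N}" using Suc by auto
  have B0: "B \<ge> 0" using B[OF j, of 0] sqnorm_nonneg order_trans by blast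
  note p = dx_is_primitive[OF lpos X j]
  have Hol: "cmod (X n ?j x - X n ?j y) \<le> sqrt \<bar>x - y\<bar> * sqrt B" if "x \<in> {0..l ?j}" "y \<in> {0..l ?j}" for n x y
  proof -
    have "cmod (X n ?j x - X n ?j y) \<le> sqrt \<bar>x - y\<bar> * sqrt (sqnorm (l ?j) (dx l (X n) ?j))"
      by (rule primitive_Holder_abs[OF p that])
    also have "\<dots> \<le> sqrt \<bar>x - y\<bar> * sqrt B" using B[OF j] by (intro mult_left_mono) auto
    finally show ?thesis .
  qed
  have "\<exists>g (k' :: nat \<Rightarrow> nat). continuous_on {0..l ?j} g \<and> strict_mono k' \<and>
    (\<forall>e>0. \<exists>K. \<forall>n x. n \<ge> K \<and> x \<in> {0..l ?j} \<longrightarrow> norm (X (r (k' n)) ?j x - g x) < e)"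
  proof (rule Arzela_Ascoli[of "{0..l ?j}" "\<lambda>n. X (r n) ?j" "sqrt (l ?j) * sqrt B"])
    show "compact {0..l ?j}" by simp
    show "norm (X (r n) ?j x) \<le> sqrt (l ?j) * sqrt B" if x: "x \<in> {0..l ?j}" for n x
    proof -
      have "cmod (X (r n) ?j x - X (r n) ?j (l ?j)) \<le> sqrt \<bar>x - l ?j\<bar> * sqrt B"
        using x edge_pos[OF j] by (intro Hol) auto
      also have "\<dots> \<le> sqrt (l ?j) * sqrt B" using x B0 by (intro mult_right_mono) auto
      finally show ?thesis using H1e_H1(2)[OF X j] by simp
    qed
    fix x e assume x: "x \<in> {0..l ?j}" and e: "(0::real) < e"
    \<comment> \<open>The functions are uniformly Hoelder continuous with exponent one half.\<close>
    define d where "d = (e / (sqrt B + 1))\<^sup>2"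
    have d0: "d > 0" using e B0 unfolding d_def by (intro zero_less_power divide_pos_pos add_nonneg_pos) auto
    have "norm (X (r n) ?j x - X (r n) ?j y) < e" if y: "y \<in> {0..l ?j}" "norm (x - y) < d" for n y
    proof -
      have "sqrt \<bar>x - y\<bar> < sqrt d" using y(2) by simp
      also have "sqrt d = e / (sqrt B + 1)" using e B0 by (simp add: d_def)
      finally have "sqrt \<bar>x - y\<bar> * (sqrt B + 1) < e" using B0 by (simp add: pos_less_divide_eq add_nonneg_pos)
      moreover have "sqrt \<bar>x - y\<bar> * sqrt B \<le> sqrt \<bar>x - y\<bar> * (sqrt B + 1)" by (intro mult_left_mono) auto
      ultimately show ?thesis using Hol[OF x y(1), of "r n"] by linarith
    qed
    then show "\<exists>d. 0 < d \<and> (\<forall>n y. y \<in> {0..l ?j} \<and> norm (x - y) < d \<longrightarrow> norm (X (r n) ?j x - X (r n) ?j y) < e)"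
      using d0 by blast
  next
    fix g and k' :: "nat \<Rightarrow> nat"
    assume "continuous_on {0..l ?j} g" "strict_mono k'"
      "\<And>e. 0 < e \<Longrightarrow> \<exists>K. \<forall>n x. n \<ge> K \<and> x \<in> {0..l ?j} \<longrightarrow> norm (X (r (k' n)) ?j x - g x) < e"
    then show "\<exists>g (k' :: nat \<Rightarrow> nat). continuous_on {0..l ?j} g \<and> strict_mono k' \<and>
      (\<forall>e>0. \<exists>K. \<forall>n x. n \<ge> K \<and> x \<in> {0..l ?j} \<longrightarrow> norm (X (r (k' n)) ?j x - g x) < e)"
      by blast
  qed
  then obtain g and k' :: "nat \<Rightarrow> nat" where g: "continuous_on {0..l ?j} g" and k': "strict_mono k'"
    and lim: "\<forall>e>0. \<exists>K. \<forall>n x. n \<ge> K \<and> x \<in> {0..l ?j} \<longrightarrow> norm (X (r (k' n)) ?j x - g x) < e"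
    by (elim exE conjE)
  define U' where "U' = U(?j := g)"
  have ul: "uniform_limit {0..l ?j} (\<lambda>n. X (r (k' n)) ?j) g sequentially"
    unfolding uniform_limit_sequentially_iff dist_norm using lim by blast
  have "continuous_on {0..l j} (U' j) \<and> uniform_limit {0..l j} (\<lambda>n. X ((r \<circ> k') n) j) (U' j) sequentially"
    if "j \<in> {1..Suc k}" for j
  proof (cases "j = ?j")
    case True
    then show ?thesis using g ul by (simp add: U'_def)
  next
    case False
    then have jk: "j \<in> {1..k}" using that by auto
    have "uniform_limit {0..l j} (\<lambda>n. X (r (k' n)) j) (U j) sequentially"
      using filterlim_compose[OF U(2)[OF jk] filterlim_subseq[OF k']] by simp
    then show ?thesis using U(1)[OF jk] False by (simp add: U'_def)
  qed
  moreover have "strict_mono (r \<circ> k')" using r k' by (rule strict_mono_o)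
  ultimately show ?case by blast
qed

text \<open>A bounded sequence has a subsequence that converges uniformly to some \<open>U\<close>, which need not belong to
the energy space. By \<open>A_sup_bound\<close> the images converge in the energy norm to \<open>A U\<close>, and this limit does
belong to the space.\<close>

lemma A_compact:
  fixes X :: "nat \<Rightarrow> network_fun"
  assumes X: "\<And>n. X n \<in> H1e N l" and M: "\<And>n. H1_ip N l (X n) (X n) \<le> M"
  shows "\<exists>(r::nat \<Rightarrow> nat) y. strict_mono r \<and> y \<in> H1e N l \<and> (\<lambda>n. H1_ip N l (A (X (r n)) - y) (A (X (r n)) - y)) \<longlonglongrightarrow> 0"
proof -
  have B: "sqnorm (l j) (dx l (X n) j) \<le> M" if "j \<in> {1..N}" for n j
    using sqnorm_dx_le[OF X that] M order_trans by blast
  have "\<exists>(r::nat \<Rightarrow> nat) U. strict_mono r \<and> (\<forall>j\<in>{1..N}. continuous_on {0..l j} (U j) \<and>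
    uniform_limit {0..l j} (\<lambda>n. X (r n) j) (U j) sequentially)"
    by (rule Arzela_Ascoli_network[OF X B order_refl])
  then obtain r :: "nat \<Rightarrow> nat" and U where r: "strict_mono r"
    and U_all: "\<forall>j\<in>{1..N}. continuous_on {0..l j} (U j) \<and>
      uniform_limit {0..l j} (\<lambda>n. X (r n) j) (U j) sequentially" by (elim exE conjE)
  have U: "continuous_on {0..l j} (U j)" "uniform_limit {0..l j} (\<lambda>n. X (r n) j) (U j) sequentially"
    if "j \<in> {1..N}" for j using U_all that by blast+
  have admX: "continuous_network (X n)" for n by (rule continuous_network_H1e[OF X])
  have pt: "(\<lambda>n. X (r n) j x) \<longlonglongrightarrow> U j x" if "j \<in> {1..N}" "x \<in> {0..l j}" for j x
    by (rule tendsto_uniform_limitI[OF U(2)[OF that(1)] that(2)])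
  have admU: "continuous_network U"
    unfolding continuous_network_def
  proof (intro ballI conjI U(1))
    fix j assume j: "j \<in> {1..N}"
    have lim: "(\<lambda>n. X (r n) j 0) \<longlonglongrightarrow> U j 0" "(\<lambda>n. X (r n) 1 0) \<longlonglongrightarrow> U 1 0"
      using pt[OF j, of 0] pt[OF one_in, of 0] edge_pos[OF j] edge_pos[OF one_in] by auto
    show "U j 0 = U 1 0" by (rule LIMSEQ_unique[OF lim(1)[unfolded H1e_H1(3)[OF X j]] lim(2)])
  qed
  obtain C where C: "C \<ge> 0" "\<And>u d. continuous_network u \<Longrightarrow> (\<And>j x. j \<in> {1..N} \<Longrightarrow> x \<in> {0..l j} \<Longrightarrow> cmod (u j x) \<le> d) \<Longrightarrow>
     (\<forall>j\<in>{1..N}. \<forall>x\<in>{0..l j}. cmod (A u j x) \<le> C * d \<and> cmod (bvp_deriv u (of_real \<alpha> * u 1 0) j x) \<le> C * d)"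
    using A_sup_bound by metis
  have AU: "A U \<in> H1e N l" unfolding A_def by (rule bvp_sol_H1e[OF admU])
  define W where "W n = X (r n) - U" for n
  have admW: "continuous_network (W n)" for n unfolding W_def by (rule continuous_network_diff[OF admX admU])
  have AW: "A (X (r n)) - A U = A (W n)" for n
    unfolding A_def W_def using bvp_sol_diff[OF admX admU] by (simp add: right_diff_distrib)
  define S where "S = (\<Sum>j=1..N. 2 * l j)"
  have bound: "H1_ip N l (A (W n)) (A (W n)) \<le> (C * d)\<^sup>2 * S"
    if d: "\<And>j x. j \<in> {1..N} \<Longrightarrow> x \<in> {0..l j} \<Longrightarrow> cmod (W n j x) \<le> d" for n d
  proof -
    let ?\<beta> = "of_real \<alpha> * W n 1 0"
    have H: "A (W n) \<in> H1e N l" unfolding A_def by (rule bvp_sol_H1e[OF admW])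
    have p: "is_primitive (l j) (A (W n) j) (bvp_deriv (W n) ?\<beta> j)" if "j \<in> {1..N}" for j
      unfolding A_def by (rule bvp_sol_primitive(1)[OF admW that])
    have "H1_ip N l (A (W n)) (A (W n)) = (\<Sum>j=1..N. sqnorm (l j) (A (W n) j) + sqnorm (l j) (bvp_deriv (W n) ?\<beta> j))"
      by (rule H1_ip_self[OF H p])
    also have "\<dots> \<le> (\<Sum>j=1..N. (C * d)\<^sup>2 * l j + (C * d)\<^sup>2 * l j)"
      using C(2)[OF admW d]
      by (intro sum_mono add_mono sqnorm_bound edge_pos is_primitive_in_L2[OF p] is_primitive_L2[OF p]) auto
    also have "\<dots> = (C * d)\<^sup>2 * S" by (simp add: S_def sum_distrib_left mult_ac)
    finally show ?thesis .
  qed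
  have S0: "S \<ge> 0" unfolding S_def using edge_pos by (intro sum_nonneg) (auto intro: less_imp_le)
  have "(\<lambda>n. H1_ip N l (A (W n)) (A (W n))) \<longlonglongrightarrow> 0"
  proof (rule LIMSEQ_I)
    fix e :: real assume e: "e > 0"
    define d where "d = sqrt (e / (2 * (C\<^sup>2 * S + 1)))"
    have CS: "C\<^sup>2 * S \<ge> 0" using S0 by simp
    have d: "d > 0" "d\<^sup>2 = e / (2 * (C\<^sup>2 * S + 1))"
      using e CS by (auto simp: d_def intro!: divide_pos_pos)
    have "\<forall>j\<in>{1..N}. \<forall>\<^sub>F n in sequentially. \<forall>x\<in>{0..l j}. dist (X (r n) j x) (U j x) < d"
      using U(2) d(1) by (auto simp: uniform_limit_iff)
    then have "\<forall>\<^sub>F n in sequentially. \<forall>j\<in>{1..N}. \<forall>x\<in>{0..l j}. dist (X (r n) j x) (U j x) < d"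
      by (intro eventually_ball_finite) auto
    then obtain K where K: "\<And>n. n \<ge> K \<Longrightarrow> \<forall>j\<in>{1..N}. \<forall>x\<in>{0..l j}. dist (X (r n) j x) (U j x) < d"
      by (auto simp: eventually_sequentially)
    show "\<exists>K. \<forall>n\<ge>K. norm (H1_ip N l (A (W n)) (A (W n)) - 0) < e"
    proof (intro exI[of _ K] allI impI)
      fix n assume n: "n \<ge> K"
      have "H1_ip N l (A (W n)) (A (W n)) \<le> (C * d)\<^sup>2 * S"
        by (rule bound) (use K[OF n] in \<open>auto simp: W_def dist_norm intro: less_imp_le\<close>)
      also have "\<dots> = e * (C\<^sup>2 * S / (2 * (C\<^sup>2 * S + 1)))" by (simp add: power_mult_distrib d(2))
      also have "\<dots> < e * 1"
      proof (intro mult_strict_left_mono e)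
        have "c / (2 * (c + 1)) < 1" if "c \<ge> 0" for c :: real
          using that by (simp add: divide_less_eq_1_pos)
        then show "C\<^sup>2 * S / (2 * (C\<^sup>2 * S + 1)) < 1" using CS by blast
      qed
      finally have "H1_ip N l (A (W n)) (A (W n)) < e" by simp
      moreover have "H1_ip N l (A (W n)) (A (W n)) \<ge> 0"
      proof -
        interpret inner_on "H1e N l" "H1_ip N l" by (rule inner_on_H1e[OF lpos])
        show ?thesis unfolding A_def by (rule ip_nonneg[OF bvp_sol_H1e[OF admW]])
      qed
      ultimately show "norm (H1_ip N l (A (W n)) (A (W n)) - 0) < e" by simp
    qed
  qed
  then have "(\<lambda>n. H1_ip N l (A (X (r n)) - A U) (A (X (r n)) - A U)) \<longlonglongrightarrow> 0" unfolding AW .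
  then show ?thesis by (intro exI[of _ r] exI[of _ "A U"] conjI r AU)
qed

sublocale S: compact_dissipative "H1e N l" "H1_ip N l" A
proof -
  interpret inner_on "H1e N l" "H1_ip N l" by (rule inner_on_H1e[OF lpos])
  show "compact_dissipative (H1e N l) (H1_ip N l) A"
  proof
    show "A u \<in> H1e N l" if "u \<in> H1e N l" for u by (rule A_H1e[OF that])
    show "A (u + v) = A u + A v" if "u \<in> H1e N l" "v \<in> H1e N l" for u v by (rule A_add[OF that])
    show "A (c *\<^sub>R u) = c *\<^sub>R A u" if "u \<in> H1e N l" for c u
      unfolding scaleR_eq_cscale by (rule A_cscale[OF that])
    show "H1_ip N l (A u) u \<le> 0" if "u \<in> H1e N l" for u
      unfolding A_energy[OF that] using \<alpha> by (intro mult_nonpos_nonneg) auto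
    fix X :: "nat \<Rightarrow> network_fun" and M assume X: "\<And>n. X n \<in> H1e N l" "\<And>n. nrm (X n) \<le> M"
    have M2: "H1_ip N l (X n) (X n) \<le> M\<^sup>2" for n
      using X power_mono[OF X(2)[of n], of 2] nrm_nonneg[OF X(1)[of n]] by (simp add: nrm_sq)
    have "\<exists>(r::nat \<Rightarrow> nat) y. strict_mono r \<and> y \<in> H1e N l \<and>
      (\<lambda>n. H1_ip N l (A (X (r n)) - y) (A (X (r n)) - y)) \<longlonglongrightarrow> 0"
      by (rule A_compact[OF X(1) M2])
    then obtain r :: "nat \<Rightarrow> nat" and y where r: "strict_mono r" "y \<in> H1e N l"
      "(\<lambda>n. H1_ip N l (A (X (r n)) - y) (A (X (r n)) - y)) \<longlonglongrightarrow> 0" by (elim exE conjE)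
    from tendsto_real_sqrt[OF r(3)] have "tends (\<lambda>n. A (X (r n))) y sequentially"
      by (simp add: tends_def nrm_def)
    then show "\<exists>r y. strict_mono r \<and> y \<in> H1e N l \<and> tends (\<lambda>n. A (X (r n))) y sequentially"
      by (intro exI[of _ r] exI[of _ y] conjI r)
  qed
qed

lemma H1_norm_eq: "H1_norm N l u = S.nrm u"
  by (simp add: H1_norm_def S.nrm_def H1_ip_def)

lemma BBM_solution_iff: "BBM_solution N l \<alpha> u0 u \<longleftrightarrow> S.solution u0 u"
proof -
  have "((\<lambda>s. H1_norm N l (\<lambda>j x. (u s j x - u t j x) / of_real (s - t) - BBM_op N l \<alpha> (u t) j x)) \<longlongrightarrow> 0) (at t within {0..})
    \<longleftrightarrow> S.tends (\<lambda>s. (1 / (s - t)) *\<^sub>R (u s - u t)) (A (u t)) (at t within {0..})" if "u t \<in> H1e N l" for t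
  proof -
    have "(\<lambda>j x. (u s j x - u t j x) / of_real (s - t) - BBM_op N l \<alpha> (u t) j x) = (1 / (s - t)) *\<^sub>R (u s - u t) - A (u t)" for s
      unfolding BBM_op_eq[OF that] by (simp add: fun_eq_iff scaleR_conv_of_real divide_inverse mult.commute)
    then show ?thesis unfolding S.tends_def H1_norm_eq by simp
  qed
  then show ?thesis unfolding BBM_solution_def S.solution_def BBM_domain_eq by blast
qed

lemma BBM_semigroup_eq:
  assumes "u0 \<in> H1e N l" "t \<ge> 0"
  shows "BBM_semigroup N l \<alpha> t u0 = S.flow t u0"
  unfolding BBM_semigroup_def BBM_solution_iff
proof (rule the_equality)
  show "\<exists>u. S.solution u0 u \<and> S.flow t u0 = u t"
    using S.flow_solution[OF assms(1)] by blast
  show "v = S.flow t u0" if "\<exists>u. S.solution u0 u \<and> v = u t" for v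
    using that S.flow_eq assms(2) by metis
qed

lemma strongly_stable_iff:
  "strongly_stable N l \<alpha> \<longleftrightarrow> (\<forall>u0\<in>H1e N l. ((\<lambda>t. S.nrm (S.flow t u0)) \<longlongrightarrow> 0) at_top)"
proof -
  have "((\<lambda>t. H1_norm N l (BBM_semigroup N l \<alpha> t u0)) \<longlongrightarrow> 0) at_top \<longleftrightarrow> ((\<lambda>t. S.nrm (S.flow t u0)) \<longlongrightarrow> 0) at_top"
    if "u0 \<in> H1e N l" for u0
    by (rule tendsto_cong, use eventually_ge_at_top[of "0::real"] in eventually_elim)
       (simp add: BBM_semigroup_eq[OF that] H1_norm_eq)
  then show ?thesis unfolding strongly_stable_def by blast
qed

text \<open>Test functions supported on one edge \<open>j\<close> turn \<open>A (X n) \<longlongrightarrow> 0\<close> into weak convergence to zero of the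
derivatives of \<open>X n j\<close>, first on a dense set and then on all square-integrable functions. The part
of the inner product without derivatives is brought into the same form by a primitive \<open>Y\<close> of
\<open>cnj y\<close>.\<close>

lemma weak_null:
  assumes X: "\<And>n. X n \<in> H1e N l" "\<And>n. S.nrm (X n) \<le> M"
    and AX: "S.tends (\<lambda>n. A (X n)) 0 sequentially" and y: "y \<in> H1e N l"
  shows "(\<lambda>n. H1_ip N l (X n) y) \<longlonglongrightarrow> 0"
proof -
  note p = dx_is_primitive[OF lpos]
  have ip0: "(\<lambda>n. H1_ip N l (A (X n)) f) \<longlonglongrightarrow> 0" if "f \<in> H1e N l" for f
    using S.tends_ip[OF AX _ S.H_zero that] X(1) that by auto
  have inner0: "(\<lambda>n. H1_inner N l (A (X n)) f) \<longlonglongrightarrow> 0" if f: "f \<in> H1e N l" for f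
  proof -
    \<comment> \<open>Only the real part of the inner product is known to converge; testing with \<open>\<i> f\<close> gives the imaginary part.\<close>
    have "H1_inner N l (A (X n)) (cscale \<i> f) = - \<i> * H1_inner N l (A (X n)) f" for n
      using H1_inner_cnj[OF lpos H1e_cscale[OF lpos f, of \<i>] A_H1e[OF X(1)[of n]]]
        H1_inner_cscale[OF lpos f A_H1e[OF X(1)[of n]], of \<i>] H1_inner_cnj[OF lpos f A_H1e[OF X(1)[of n]]]
      by simp
    then have "H1_ip N l (A (X n)) (cscale \<i> f) = Im (H1_inner N l (A (X n)) f)" for n
      by (simp add: H1_ip_def)
    then show ?thesis using ip0[OF f] ip0[OF H1e_cscale[OF lpos f, of \<i>]]
      unfolding tendsto_complex_iff by (simp add: H1_ip_def)
  qed
  have H1null: "(\<lambda>n. LINT x|interval_measure (l j). dx l (X n) j x * f x) \<longlonglongrightarrow> 0"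
    if j: "j \<in> {1..N}" and f: "is_primitive (l j) f f'" "f 0 = 0" "f (l j) = 0" for j f f'
  proof -
    define F where "F = (\<lambda>i x. if i = j \<and> x \<in> {0..l j} then cnj (f x) else 0)"
    have Fp: "is_primitive (l i) (F i) (if i = j then (\<lambda>x. cnj (f' x)) else (\<lambda>x. 0))" if "i \<in> {1..N}" for i
    proof (cases "i = j")
      case True
      have "is_primitive (l j) (F j) (\<lambda>x. cnj (f' x))"
        by (rule is_primitive_cong[OF is_primitive_cnj[OF f(1)] _ L2_cnj[OF is_primitive_L2[OF f(1)]]]) (auto simp: F_def)
      then show ?thesis using True by simp
    next
      case False
      then show ?thesis using is_primitive_const[of "l i" 0] by (simp add: F_def)
    qed
    have F: "F \<in> H1e N l"
    proof (rule H1eI)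
      fix i assume i: "i \<in> {1..N}"
      show "F i \<in> H1 (l i)" by (rule H1I[OF edge_pos[OF i] Fp[OF i]]) (auto simp: F_def)
      show "F i (l i) = 0" "F i 0 = 0" using f by (auto simp: F_def)
    qed (use j in \<open>auto simp: F_def fun_eq_iff\<close>)
    have "H1_inner N l (A (X n)) F = - (LINT x|interval_measure (l j). dx l (X n) j x * f x)" for n
    proof -
      have "H1_inner N l (A (X n)) F = - (\<Sum>i=1..N. LINT x|interval_measure (l i). dx l (X n) i x * cnj (F i x))
        - of_real \<alpha> * X n 1 0 * cnj (F 1 0)"
        by (rule A_variational[OF X(1) F p[OF X(1)]])
      also have "F 1 0 = 0" using f by (auto simp: F_def)
      also have "(\<Sum>i=1..N. LINT x|interval_measure (l i). dx l (X n) i x * cnj (F i x))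
        = (\<Sum>i=1..N. if i = j then (LINT x|interval_measure (l j). dx l (X n) j x * f x) else 0)"
      proof (intro sum.cong refl)
        fix i
        show "(LINT x|interval_measure (l i). dx l (X n) i x * cnj (F i x)) =
          (if i = j then (LINT x|interval_measure (l j). dx l (X n) j x * f x) else 0)"
        proof (cases "i = j")
          case True
          have "(LINT x|interval_measure (l j). dx l (X n) j x * cnj (F j x)) = (LINT x|interval_measure (l j). dx l (X n) j x * f x)"
            by (intro Bochner_Integration.integral_cong refl) (auto simp: F_def)
          then show ?thesis using True by simp
        qed (simp add: F_def)
      qed
      also have "\<dots> = (LINT x|interval_measure (l j). dx l (X n) j x * f x)" using j by simp
      finally show ?thesis by simp
    qed
    then show ?thesis using tendsto_minus[OF inner0[OF F]] by simp
  qed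
  have L2null: "(\<lambda>n. LINT x|interval_measure (l j). dx l (X n) j x * h x) \<longlonglongrightarrow> 0"
    if j: "j \<in> {1..N}" and h: "h \<in> L2 (l j)" for j h
  proof (rule weak_null_by_density[OF edge_pos[OF j] is_primitive_L2[OF p[OF X(1) j]] _ H1null[OF j] h])
    show "sqnorm (l j) (dx l (X n) j) \<le> M\<^sup>2" for n
      using sqnorm_dx_le[OF X(1)[of n] j] S.nrm_sq[OF X(1)[of n]] power_mono[OF X(2)[of n], of 2]
        S.nrm_nonneg[OF X(1)[of n]] by simp
  qed
  define Y where "Y j x = (LINT t|interval_measure x. cnj (y j t))" for j x
  have Yp: "is_primitive (l j) (Y j) (\<lambda>x. cnj (y j x))" "Y j 0 = 0" if j: "j \<in> {1..N}" for j
  proof -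
    have yL: "(\<lambda>x. cnj (y j x)) \<in> L2 (l j)" by (rule L2_cnj[OF is_primitive_in_L2[OF p[OF y j]]])
    show Y0: "Y j 0 = 0" unfolding Y_def
      using LINT_eq_integral[OF L2_integrable[OF yL], of 0] edge_pos[OF j] by simp
    show "is_primitive (l j) (Y j) (\<lambda>x. cnj (y j x))"
      unfolding is_primitive_def using yL Y0 by (simp add: Y_def)
  qed
  have "H1_inner N l (X n) y = (\<Sum>j=1..N. LINT x|interval_measure (l j). dx l (X n) j x * (cnj (dx l y j x) - Y j x))" for n
    unfolding H1_inner_dx[OF lpos X(1) y]
  proof (intro sum.cong refl)
    fix j assume j: "j \<in> {1..N}"
    have "(LINT x|interval_measure (l j). X n j x * cnj (y j x)) + (LINT x|interval_measure (l j). dx l (X n) j x * Y j x)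
      = X n j (l j) * Y j (l j) - X n j 0 * Y j 0"
      by (rule integration_by_parts_primitive[OF p[OF X(1) j] Yp(1)[OF j] edge_pos[OF j]])
    then have "(LINT x|interval_measure (l j). X n j x * cnj (y j x)) = - (LINT x|interval_measure (l j). dx l (X n) j x * Y j x)"
      unfolding H1e_H1(2)[OF X(1) j] Yp(2)[OF j] by (simp add: eq_neg_iff_add_eq_0)
    moreover have "(LINT x|interval_measure (l j). dx l (X n) j x * (cnj (dx l y j x) - Y j x))
       = (LINT x|interval_measure (l j). dx l (X n) j x * cnj (dx l y j x)) - (LINT x|interval_measure (l j). dx l (X n) j x * Y j x)"
      unfolding right_diff_distrib
      by (intro Bochner_Integration.integral_diff L2_mult_integrable is_primitive_L2[OF p[OF X(1) j]]
          L2_cnj is_primitive_L2[OF p[OF y j]] is_primitive_in_L2[OF Yp(1)[OF j]])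
    ultimately show "(LINT x|interval_measure (l j). X n j x * cnj (y j x)) + (LINT x|interval_measure (l j). dx l (X n) j x * cnj (dx l y j x))
      = (LINT x|interval_measure (l j). dx l (X n) j x * (cnj (dx l y j x) - Y j x))" by simp
  qed
  moreover have "(\<lambda>n. \<Sum>j=1..N. LINT x|interval_measure (l j). dx l (X n) j x * (cnj (dx l y j x) - Y j x)) \<longlonglongrightarrow> (\<Sum>j=1..N. 0)"
    by (intro tendsto_sum L2null L2_diff L2_cnj is_primitive_L2[OF p[OF y]] is_primitive_in_L2[OF Yp(1)]) auto
  ultimately have "(\<lambda>n. H1_inner N l (X n) y) \<longlonglongrightarrow> 0" by simp
  then show ?thesis unfolding H1_ip_def using tendsto_Re by fastforce
qed

end

section \<open>Imaginary eigenvalues and the edge lengths\<close>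

lemma complex_chain_derivative:
  assumes "(f has_field_derivative f') (at (of_real x))"
  shows "((\<lambda>x. f (of_real x)) has_vector_derivative f') (at x within S)"
  using assms by (rule has_vector_derivative_real_field)

lemma constant_on_interval:
  fixes f :: "real \<Rightarrow> complex"
  assumes "\<And>x. x \<in> {0..L} \<Longrightarrow> (f has_vector_derivative 0) (at x within {0..L})" "x \<in> {0..L}"
  shows "f x = f 0"
proof -
  obtain c where c: "\<And>x. x \<in> {0..L} \<Longrightarrow> f x = c"
    using has_vector_derivative_zero_constant[of "{0..L}" f] assms(1) by auto
  then show ?thesis using assms(2) c[of x] c[of 0] by simp
qed

text \<open>The two first integrals of \<open>y'' = - \<mu>\<^sup>2 y\<close> determine the solution. The frequency is complex, which
covers oscillating and exponential solutions at once.\<close>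

lemma harmonic_oscillator:
  fixes y v :: "real \<Rightarrow> complex" and \<mu> :: complex
  assumes y: "\<And>x. x \<in> {0..L} \<Longrightarrow> (y has_vector_derivative v x) (at x within {0..L})"
    and v: "\<And>x. x \<in> {0..L} \<Longrightarrow> (v has_vector_derivative - \<mu>\<^sup>2 * y x) (at x within {0..L})"
    and y0: "y 0 = 0" and x: "x \<in> {0..L}"
  shows "\<mu> * y x = v 0 * sin (\<mu> * of_real x)" "\<mu> = 0 \<Longrightarrow> y x = v 0 * of_real x"
proof -
  have c: "((\<lambda>x. cos (\<mu> * of_real x)) has_vector_derivative - sin (\<mu> * of_real x) * \<mu>) (at x within {0..L})"
    and s: "((\<lambda>x. sin (\<mu> * of_real x)) has_vector_derivative cos (\<mu> * of_real x) * \<mu>) (at x within {0..L})" for x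
    by (rule complex_chain_derivative, auto intro!: derivative_eq_intros)+
  \<comment> \<open>Two expressions with derivative zero.\<close>
  have 1: "\<mu> * y x * cos (\<mu> * of_real x) - v x * sin (\<mu> * of_real x) = 0" if "x \<in> {0..L}" for x
  proof -
    have "((\<lambda>x. \<mu> * y x * cos (\<mu> * of_real x) - v x * sin (\<mu> * of_real x)) has_vector_derivative 0) (at x within {0..L})"
      if x: "x \<in> {0..L}" for x
    proof -
      have "((\<lambda>x. \<mu> * y x * cos (\<mu> * of_real x) - v x * sin (\<mu> * of_real x)) has_vector_derivative
        ((\<mu> * y x) * (- sin (\<mu> * of_real x) * \<mu>) + (\<mu> * v x) * cos (\<mu> * of_real x))
        - (v x * (cos (\<mu> * of_real x) * \<mu>) + (- \<mu>\<^sup>2 * y x) * sin (\<mu> * of_real x))) (at x within {0..L})"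
        by (intro has_vector_derivative_diff has_vector_derivative_mult has_vector_derivative_mult_right c s y v x)
      then show ?thesis by (simp add: algebra_simps power2_eq_square)
    qed
    from constant_on_interval[OF this that] show ?thesis using y0 by simp
  qed
  have 2: "\<mu> * y x * sin (\<mu> * of_real x) + v x * cos (\<mu> * of_real x) = v 0" if "x \<in> {0..L}" for x
  proof -
    have "((\<lambda>x. \<mu> * y x * sin (\<mu> * of_real x) + v x * cos (\<mu> * of_real x)) has_vector_derivative 0) (at x within {0..L})"
      if x: "x \<in> {0..L}" for x
    proof -
      have "((\<lambda>x. \<mu> * y x * sin (\<mu> * of_real x) + v x * cos (\<mu> * of_real x)) has_vector_derivative
        ((\<mu> * y x) * (cos (\<mu> * of_real x) * \<mu>) + (\<mu> * v x) * sin (\<mu> * of_real x))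
        + (v x * (- sin (\<mu> * of_real x) * \<mu>) + (- \<mu>\<^sup>2 * y x) * cos (\<mu> * of_real x))) (at x within {0..L})"
        by (intro has_vector_derivative_add has_vector_derivative_mult has_vector_derivative_mult_right c s y v x)
      then show ?thesis by (simp add: algebra_simps power2_eq_square)
    qed
    from constant_on_interval[OF this that] show ?thesis using y0 by simp
  qed
  have "\<mu> * y x = \<mu> * y x * ((sin (\<mu> * of_real x))\<^sup>2 + (cos (\<mu> * of_real x))\<^sup>2)" by simp
  also have "\<dots> = (\<mu> * y x * cos (\<mu> * of_real x) - v x * sin (\<mu> * of_real x)) * cos (\<mu> * of_real x)
      + (\<mu> * y x * sin (\<mu> * of_real x) + v x * cos (\<mu> * of_real x)) * sin (\<mu> * of_real x)"
  proof -
    have "a * (S\<^sup>2 + C\<^sup>2) = (a * C - b * S) * C + (a * S + b * C) * S" for a b S C :: complex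
      by (simp add: algebra_simps power2_eq_square)
    then show ?thesis .
  qed
  also have "\<dots> = v 0 * sin (\<mu> * of_real x)" unfolding 1[OF x] 2[OF x] by simp
  finally show "\<mu> * y x = v 0 * sin (\<mu> * of_real x)" .
  assume \<mu>: "\<mu> = 0"
  have v0: "v x = v 0" if "x \<in> {0..L}" for x using 2[OF that] \<mu> by simp
  have "((\<lambda>x. y x - v 0 * of_real x) has_vector_derivative 0) (at x within {0..L})" if x: "x \<in> {0..L}" for x
  proof -
    have "((\<lambda>x. y x - v 0 * complex_of_real x) has_vector_derivative v x - v 0 * of_real 1) (at x within {0..L})"
      by (intro has_vector_derivative_diff y x has_vector_derivative_mult_right
          bounded_linear.has_vector_derivative[OF bounded_linear_of_real] has_vector_derivative_id)
    then show ?thesis using v0[OF x] by simp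
  qed
  from constant_on_interval[OF this x] show "y x = v 0 * of_real x" using y0 by simp
qed

lemma exp_derivative:
  fixes s :: complex
  shows "((\<lambda>x. exp (s * of_real x)) has_vector_derivative s * exp (s * of_real x)) (at x within S)"
  by (rule complex_chain_derivative) (auto intro!: derivative_eq_intros)

text \<open>The factor \<open>exp (- s x)\<close> with \<open>s = 1 / (2\<i>\<omega>)\<close> removes the first-order term and leaves
\<open>y'' = (1 + s\<^sup>2) y\<close>, where \<open>1 + s\<^sup>2 = 1 - 1 / (4\<omega>\<^sup>2)\<close>. A nonzero solution that vanishes at both ends forces
\<open>sin (\<mu> L) = 0\<close>.\<close>

lemma edge_eigenfunction:
  fixes z w :: "real \<Rightarrow> complex" and \<omega> L :: real
  assumes L: "L > 0" and \<omega>: "\<omega> \<noteq> 0"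
    and z: "\<And>x. x \<in> {0..L} \<Longrightarrow> (z has_vector_derivative w x) (at x within {0..L})"
    and w: "\<And>x. x \<in> {0..L} \<Longrightarrow> (w has_vector_derivative z x + w x / (\<i> * of_real \<omega>)) (at x within {0..L})"
    and bc: "z 0 = 0" "z L = 0"
  shows "w 0 = 0 \<Longrightarrow> x \<in> {0..L} \<Longrightarrow> z x = 0"
    "w 0 \<noteq> 0 \<Longrightarrow> \<exists>k>0. 1 / (4 * \<omega>\<^sup>2) - 1 = (real k * pi / L)\<^sup>2"
proof -
  define s where "s = 1 / (2 * (\<i> * complex_of_real \<omega>))"
  \<comment> \<open>The square of the frequency \<open>\<mu>\<close>; it may be negative.\<close>
  define m where "m = 1 / (4 * \<omega>\<^sup>2) - 1"
  define \<mu> where "\<mu> = csqrt (of_real m)"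
  have s2: "s\<^sup>2 = - of_real (1 / (4 * \<omega>\<^sup>2))"
    using \<omega> by (simp add: s_def power_divide power_mult_distrib)
  have \<mu>2: "- \<mu>\<^sup>2 = 1 + s\<^sup>2" unfolding \<mu>_def power2_csqrt s2 m_def by simp
  have ws: "w x / (\<i> * of_real \<omega>) = 2 * s * w x" for x by (simp add: s_def)
  define y where "y x = exp (- s * of_real x) * z x" for x
  define v where "v x = exp (- s * of_real x) * (w x - s * z x)" for x
  have yd: "(y has_vector_derivative v x) (at x within {0..L})" if x: "x \<in> {0..L}" for x
  proof -
    have "((\<lambda>x. exp (- s * of_real x) * z x) has_vector_derivative
      exp (- s * of_real x) * w x + (- s * exp (- s * of_real x)) * z x) (at x within {0..L})"
      by (intro has_vector_derivative_mult z[OF x] exp_derivative)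
    then show ?thesis unfolding y_def[abs_def] v_def by (simp add: algebra_simps)
  qed
  have vd: "(v has_vector_derivative - \<mu>\<^sup>2 * y x) (at x within {0..L})" if x: "x \<in> {0..L}" for x
  proof -
    have "((\<lambda>x. exp (- s * of_real x) * (w x - s * z x)) has_vector_derivative
      exp (- s * of_real x) * ((z x + 2 * s * w x) - s * w x) + (- s * exp (- s * of_real x)) * (w x - s * z x)) (at x within {0..L})"
      using w[OF x] unfolding ws
      by (intro has_vector_derivative_mult has_vector_derivative_diff has_vector_derivative_mult_right z[OF x] exp_derivative)
    moreover have "exp (- s * of_real x) * ((z x + 2 * s * w x) - s * w x) + (- s * exp (- s * of_real x)) * (w x - s * z x)
       = (1 + s\<^sup>2) * (exp (- s * of_real x) * z x)" by (simp add: algebra_simps power2_eq_square)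
    ultimately show ?thesis unfolding v_def[abs_def] y_def \<mu>2 by simp
  qed
  have y0: "y 0 = 0" by (simp add: y_def bc)
  have v0: "v 0 = w 0" by (simp add: v_def bc)
  have yL: "y L = 0" by (simp add: y_def bc)
  have ho1: "\<mu> * y x = v 0 * sin (\<mu> * of_real x)" if "x \<in> {0..L}" for x
    by (rule harmonic_oscillator(1)[OF yd vd y0 that])
  have ho2: "y x = v 0 * of_real x" if "\<mu> = 0" "x \<in> {0..L}" for x
    by (rule harmonic_oscillator(2)[OF yd vd y0 that(2,1)])
  have LL: "L \<in> {0..L}" using L by simp
  show "z x = 0" if "w 0 = 0" "x \<in> {0..L}"
  proof -
    have "y x = 0" using ho1[OF that(2)] ho2[OF _ that(2)] v0 that(1) by (cases "\<mu> = 0") auto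
    then show ?thesis by (simp add: y_def)
  qed
  assume w0: "w 0 \<noteq> 0"
  have \<mu>0: "\<mu> \<noteq> 0" using ho2[OF _ LL] yL v0 w0 L by auto
  have "sin (\<mu> * of_real L) = 0" using ho1[OF LL] yL v0 w0 by simp
  then obtain n :: int where n: "\<mu> * of_real L = of_real (of_int n * pi)" using Complex_Transcendental.sin_eq_0 by blast
  have n0: "n \<noteq> 0" using n \<mu>0 L by auto
  define k where "k = nat \<bar>n\<bar>"
  have k: "k > 0" "(real k)\<^sup>2 = (of_int n)\<^sup>2" using n0 by (auto simp: k_def)
  have "of_real m * (complex_of_real L)\<^sup>2 = (\<mu> * of_real L)\<^sup>2" by (simp add: \<mu>_def power_mult_distrib)
  also have "\<dots> = of_real ((of_int n * pi)\<^sup>2)" unfolding n by simp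
  finally have "complex_of_real (m * L\<^sup>2) = of_real ((of_int n * pi)\<^sup>2)" by simp
  then have "m * L\<^sup>2 = (of_int n * pi)\<^sup>2" unfolding of_real_eq_iff .
  then have "m = (real k * pi / L)\<^sup>2"
    using L k(2) by (simp add: power_divide power_mult_distrib field_simps)
  then show "\<exists>k>0. 1 / (4 * \<omega>\<^sup>2) - 1 = (real k * pi / L)\<^sup>2"
    unfolding m_def by (intro exI[of _ k] conjI k(1))
qed

context star_network begin

text \<open>On an edge where the derivative at the node vanishes, the eigenfunction is zero. The derivatives at the
node have sum zero, so if one is nonzero then so is another, and \<open>edge_eigenfunction\<close> on these two
edges gives the same number \<open>k / l\<^sub>j = k' / l\<^sub>i\<close>.\<close>

lemma no_imaginary_eigenvalue:
  assumes irr: "\<forall>i\<in>{1..N}. \<forall>j\<in>{1..N}. i \<noteq> j \<longrightarrow> l i / l j \<notin> \<rat>"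
    and \<omega>: "\<omega> \<noteq> 0" and z: "z \<in> H1e N l" and node: "z 1 0 = 0"
    and eig: "A z = cscale (\<i> * of_real \<omega>) z"
  shows "z = 0"
proof -
  define c where "c = \<i> * complex_of_real \<omega>"
  have c0: "c \<noteq> 0" using \<omega> by (simp add: c_def)
  note nw = continuous_network_H1e[OF z]
  define w where "w j x = bvp_deriv z 0 j x / c" for j x
  have K: "bvp_sol z 0 j = (\<lambda>x. c * z j x)" for j
    using eig node by (simp add: A_def cscale_def c_def fun_eq_iff)
  have zw: "is_primitive (l j) (z j) (w j)" if j: "j \<in> {1..N}" for j
    using is_primitive_cmult[OF bvp_sol_primitive(1)[OF nw j, of 0], of "1 / c"] c0
    unfolding K w_def[abs_def] by simp
  have ww: "is_primitive (l j) (w j) (\<lambda>x. z j x + w j x / c)" if j: "j \<in> {1..N}" for j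
    using is_primitive_cmult[OF bvp_sol_primitive(2)[OF nw j zw[OF j], of 0], of "1 / c"] c0
    unfolding K w_def[abs_def] by (simp add: distrib_left add.commute)
  have wc: "continuous_on {0..l j} (w j)" and zc: "continuous_on {0..l j} (z j)" if j: "j \<in> {1..N}" for j
    using is_primitive_continuous[OF ww[OF j]] is_primitive_continuous[OF zw[OF j]] by auto
  have zd: "(z j has_vector_derivative w j x) (at x within {0..l j})" if "j \<in> {1..N}" "x \<in> {0..l j}" for j x
    by (rule is_primitive_has_derivative[OF zw[OF that(1)] wc[OF that(1)] that(2)])
  have wd: "(w j has_vector_derivative z j x + w j x / (\<i> * of_real \<omega>)) (at x within {0..l j})" if j: "j \<in> {1..N}" and x: "x \<in> {0..l j}" for j x
    unfolding c_def[symmetric]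
    by (rule is_primitive_has_derivative[OF ww[OF j] _ x]) (use c0 in \<open>auto intro!: continuous_intros wc zc j\<close>)
  have bc: "z j 0 = 0" "z j (l j) = 0" if j: "j \<in> {1..N}" for j
    using H1e_H1(2,3)[OF z j] node by auto
  have edge1: "z j x = 0" if j: "j \<in> {1..N}" and "w j 0 = 0" "x \<in> {0..l j}" for j x
    by (rule edge_eigenfunction(1)[OF edge_pos[OF j] \<omega> zd[OF j] wd[OF j] bc[OF j] that(2,3)])
  have edge2: "\<exists>k>0. 1 / (4 * \<omega>\<^sup>2) - 1 = (real k * pi / l j)\<^sup>2"
    if j: "j \<in> {1..N}" and "w j 0 \<noteq> 0" for j
    by (rule edge_eigenfunction(2)[OF edge_pos[OF j] \<omega> zd[OF j] wd[OF j] bc[OF j] that(2)])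
  have flux: "(\<Sum>j=1..N. w j 0) = 0"
    using bvp_sol_flux[OF nw, of 0] by (simp add: w_def sum_divide_distrib[symmetric])
  have w0: "w j 0 = 0" if j: "j \<in> {1..N}" for j
  proof (rule ccontr)
    assume wj: "w j 0 \<noteq> 0"
    have "\<exists>i\<in>{1..N}. i \<noteq> j \<and> w i 0 \<noteq> 0"
    proof (rule ccontr)
      assume "\<not> ?thesis"
      then have "(\<Sum>i\<in>{1..N} - {j}. w i 0) = 0" by (intro sum.neutral) auto
      then show False using flux wj j sum.remove[of "{1..N}" j "\<lambda>i. w i 0"] by simp
    qed
    then obtain i where i: "i \<in> {1..N}" "i \<noteq> j" "w i 0 \<noteq> 0" by blast
    obtain p where p: "p > 0" "1 / (4 * \<omega>\<^sup>2) - 1 = (real p * pi / l i)\<^sup>2"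
      using edge2[OF i(1,3)] by (elim exE conjE)
    obtain q where q: "q > 0" "1 / (4 * \<omega>\<^sup>2) - 1 = (real q * pi / l j)\<^sup>2"
      using edge2[OF j wj] by (elim exE conjE)
    have "real p * pi / l i = real q * pi / l j"
    proof (rule power2_eq_imp_eq)
      show "(real p * pi / l i)\<^sup>2 = (real q * pi / l j)\<^sup>2" using p(2) q(2) by simp
    qed (use edge_pos[OF i(1)] edge_pos[OF j] in auto)
    then have "real p * l j = real q * l i" using edge_pos[OF i(1)] edge_pos[OF j] by (simp add: field_simps)
    then have "l i / l j = real p / real q" using edge_pos[OF j] q(1) by (simp add: field_simps)
    then have "l i / l j \<in> \<rat>" by simp
    then show False using irr i j by blast
  qed
  have "z j x = 0" for j x
  proof (cases "j \<in> {1..N}")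
    case True
    show ?thesis
    proof (cases "x \<in> {0..l j}")
      case x: True
      show ?thesis by (rule edge1[OF True w0[OF True] x])
    next
      case False
      then show ?thesis by (rule H1_outside[OF H1e_H1(1)[OF z True]])
    qed
  next
    case False
    then show ?thesis using H1e_outside[OF z] by simp
  qed
  then show ?thesis by (simp add: fun_eq_iff)
qed

lemma energy_zero_node:
  assumes u: "u \<in> H1e N l" and e: "H1_ip N l (A u) u = 0"
  shows "u 1 0 = 0"
proof -
  have "\<alpha> - real N / 2 > 0" using \<alpha> by simp
  then have "(cmod (u 1 0))\<^sup>2 = 0" using e A_energy[OF u] by simp
  then show ?thesis by simp
qed

text \<open>If \<open>A\<^sup>2 x = - \<mu>\<^sup>2 x\<close> then \<open>x \<mp> \<i> A x / \<mu>\<close> are eigenvectors of \<open>A\<close> for \<open>\<plusminus>\<i>\<mu>\<close> unless they are zero, and their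
sum is \<open>2 x\<close>.\<close>

lemma stable_if_irrational:
  assumes irr: "\<forall>i\<in>{1..N}. \<forall>j\<in>{1..N}. i \<noteq> j \<longrightarrow> l i / l j \<notin> \<rat>"
  shows "strongly_stable N l \<alpha>"
  unfolding strongly_stable_iff
proof (intro ballI S.strong_stability weak_null)
  fix x :: network_fun and \<mu> :: real
  assume x: "x \<in> H1e N l" and \<mu>: "\<mu> > 0" and AA: "A (A x) = - (\<mu>\<^sup>2) *\<^sub>R x"
    and e: "H1_ip N l (A x) x = 0" "H1_ip N l (A (A x)) (A x) = 0"
  have nodes: "x 1 0 = 0" "A x 1 0 = 0"
    using energy_zero_node[OF x e(1)] energy_zero_node[OF A_H1e[OF x] e(2)] by auto
  have zero: "x + cscale (- \<i> / of_real \<omega>) (A x) = 0" if \<omega>: "\<omega>\<^sup>2 = \<mu>\<^sup>2" "\<omega> \<noteq> 0" for \<omega> :: real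
  proof (rule no_imaginary_eigenvalue[OF irr \<omega>(2)])
    note Ax = A_H1e[OF x]
    show "x + cscale (- \<i> / of_real \<omega>) (A x) \<in> H1e N l"
      by (intro H1e_add[OF lpos] H1e_cscale[OF lpos] x Ax)
    show "(x + cscale (- \<i> / of_real \<omega>) (A x)) 1 0 = 0"
      using nodes by (simp add: cscale_def)
    have "A (x + cscale (- \<i> / of_real \<omega>) (A x)) = A x + cscale (- \<i> / of_real \<omega>) (- (\<mu>\<^sup>2) *\<^sub>R x)"
      using A_add[OF x H1e_cscale[OF lpos Ax]] A_cscale[OF Ax] AA by simp
    also have "\<dots> = cscale (\<i> * of_real \<omega>) (x + cscale (- \<i> / of_real \<omega>) (A x))"
      using \<omega>(2) unfolding \<omega>(1)[symmetric]
      by (simp add: fun_eq_iff cscale_def scaleR_conv_of_real field_simps power2_eq_square)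
    finally show "A (x + cscale (- \<i> / of_real \<omega>) (A x)) = cscale (\<i> * of_real \<omega>) (x + cscale (- \<i> / of_real \<omega>) (A x))" .
  qed
  have "x + cscale (- \<i> / of_real \<mu>) (A x) = 0" "x + cscale (- \<i> / of_real (- \<mu>)) (A x) = 0"
    using zero[of \<mu>] zero[of "- \<mu>"] \<mu> by auto
  then have "x + x = 0" by (simp add: fun_eq_iff cscale_def)
  then show "x = 0" by (simp add: fun_eq_iff)
qed

text \<open>For \<open>l\<^sub>i / l\<^sub>j = a / b\<close> the wave number \<open>\<kappa> = a\<pi> / l\<^sub>i = b\<pi> / l\<^sub>j\<close> fits both edges. The function
\<open>exp (s x) sin (\<kappa> x)\<close> on edge \<open>i\<close>, its negative on edge \<open>j\<close> and zero elsewhere has total flux zero and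
is an eigenfunction.\<close>

lemma unstable_if_rational:
  assumes i: "i \<in> {1..N}" and j: "j \<in> {1..N}" and ij: "i \<noteq> j" and rat: "l i / l j \<in> \<rat>"
  shows "\<not> strongly_stable N l \<alpha>"
proof -
  have pos: "l i / l j > 0" using edge_pos[OF i] edge_pos[OF j] by simp
  obtain a b :: nat where ab: "b \<noteq> 0" "\<bar>l i / l j\<bar> = real a / real b"
    using Rats_abs_nat_div_natE[OF rat] by metis
  have ab': "l i / l j = real a / real b" using ab(2) unfolding abs_of_pos[OF pos] .
  have ab_pos: "a > 0" "b > 0" using pos ab(1) unfolding ab' by (auto intro: gr0I)
  define \<kappa> where "\<kappa> = real a * pi / l i"
  have \<kappa>i: "\<kappa> * l i = real a * pi" using edge_pos[OF i] by (simp add: \<kappa>_def)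
  have \<kappa>j: "\<kappa> * l j = real b * pi"
    using ab' ab_pos edge_pos[OF i] edge_pos[OF j] by (simp add: \<kappa>_def field_simps)
  define \<omega> where "\<omega> = 1 / (2 * sqrt (1 + \<kappa>\<^sup>2))"
  have \<omega>: "\<omega> > 0" by (simp add: \<omega>_def add_pos_nonneg)
  have \<omega>2: "1 / (4 * \<omega>\<^sup>2) = 1 + \<kappa>\<^sup>2"
    by (simp add: \<omega>_def power_divide power_mult_distrib add_nonneg_nonneg)
  define c where "c = \<i> * complex_of_real \<omega>"
  have c0: "c \<noteq> 0" using \<omega> by (simp add: c_def)
  define s where "s = 1 / (2 * c)"
  have s2: "s\<^sup>2 = - of_real (1 + \<kappa>\<^sup>2)"
  proof -
    have "s\<^sup>2 = - of_real (1 / (4 * \<omega>\<^sup>2))" by (simp add: s_def c_def power_divide power_mult_distrib)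
    then show ?thesis unfolding \<omega>2 .
  qed
  have cs: "2 * c * s = 1" using c0 by (simp add: s_def)
  define E where "E x = exp (s * complex_of_real x)" for x
  define sn where "sn x = sin (of_real \<kappa> * complex_of_real x)" for x
  define cn where "cn x = cos (of_real \<kappa> * complex_of_real x)" for x
  have Ed: "(E has_vector_derivative s * E x) (at x within S)" for x S
    unfolding E_def[abs_def] by (rule exp_derivative)
  have snd: "(sn has_vector_derivative cn x * of_real \<kappa>) (at x within S)" for x S
    unfolding sn_def[abs_def] cn_def by (rule complex_chain_derivative) (auto intro!: derivative_eq_intros)
  have cnd: "(cn has_vector_derivative - sn x * of_real \<kappa>) (at x within S)" for x S
    unfolding cn_def[abs_def] sn_def by (rule complex_chain_derivative) (auto intro!: derivative_eq_intros)
  define f0 where "f0 x = E x * sn x" for x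
  define f1 where "f1 x = E x * (s * sn x + of_real \<kappa> * cn x)" for x
  define f2 where "f2 x = E x * ((s\<^sup>2 - (of_real \<kappa>)\<^sup>2) * sn x + 2 * s * of_real \<kappa> * cn x)" for x
  have f0d: "(f0 has_vector_derivative f1 x) (at x within S)" for x S
  proof -
    have "((\<lambda>x. E x * sn x) has_vector_derivative E x * (cn x * of_real \<kappa>) + (s * E x) * sn x) (at x within S)"
      by (intro has_vector_derivative_mult Ed snd)
    then show ?thesis unfolding f0_def[abs_def] f1_def by (simp add: algebra_simps)
  qed
  have f1d: "(f1 has_vector_derivative f2 x) (at x within S)" for x S
  proof -
    have "((\<lambda>x. E x * (s * sn x + of_real \<kappa> * cn x)) has_vector_derivative
      E x * (s * (cn x * of_real \<kappa>) + of_real \<kappa> * (- sn x * of_real \<kappa>)) + (s * E x) * (s * sn x + of_real \<kappa> * cn x)) (at x within S)"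
      by (intro has_vector_derivative_mult has_vector_derivative_add has_vector_derivative_mult_right Ed snd cnd)
    then show ?thesis unfolding f1_def[abs_def] f2_def by (simp add: algebra_simps power2_eq_square)
  qed
  have ode: "c * f0 x - c * f2 x = - f1 x" for x
  proof -
    have k2: "(complex_of_real \<kappa>)\<^sup>2 = - s\<^sup>2 - 1" unfolding s2 by simp
    have "c * f0 x - c * f2 x + f1 x = E x * ((c - c * (s\<^sup>2 - (of_real \<kappa>)\<^sup>2) + s) * sn x + (1 - 2 * c * s) * of_real \<kappa> * cn x)"
      by (simp add: f0_def f1_def f2_def algebra_simps)
    also have "c - c * (s\<^sup>2 - (of_real \<kappa>)\<^sup>2) + s = s * (1 - 2 * c * s)"
      unfolding k2 by (simp add: algebra_simps power2_eq_square)
    finally show ?thesis unfolding cs by (simp add: add_eq_0_iff)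
  qed
  have cont: "continuous_on S f0" "continuous_on S f1" "continuous_on S f2" for S
  proof -
    have "continuous_on S E" "continuous_on S sn" "continuous_on S cn" for S
      unfolding E_def[abs_def] sn_def[abs_def] cn_def[abs_def] by (auto intro!: continuous_intros)
    then show "continuous_on S f0" "continuous_on S f1" "continuous_on S f2"
      unfolding f0_def[abs_def] f1_def[abs_def] f2_def[abs_def] by (auto intro!: continuous_intros)
  qed
  have p01: "is_primitive L f0 f1" and p12: "is_primitive L f1 f2" for L
    by (intro is_primitive_C1 f0d f1d cont)+
  define \<sigma> where "\<sigma> k = (if k = i then 1 else if k = j then -1 else 0 :: complex)" for k
  define Z where "Z = (\<lambda>k x. if k \<in> {1..N} \<and> x \<in> {0..l k} then \<sigma> k * f0 x else 0)"
  have Zp: "is_primitive (l k) (Z k) (\<lambda>x. \<sigma> k * f1 x)" if k: "k \<in> {1..N}" for k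
    by (rule is_primitive_cong[OF is_primitive_cmult[OF p01] _ L2_continuous])
       (use k in \<open>auto simp: Z_def intro!: continuous_intros cont\<close>)
  have Z: "Z \<in> H1e N l"
  proof (rule H1eI)
    fix k assume k: "k \<in> {1..N}"
    show "Z k \<in> H1 (l k)" by (rule H1I[OF edge_pos[OF k] Zp[OF k]]) (auto simp: Z_def)
    have "sn (l i) = 0" "sn (l j) = 0"
      unfolding sn_def of_real_mult[symmetric] \<kappa>i \<kappa>j
      unfolding sin_of_real by (simp_all add: sin_npi mult.commute)
    then show "Z k (l k) = 0" by (auto simp: Z_def f0_def \<sigma>_def)
    show "Z k 0 = 0" by (simp add: Z_def f0_def sn_def)
  qed (auto simp: Z_def)
  have Z10: "Z 1 0 = 0" by (simp add: Z_def f0_def sn_def)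
  have sum\<sigma>: "(\<Sum>k=1..N. \<sigma> k) = 0"
  proof -
    have "(\<Sum>k=1..N. \<sigma> k) = (\<Sum>k=1..N. (if k = i then 1 else 0) + (if k = j then -1 else 0))"
      using ij by (intro sum.cong) (auto simp: \<sigma>_def)
    then show ?thesis using i j by (simp add: sum.distrib)
  qed
  have AZ: "A Z = cscale c Z"
  proof (rule H1e_eqI[OF lpos A_H1e[OF Z] H1e_cscale[OF lpos Z]])
    fix f assume f: "f \<in> H1e N l"
    have g: "is_primitive (l k) (cscale c Z k) (\<lambda>x. (c * \<sigma> k) * f1 x)" if "k \<in> {1..N}" for k
      using is_primitive_cmult[OF Zp[OF that], of c] by (simp add: cscale_def mult.assoc)
    have "H1_inner N l (cscale c Z) f = (\<Sum>k=1..N. LINT x|interval_measure (l k). (cscale c Z k x - (c * \<sigma> k) * f2 x) * cnj (f k x))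
     - (\<Sum>k=1..N. (c * \<sigma> k) * f1 0) * cnj (f 1 0)"
      by (rule variational_form[OF lpos H1e_cscale[OF lpos Z] f g is_primitive_cmult[OF p12]])
    also have "(\<Sum>k=1..N. (c * \<sigma> k) * f1 0) = 0"
      using sum\<sigma> by (simp add: sum_distrib_right[symmetric] sum_distrib_left[symmetric])
    also have "(\<Sum>k=1..N. LINT x|interval_measure (l k). (cscale c Z k x - (c * \<sigma> k) * f2 x) * cnj (f k x))
      = (\<Sum>k=1..N. LINT x|interval_measure (l k). - (\<sigma> k * f1 x * cnj (f k x)))"
    proof (intro sum.cong refl Bochner_Integration.integral_cong)
      fix k x assume "k \<in> {1..N}" "x \<in> space (interval_measure (l k))"
      then have "cscale c Z k x - (c * \<sigma> k) * f2 x = \<sigma> k * (c * f0 x - c * f2 x)"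
        by (auto simp: cscale_def Z_def algebra_simps)
      then show "(cscale c Z k x - (c * \<sigma> k) * f2 x) * cnj (f k x) = - (\<sigma> k * f1 x * cnj (f k x))"
        unfolding ode by simp
    qed
    finally have "H1_inner N l (cscale c Z) f = - (\<Sum>k=1..N. LINT x|interval_measure (l k). \<sigma> k * f1 x * cnj (f k x))"
      by (simp add: sum_negf)
    moreover have "H1_inner N l (A Z) f = - (\<Sum>k=1..N. LINT x|interval_measure (l k). \<sigma> k * f1 x * cnj (f k x))
      - of_real \<alpha> * Z 1 0 * cnj (f 1 0)"
      by (rule A_variational[OF Z f Zp])
    ultimately show "H1_inner N l (A Z) f = H1_inner N l (cscale c Z) f" using Z10 by simp
  qed
  have Z0: "Z \<noteq> 0"
  proof
    assume "Z = 0"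
    \<comment> \<open>A quarter of the wavelength, where the sine equals one.\<close>
    define x where "x = l i / (2 * real a)"
    have x: "x \<in> {0..l i}" using edge_pos[OF i] ab_pos(1) by (auto simp: x_def field_simps)
    have "\<kappa> * x = pi / 2" using edge_pos[OF i] ab_pos(1) by (simp add: x_def \<kappa>_def)
    then have "sin (\<kappa> * x) = 1" by (simp only: sin_pi_half)
    then have "sn x = 1" unfolding sn_def of_real_mult[symmetric] sin_of_real by simp
    then have "Z i x \<noteq> 0" using i x by (simp add: Z_def f0_def E_def \<sigma>_def)
    then show False using \<open>Z = 0\<close> by simp
  qed
  have iZ: "cscale \<i> Z \<in> H1e N l" by (rule H1e_cscale[OF lpos Z])
  have "A Z = \<omega> *\<^sub>R cscale \<i> Z" unfolding AZ
    by (simp add: fun_eq_iff cscale_def c_def scaleR_conv_of_real)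
  moreover have "A (cscale \<i> Z) = - \<omega> *\<^sub>R Z"
    unfolding A_cscale[OF Z] AZ
    by (simp add: fun_eq_iff cscale_def c_def scaleR_conv_of_real mult.assoc[symmetric])
  ultimately have "\<not> ((\<lambda>t. S.nrm (S.flow t Z)) \<longlongrightarrow> 0) at_top"
    by (rule S.oscillation_unstable[OF Z Z0 iZ])
  then show ?thesis unfolding strongly_stable_iff using Z by blast
qed

end

theorem theorem4p2:
  fixes N :: nat and l :: "nat \<Rightarrow> real" and \<alpha> :: real
  assumes "N \<ge> 1"
    and "\<forall>j\<in>{1..N}. l j > 0"
    and "\<alpha> > real N / 2"
  shows "strongly_stable N l \<alpha> \<longleftrightarrow>
    (\<forall>i\<in>{1..N}. \<forall>j\<in>{1..N}. i \<noteq> j \<longrightarrow> l i / l j \<notin> \<rat>)"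
proof -
  interpret star_network N l \<alpha> using assms by unfold_locales
  show ?thesis using stable_if_irrational unstable_if_rational by blast
qed

end
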